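(* Let $n\ge 2$, let $G_1$ be a subgroup of $SL_{n-1}(\mathbb{F}_q)$, acting on $P_{n-1}=\mathbb{F}_q[x_2,\dots,x_n]$ and on $P_{n-1}\otimes E_{n-1}$, where $E_{n-1}=\Lambda(dx_2,\dots,dx_n)$, and let $G\subset SL_n(\mathbb{F}_q)$ be the subgroup of all matrices $$\begin{pmatrix}1&m\\0&g_1\end{pmatrix},\qquad g_1\in G_1,\ m\in M_{1,n-1}(\mathbb{F}_q).$$ Suppose that the ring of invariants $P_{n-1}^{G_1}$ is a polynomial algebra generated by homogeneous polynomials $f_2,\dots,f_n$ in the $(n-1)$ variables $x_2,\dots,x_n$, and suppose that the ring of invariants $(P_{n-1}\otimes E_{n-1})^{G_1}$ is a free $P_{n-1}^{G_1}$-module with a basis $\{v_i\}$, $i=1,\dots,2^{n-1}$. Then the ring of invariants $(P_n\otimes E_n)^G$ is a free $P_n^G$-module with the basis $$\{v_i : 1\le i\le 2^{n-1}\}\cup\{Q_I\,dx_1\cdots dx_n : I\in A_{n-1}\}.$$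
   Context: Let $p$ be an odd prime, $q$ a power of $p$. $P_n=\mathbb{F}_q[x_1,\dots,x_n]$; $E_n=\Lambda(dx_1,\dots,dx_n)$ is the exterior algebra over $\mathbb{F}_q$, with $E_n^r=\Lambda^r(dx_1,\dots,dx_n)$. $P_n\otimes E_n$ is graded by $\deg x_i=2$, $\deg dx_i=1$. $P_{n-1}\otimes E_{n-1}$ is viewed as the subalgebra of $P_n\otimes E_n$ generated by $x_2,\dots,x_n,dx_2,\dots,dx_n$. $M_{1,n-1}(\mathbb{F}_q)$ is the set of $1\times(n-1)$ matrices over $\mathbb{F}_q$. Action: for $g\in GL_n(\mathbb{F}_q)$, $g x_i=\sum_{j} a_{i,j}(g^{-1})x_j$, $g\,dx_i=\sum_j a_{i,j}(g^{-1})dx_j$, $g(xy)=g(x)g(y)$, where $a_{i,j}(g^{-1})$ is the $(i,j)$ entry of $g^{-1}$; $g_1\in GL_{n-1}(\mathbb{F}_q)$ acts on $P_{n-1}\otimes E_{n-1}$ by the same formula with indices $2,\dots,n$, i.e. as the block matrix $\begin{pmatrix}1&0\\0&g_1\end{pmatrix}$. Milnor operations: for $j\ge 0$, $Q_j:P_n\otimes E_n^r\to P_n\otimes E_n^{r-1}$ is the $P_n$-linear derivation determined by $Q_j(xy)=(Q_jx)y+(-1)^{\deg x}x(Q_jy)$, $Q_j\,dx_i=x_i^{q^j}$, $Q_jx_i=0$. For $I=\{i_1<\dots<i_r\}$, $Q_I=Q_{i_1}\cdots Q_{i_r}$, and $Q_\emptyset=1$. $A_{n-1}$ is the set of all subsets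 of $\{0,1,\dots,n-2\}$. *)

theory Defs
  imports
    "HOL-Library.Poly_Mapping"
    "HOL-Algebra.Group"
    "Jordan_Normal_Form.Determinant"
begin

section \<open>The exterior algebra\<close>

text \<open>
  \<open>'r exterior\<close> is the exterior algebra over \<open>'r\<close> on generators \<open>dx i\<close>, \<open>i :: nat\<close>. An element is
  the family of its coordinates with respect to the basis
  \<open>dx i\<^sub>1 * \<dots> * dx i\<^sub>r\<close>, \<open>I = {i\<^sub>1 < \<dots> < i\<^sub>r}\<close>; almost all coordinates vanish, and only
  finite \<open>I\<close> occur.
\<close>

typedef (overloaded) 'r exterior =
  "{w :: nat set \<Rightarrow> 'r::zero. \<exists>N. \<forall>I. w I \<noteq> 0 \<longrightarrow> I \<subseteq> {..<N}}"
  morphisms ecoeff Abs_exterior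
  by (rule exI[of _ "\<lambda>_. 0"]) auto

setup_lifting type_definition_exterior

lemma exterior_eqI: "(\<And>I. ecoeff u I = ecoeff v I) \<Longrightarrow> u = v"
  using ecoeff_inject[of u v] by (simp add: fun_eq_iff)

lemma ecoeff_bound: "\<exists>N. \<forall>I. ecoeff w I \<noteq> 0 \<longrightarrow> I \<subseteq> {..<N}"
  using ecoeff[of w] by simp

lemma ecoeff_infinite: "infinite I \<Longrightarrow> ecoeff w I = 0"
proof (rule ccontr)
  assume "infinite I" "ecoeff w I \<noteq> 0"
  obtain N where "\<forall>I. ecoeff w I \<noteq> 0 \<longrightarrow> I \<subseteq> {..<N}" using ecoeff_bound[of w] ..
  then have "I \<subseteq> {..<N}" using \<open>ecoeff w I \<noteq> 0\<close> by simp
  then show False using \<open>infinite I\<close> finite_subset by auto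
qed

lemma finite_ecoeff_support [simp]: "finite {I. ecoeff w I \<noteq> 0}"
proof -
  obtain N where "\<forall>I. ecoeff w I \<noteq> 0 \<longrightarrow> I \<subseteq> {..<N}" using ecoeff_bound[of w] ..
  then have "{I. ecoeff w I \<noteq> 0} \<subseteq> Pow {..<N}"
    by (simp add: subset_eq)
  then show ?thesis by (rule finite_subset) simp
qed

instantiation exterior :: (ab_group_add) ab_group_add
begin

lift_definition zero_exterior :: "'a exterior" is "\<lambda>_. 0" by simp

lift_definition plus_exterior :: "'a exterior \<Rightarrow> 'a exterior \<Rightarrow> 'a exterior"
  is "\<lambda>u v I. u I + v I"
proof -
  fix u v :: "nat set \<Rightarrow> 'a"
  assume u: "\<exists>N. \<forall>I. u I \<noteq> 0 \<longrightarrow> I \<subseteq> {..<N}"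
    and v: "\<exists>N. \<forall>I. v I \<noteq> 0 \<longrightarrow> I \<subseteq> {..<N}"
  obtain M where M: "\<forall>I. u I \<noteq> 0 \<longrightarrow> I \<subseteq> {..<M}" using u ..
  obtain N where N: "\<forall>I. v I \<noteq> 0 \<longrightarrow> I \<subseteq> {..<N}" using v ..
  have "I \<subseteq> {..<max M N}" if "u I + v I \<noteq> 0" for I
  proof (cases "u I = 0")
    case True
    then have "I \<subseteq> {..<N}" using N that by simp
    then show ?thesis by (rule order_trans) simp
  next
    case False
    then have "I \<subseteq> {..<M}" using M by simp
    then show ?thesis by (rule order_trans) simp
  qed
  then show "\<exists>N. \<forall>I. u I + v I \<noteq> 0 \<longrightarrow> I \<subseteq> {..<N}" by (intro exI allI impI)
qed

lift_definition uminus_exterior :: "'a exterior \<Rightarrow> 'a exterior" is "\<lambda>u I. - u I" by simp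

definition minus_exterior :: "'a exterior \<Rightarrow> 'a exterior \<Rightarrow> 'a exterior"
  where "minus_exterior u v = u + - v"

instance
proof
  fix a b c :: "'a exterior"
  show "a + b + c = a + (b + c)" by transfer (simp add: add.assoc)
  show "a + b = b + a" by transfer (simp add: add.commute)
  show "0 + a = a" by transfer simp
  show "- a + a = 0" by transfer simp
  show "a - b = a + - b" by (rule minus_exterior_def)
qed

end

lemma ecoeff_zero [simp]: "ecoeff 0 I = 0" by transfer simp
lemma ecoeff_plus [simp]: "ecoeff (u + v) I = ecoeff u I + ecoeff v I" by transfer simp
lemma ecoeff_uminus [simp]: "ecoeff (- u) I = - ecoeff u I" by transfer simp
lemma ecoeff_minus [simp]: "ecoeff (u - v) I = ecoeff u I - ecoeff v I"
  by (simp only: minus_exterior_def ecoeff_plus ecoeff_uminus diff_conv_add_uminus)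
lemma ecoeff_sum [simp]: "ecoeff (\<Sum>a\<in>A. f a) I = (\<Sum>a\<in>A. ecoeff (f a) I)"
  by (induction A rule: infinite_finite_induct) auto

text \<open>For disjoint \<open>I\<close> and \<open>J\<close>, \<open>shuffle_sign I J\<close> is the sign in
  \<open>dx\<^sub>I * dx\<^sub>J = \<plusminus> dx\<^sub>I\<^sub>\<union>\<^sub>J\<close>.\<close>

definition shuffle_sign :: "nat set \<Rightarrow> nat set \<Rightarrow> 'r::comm_ring_1" where
  "shuffle_sign I J = (- 1) ^ card {(a, b). a \<in> I \<and> b \<in> J \<and> b < a}"

lemma shuffle_sign_empty [simp]: "shuffle_sign {} J = 1" "shuffle_sign I {} = 1"
  by (simp_all add: shuffle_sign_def)

lemma finite_inversions: "finite I \<Longrightarrow> finite J \<Longrightarrow> finite {(a, b). a \<in> I \<and> b \<in> J \<and> b < (a::nat)}"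
  by (rule finite_subset[of _ "I \<times> J"]) auto

lemma shuffle_sign_Un_left:
  assumes "finite I" "finite I'" "finite J" "I \<inter> I' = {}"
  shows "shuffle_sign (I \<union> I') J = (shuffle_sign I J * shuffle_sign I' J :: 'r::comm_ring_1)"
proof -
  let ?S = "\<lambda>I. {(a, b). a \<in> I \<and> b \<in> J \<and> b < a}"
  have "?S (I \<union> I') = ?S I \<union> ?S I'" by auto
  moreover have "card (?S I \<union> ?S I') = card (?S I) + card (?S I')"
    by (rule card_Un_disjoint) (use assms finite_inversions in auto)
  ultimately show ?thesis by (simp add: shuffle_sign_def power_add)
qed

lemma shuffle_sign_Un_right:
  assumes "finite I" "finite J" "finite J'" "J \<inter> J' = {}"
  shows "shuffle_sign I (J \<union> J') = (shuffle_sign I J * shuffle_sign I J' :: 'r::comm_ring_1)"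
proof -
  let ?S = "\<lambda>J. {(a, b). a \<in> I \<and> b \<in> J \<and> b < a}"
  have "?S (J \<union> J') = ?S J \<union> ?S J'" by auto
  moreover have "card (?S J \<union> ?S J') = card (?S J) + card (?S J')"
    by (rule card_Un_disjoint) (use assms finite_inversions in auto)
  ultimately show ?thesis by (simp add: shuffle_sign_def power_add)
qed

instantiation exterior :: (comm_ring_1) ring_1
begin

lift_definition one_exterior :: "'a exterior" is "\<lambda>I. if I = {} then 1 else 0"
  by (rule exI[of _ 0]) auto

lift_definition times_exterior :: "'a exterior \<Rightarrow> 'a exterior \<Rightarrow> 'a exterior"
  is "\<lambda>u v K. \<Sum>I\<in>Pow K. shuffle_sign I (K - I) * u I * v (K - I)"
proof -
  fix u v :: "nat set \<Rightarrow> 'a"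
  assume u: "\<exists>N. \<forall>I. u I \<noteq> 0 \<longrightarrow> I \<subseteq> {..<N}"
    and v: "\<exists>N. \<forall>I. v I \<noteq> 0 \<longrightarrow> I \<subseteq> {..<N}"
  obtain M where M: "\<forall>I. u I \<noteq> 0 \<longrightarrow> I \<subseteq> {..<M}" using u ..
  obtain N where N: "\<forall>I. v I \<noteq> 0 \<longrightarrow> I \<subseteq> {..<N}" using v ..
  have "K \<subseteq> {..<max M N}"
    if nz: "(\<Sum>I\<in>Pow K. shuffle_sign I (K - I) * u I * v (K - I)) \<noteq> 0" for K
  proof -
    obtain I where "I \<in> Pow K" "shuffle_sign I (K - I) * u I * v (K - I) \<noteq> 0"
      using nz by (rule sum.not_neutral_contains_not_neutral)
    then have "I \<subseteq> K" "u I \<noteq> 0" "v (K - I) \<noteq> 0" by auto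
    then have "I \<subseteq> {..<M}" "K - I \<subseteq> {..<N}" using M N by simp_all
    then have "I \<union> (K - I) \<subseteq> {..<M} \<union> {..<N}" by (rule Un_mono)
    then show ?thesis using \<open>I \<subseteq> K\<close> by (simp add: Un_absorb1 ivl_disj_un_singleton subset_iff less_max_iff_disj)
  qed
  then show "\<exists>N. \<forall>K. (\<Sum>I\<in>Pow K. shuffle_sign I (K - I) * u I * v (K - I)) \<noteq> 0 \<longrightarrow> K \<subseteq> {..<N}"
    by (intro exI allI impI)
qed

instance
proof
  fix u v w :: "'a exterior"
  show "u * v * w = u * (v * w)"
  proof (rule exterior_eqI)
    fix K
    show "ecoeff (u * v * w) K = ecoeff (u * (v * w)) K"
    proof (cases "finite K")
      case False
      then show ?thesis by (simp add: ecoeff_infinite)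
    next
      case True
      let ?f = "\<lambda>I J M. shuffle_sign I J * shuffle_sign I M * shuffle_sign J M
                 * ecoeff u I * ecoeff v J * ecoeff w M"
      have fin: "I \<subseteq> K \<Longrightarrow> finite I" for I using True by (rule rev_finite_subset)
      have "ecoeff (u * v * w) K = (\<Sum>L\<in>Pow K. shuffle_sign L (K - L) *
          (\<Sum>I\<in>Pow L. shuffle_sign I (L - I) * ecoeff u I * ecoeff v (L - I)) * ecoeff w (K - L))"
        by (simp add: times_exterior.rep_eq)
      also have "\<dots> = (\<Sum>L\<in>Pow K. \<Sum>I\<in>Pow L. ?f I (L - I) (K - L))"
      proof (rule sum.cong[OF refl])
        fix L assume L: "L \<in> Pow K"
        have "shuffle_sign L (K - L) =
                (shuffle_sign I (K - L) * shuffle_sign (L - I) (K - L) :: 'a)" if "I \<in> Pow L" for I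
        proof -
          have "L = I \<union> (L - I)" using that by auto
          then show ?thesis using shuffle_sign_Un_left[of I "L - I" "K - L"] L that fin True
            by (metis Diff_disjoint PowD dual_order.trans finite_Diff)
        qed
        then show "shuffle_sign L (K - L) *
            (\<Sum>I\<in>Pow L. shuffle_sign I (L - I) * ecoeff u I * ecoeff v (L - I)) * ecoeff w (K - L)
            = (\<Sum>I\<in>Pow L. ?f I (L - I) (K - L))"
          by (simp add: sum_distrib_left sum_distrib_right mult_ac)
      qed
      also have "\<dots> = (\<Sum>(L, I)\<in>Sigma (Pow K) Pow. ?f I (L - I) (K - L))"
        by (rule sum.Sigma) (use True fin in auto)
      also have "\<dots> = (\<Sum>(I, J)\<in>Sigma (Pow K) (\<lambda>I. Pow (K - I)). ?f I J (K - I - J))"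
      proof (rule sum.reindex_bij_witness[of _ "\<lambda>(I, J). (I \<union> J, I)" "\<lambda>(L, I). (I, L - I)"], goal_cases)
        case (5 a)
        then have "K - snd a - (fst a - snd a) = K - fst a" by auto
        then show ?case by (simp add: case_prod_beta)
      qed auto
      also have "\<dots> = (\<Sum>I\<in>Pow K. \<Sum>J\<in>Pow (K - I). ?f I J (K - I - J))"
        by (rule sum.Sigma[symmetric]) (use True fin in auto)
      also have "\<dots> = (\<Sum>I\<in>Pow K. shuffle_sign I (K - I) * ecoeff u I *
          (\<Sum>J\<in>Pow (K - I). shuffle_sign J (K - I - J) * ecoeff v J * ecoeff w (K - I - J)))"
      proof (rule sum.cong[OF refl])
        fix I assume I: "I \<in> Pow K"
        have "shuffle_sign I (K - I) =
                (shuffle_sign I J * shuffle_sign I (K - I - J) :: 'a)" if "J \<in> Pow (K - I)" for J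
        proof -
          have "K - I = J \<union> (K - I - J)" using that by auto
          then show ?thesis using shuffle_sign_Un_right[of I J "K - I - J"] I that fin True
            by (metis Diff_disjoint PowD finite_Diff finite_subset)
        qed
        then show "(\<Sum>J\<in>Pow (K - I). ?f I J (K - I - J)) = shuffle_sign I (K - I) * ecoeff u I *
          (\<Sum>J\<in>Pow (K - I). shuffle_sign J (K - I - J) * ecoeff v J * ecoeff w (K - I - J))"
          by (simp add: sum_distrib_left sum_distrib_right mult_ac)
      qed
      also have "\<dots> = ecoeff (u * (v * w)) K"
        by (simp add: times_exterior.rep_eq)
      finally show ?thesis .
    qed
  qed
  show "1 * u = u"
  proof (rule exterior_eqI)
    fix K
    show "ecoeff (1 * u) K = ecoeff u K"
    proof (cases "finite K")
      case True
      have "ecoeff (1 * u) K =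
          (\<Sum>I\<in>Pow K. if I = {} then ecoeff u K else 0)"
        unfolding times_exterior.rep_eq one_exterior.rep_eq by (rule sum.cong) auto
      then show ?thesis using True by (simp add: sum.delta)
    qed (simp add: ecoeff_infinite)
  qed
  show "u * 1 = u"
  proof (rule exterior_eqI)
    fix K
    show "ecoeff (u * 1) K = ecoeff u K"
    proof (cases "finite K")
      case True
      have "ecoeff (u * 1) K =
          (\<Sum>I\<in>Pow K. if I = K then ecoeff u K else 0)"
        unfolding times_exterior.rep_eq one_exterior.rep_eq by (rule sum.cong) auto
      then show ?thesis using True by (simp add: sum.delta)
    qed (simp add: ecoeff_infinite)
  qed
  show "(u + v) * w = u * w + v * w"
    by (rule exterior_eqI) (simp add: times_exterior.rep_eq algebra_simps sum.distrib)
  show "u * (v + w) = u * v + u * w"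
    by (rule exterior_eqI) (simp add: times_exterior.rep_eq algebra_simps sum.distrib)
  show "(0 :: 'a exterior) \<noteq> 1"
  proof
    assume "(0 :: 'a exterior) = 1"
    then have "ecoeff 0 {} = (ecoeff 1 {} :: 'a)" by simp
    then show False by (simp add: one_exterior.rep_eq)
  qed
qed

end

lift_definition dx :: "nat \<Rightarrow> 'r::comm_ring_1 exterior" is "\<lambda>i I. if I = {i} then 1 else 0"
proof -
  fix i :: nat
  show "\<exists>N. \<forall>I. (if I = {i} then 1 else 0 :: 'r) \<noteq> 0 \<longrightarrow> I \<subseteq> {..<N}"
    by (rule exI[of _ "Suc i"]) auto
qed

lift_definition escale :: "'r::comm_ring_1 \<Rightarrow> 'r exterior \<Rightarrow> 'r exterior" (infixr \<open>*e\<close> 75)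
  is "\<lambda>c u I. c * u I"
proof -
  fix c :: 'r and u :: "nat set \<Rightarrow> 'r"
  assume "\<exists>N. \<forall>I. u I \<noteq> 0 \<longrightarrow> I \<subseteq> {..<N}"
  then show "\<exists>N. \<forall>I. c * u I \<noteq> 0 \<longrightarrow> I \<subseteq> {..<N}" by (auto elim!: ex_forward all_forward)
qed

lemma ecoeff_escale [simp]: "ecoeff (c *e u) I = c * ecoeff u I" by transfer simp

lemma escale_simps:
  "c *e (u + v) = c *e u + c *e v" "(c + d) *e u = c *e u + d *e u"
  "c *e (d *e u) = (c * d) *e u" "1 *e u = u" "0 *e u = 0" "c *e 0 = 0" "(- c) *e u = - (c *e u)"
  by (rule exterior_eqI; simp add: algebra_simps)+

lemma escale_times: "(c *e u) * v = c *e (u * v)" "u * (c *e v) = c *e (u * v)"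
  by (rule exterior_eqI; simp add: times_exterior.rep_eq sum_distrib_left mult_ac)+

definition left_sign :: "nat \<Rightarrow> nat set \<Rightarrow> 'r::comm_ring_1" where
  "left_sign a K = (- 1) ^ card {k \<in> K. k < a}"

lemma left_sign_sq: "left_sign a K * left_sign a K = 1"
  by (simp add: left_sign_def flip: power_mult_distrib)

lemma left_sign_insert:
  assumes "finite K" "b \<notin> K"
  shows "left_sign a (insert b K) = (if b < a then - left_sign a K else left_sign a K)"
proof (cases "b < a")
  case True
  then have "{k \<in> insert b K. k < a} = insert b {k \<in> K. k < a}" by auto
  then show ?thesis using assms True by (simp add: left_sign_def)
next
  case False
  then have "{k \<in> insert b K. k < a} = {k \<in> K. k < a}" by auto
  then show ?thesis using False by (simp add: left_sign_def)
qed

lemma shuffle_sign_singleton: "shuffle_sign {a} J = left_sign a J"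
proof -
  have "{(x, b). x \<in> {a} \<and> b \<in> J \<and> b < x} = Pair a ` {k \<in> J. k < a}" by auto
  then show ?thesis
    by (simp add: shuffle_sign_def left_sign_def card_image inj_on_def)
qed

lemma ecoeff_dx_times:
  "ecoeff (dx a * v) K = (if a \<in> K then left_sign a K * ecoeff v (K - {a}) else 0)"
proof (cases "finite K")
  case True
  have "ecoeff (dx a * v) K =
      (\<Sum>I\<in>Pow K. if I = {a} then shuffle_sign {a} (K - {a}) * ecoeff v (K - {a}) else 0)"
    unfolding times_exterior.rep_eq dx.rep_eq by (rule sum.cong) auto
  also have "\<dots> = (if a \<in> K then shuffle_sign {a} (K - {a}) * ecoeff v (K - {a}) else 0)"
    using True by (subst sum.delta) auto
  also have "{k \<in> K - {a}. k < a} = {k \<in> K. k < a}" by auto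
  then have "shuffle_sign {a} (K - {a}) = left_sign a K"
    unfolding shuffle_sign_singleton left_sign_def by simp
  finally show ?thesis .
qed (simp add: ecoeff_infinite)

lemma sorted_list_of_set_insert_min:
  assumes "finite A" "\<forall>a\<in>A. b < a"
  shows "sorted_list_of_set (insert (b::nat) A) = b # sorted_list_of_set A"
proof -
  have "b \<notin> A" using assms by auto
  then have "sorted_list_of_set (insert b A) = insort b (sorted_list_of_set A)"
    using assms by simp
  also have "\<dots> = b # sorted_list_of_set A"
    by (rule insort_is_Cons) (use assms in auto)
  finally show ?thesis .
qed

abbreviation ordered_prod :: "(nat \<Rightarrow> 'm::monoid_mult) \<Rightarrow> nat set \<Rightarrow> 'm" where
  "ordered_prod \<theta> I \<equiv> prod_list (map \<theta> (sorted_list_of_set I))"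

lemma ecoeff_ordered_prod_dx:
  assumes "finite I"
  shows "ecoeff (ordered_prod dx I) J = (if J = I then 1 else 0)"
  using assms
proof (induction I arbitrary: J rule: finite_linorder_min_induct)
  case empty
  then show ?case by (simp add: one_exterior.rep_eq)
next
  case (insert b A)
  have "{k \<in> insert b A. k < b} = {}" using insert by auto
  then have 1: "left_sign b (insert b A) = (1 :: 'a)" by (simp only: left_sign_def) simp
  have "b \<notin> A" using insert by auto
  then have 2: "J - {b} = A \<longleftrightarrow> J = insert b A" if "b \<in> J" using that by auto
  show ?case
    unfolding sorted_list_of_set_insert_min[OF insert(1,2)]
    using insert(3) 1 2 \<open>b \<notin> A\<close> by (auto simp: ecoeff_dx_times)
qed

lemma exterior_expansion:
  assumes "finite S" "{I. ecoeff w I \<noteq> 0} \<subseteq> S"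
  shows "w = (\<Sum>I\<in>S. ecoeff w I *e ordered_prod dx I)"
proof (rule exterior_eqI)
  fix J
  have *: "ecoeff w I * ecoeff (ordered_prod dx I) J = (if J = I then ecoeff w J else 0)" for I
    by (cases "finite I") (auto simp: ecoeff_ordered_prod_dx ecoeff_infinite)
  show "ecoeff w J = ecoeff (\<Sum>I\<in>S. ecoeff w I *e ordered_prod dx I) J"
    using assms by (auto simp: *)
qed

lemma exterior_induct [case_names zero add basis]:
  assumes "P 0" "\<And>u v. P u \<Longrightarrow> P v \<Longrightarrow> P (u + v)"
    and "\<And>c I. finite I \<Longrightarrow> P (c *e ordered_prod dx I)"
  shows "P w"
proof -
  have "P (\<Sum>I\<in>S. ecoeff w I *e ordered_prod dx I)" if "finite S" for S
    using that
  proof (induction S)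
    case (insert I S)
    have "P (ecoeff w I *e ordered_prod dx I)"
    proof (cases "finite I")
      case False
      then show ?thesis using assms(1) by (simp add: ecoeff_infinite escale_simps)
    qed (rule assms(3))
    then show ?case using insert assms(2) by simp
  qed (simp add: assms(1))
  from this[OF finite_ecoeff_support[of w]] show ?thesis
    unfolding exterior_expansion[OF finite_ecoeff_support order_refl, of w, symmetric] .
qed

text \<open>\<open>contract c\<close> is the interior product with the linear form \<open>dx i \<mapsto> c i\<close>.\<close>

lift_definition contract :: "(nat \<Rightarrow> 'r::comm_ring_1) \<Rightarrow> 'r exterior \<Rightarrow> 'r exterior"
  is "\<lambda>c u J. \<Sum>i | i \<notin> J \<and> u (insert i J) \<noteq> 0. left_sign i J * c i * u (insert i J)"
proof -
  fix c :: "nat \<Rightarrow> 'r" and u :: "nat set \<Rightarrow> 'r"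
  assume "\<exists>N. \<forall>I. u I \<noteq> 0 \<longrightarrow> I \<subseteq> {..<N}"
  then obtain N where N: "\<forall>I. u I \<noteq> 0 \<longrightarrow> I \<subseteq> {..<N}" ..
  have "J \<subseteq> {..<N}"
    if nz: "(\<Sum>i | i \<notin> J \<and> u (insert i J) \<noteq> 0. left_sign i J * c i * u (insert i J)) \<noteq> 0" for J
  proof -
    obtain i where "i \<in> {i. i \<notin> J \<and> u (insert i J) \<noteq> 0}"
      using nz by (rule sum.not_neutral_contains_not_neutral)
    then have "insert i J \<subseteq> {..<N}" using N[rule_format, of "insert i J"] by simp
    then show ?thesis by simp
  qed
  then show "\<exists>N. \<forall>J. (\<Sum>i | i \<notin> J \<and> u (insert i J) \<noteq> 0. left_sign i J * c i * u (insert i J)) \<noteq> 0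
      \<longrightarrow> J \<subseteq> {..<N}"
    by (intro exI allI impI)
qed

lemma ecoeff_contract:
  assumes "finite S" "\<And>i. ecoeff u (insert i J) \<noteq> 0 \<Longrightarrow> i \<in> S"
  shows "ecoeff (contract c u) J =
    (\<Sum>i\<in>S. if i \<in> J then 0 else left_sign i J * c i * ecoeff u (insert i J))"
  unfolding contract.rep_eq by (rule sum.mono_neutral_cong_left) (use assms in auto)

lemma support_witness:
  obtains S where "finite S" "\<And>i J. ecoeff u (insert i J) \<noteq> 0 \<Longrightarrow> i \<in> S"
proof -
  obtain N where N: "\<forall>I. ecoeff u I \<noteq> 0 \<longrightarrow> I \<subseteq> {..<N}" using ecoeff_bound[of u] ..
  have "i \<in> {..<N}" if "ecoeff u (insert i J) \<noteq> 0" for i J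
    using N[rule_format, OF that] by simp
  then show ?thesis using that[of "{..<N}"] by simp
qed

lemma contract_add: "contract c (u + v) = contract c u + contract c v"
proof (rule exterior_eqI)
  fix J
  obtain S where S: "finite S" "\<And>i J. ecoeff u (insert i J) \<noteq> 0 \<Longrightarrow> i \<in> S"
    by (rule support_witness[of u]) (rule that)
  obtain T where T: "finite T" "\<And>i J. ecoeff v (insert i J) \<noteq> 0 \<Longrightarrow> i \<in> T"
    by (rule support_witness[of v]) (rule that)
  have ST: "i \<in> S \<union> T" if "ecoeff (u + v) (insert i J) \<noteq> 0" for i
    using S(2)[of i J] T(2)[of i J] that
    by (cases "ecoeff u (insert i J) = 0") auto
  show "ecoeff (contract c (u + v)) J = ecoeff (contract c u + contract c v) J"
    using S T ST
    by (subst ecoeff_plus, subst (1 2 3) ecoeff_contract[of "S \<union> T"])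
       (auto simp: algebra_simps simp flip: sum.distrib intro!: sum.cong)
qed

lemma contract_escale: "contract c (d *e u) = d *e contract c u"
proof (rule exterior_eqI)
  fix J
  obtain S where S: "finite S" "\<And>i J. ecoeff u (insert i J) \<noteq> 0 \<Longrightarrow> i \<in> S"
    by (rule support_witness[of u]) (rule that)
  have S': "i \<in> S" if "ecoeff (d *e u) (insert i J) \<noteq> 0" for i
    using S(2)[of i J] that by (cases "ecoeff u (insert i J) = 0") auto
  show "ecoeff (contract c (d *e u)) J = ecoeff (d *e contract c u) J"
    using S S'
    by (subst ecoeff_escale, subst (1 2) ecoeff_contract[of S])
       (auto simp: mult_ac sum_distrib_left intro!: sum.cong)
qed

lemma contract_0 [simp]: "contract c 0 = 0"
  using contract_escale[of c 0 0] by (simp add: escale_simps)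

lemma contract_1 [simp]: "contract c 1 = 0"
  by (rule exterior_eqI) (simp add: contract.rep_eq one_exterior.rep_eq)

lemma contract_dx_times: "contract c (dx a * v) = c a *e v - dx a * contract c v"
proof (rule exterior_eqI)
  fix K
  obtain S0 where S0: "finite S0" "\<And>i J. ecoeff v (insert i J) \<noteq> 0 \<Longrightarrow> i \<in> S0"
    by (rule support_witness[of v]) (rule that)
  define S where "S = insert a S0"
  have S: "finite S" "a \<in> S" "\<And>i J. ecoeff v (insert i J) \<noteq> 0 \<Longrightarrow> i \<in> S"
    using S0 by (auto simp: S_def)
  have S': "i \<in> S" if "ecoeff (dx a * v) (insert i J) \<noteq> 0" for i J
  proof (cases "i = a")
    case False
    then have "insert i J - {a} = insert i (J - {a})" by auto
    moreover have "ecoeff v (insert i J - {a}) \<noteq> 0"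
      using that unfolding ecoeff_dx_times by (cases "ecoeff v (insert i J - {a}) = 0") (simp_all split: if_splits)
    ultimately show ?thesis using S(3)[of i "J - {a}"] by simp
  qed (use S in simp)
  show "ecoeff (contract c (dx a * v)) K = ecoeff (c a *e v - dx a * contract c v) K"
  proof (cases "finite K")
    case fin: True
    have L: "ecoeff (contract c (dx a * v)) K = (\<Sum>i\<in>S. if i \<in> K then 0
        else left_sign i K * c i * ecoeff (dx a * v) (insert i K))"
      by (rule ecoeff_contract) (use S S' in auto)
    show ?thesis
    proof (cases "a \<in> K")
      case False
      have "left_sign a (insert a K) = (left_sign a K :: 'a)"
        using fin False by (simp add: left_sign_insert)
      then have "(if i \<in> K then 0 else left_sign i K * c i * ecoeff (dx a * v) (insert i K))
            = (if i = a then c a * ecoeff v K else 0)" for i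
        using False by (auto simp: ecoeff_dx_times mult_ac left_sign_sq)
      then show ?thesis using S False by (simp add: L ecoeff_dx_times)
    next
      case True
      define K' where "K' = K - {a}"
      have K': "K = insert a K'" "a \<notin> K'" "finite K'" using True fin by (auto simp: K'_def)
      have "ecoeff (contract c v) K' =
          (\<Sum>i\<in>S. if i \<in> K' then 0 else left_sign i K' * c i * ecoeff v (insert i K'))"
        by (rule ecoeff_contract) (use S in auto)
      then have "ecoeff (c a *e v - dx a * contract c v) K = c a * ecoeff v K - left_sign a K' *
          (\<Sum>i\<in>S. if i \<in> K' then 0 else left_sign i K' * c i * ecoeff v (insert i K'))"
        using K' by (simp add: ecoeff_dx_times left_sign_insert)
      also have "\<dots> = (\<Sum>i\<in>S. (if i = a then c a * ecoeff v K else 0) - left_sign a K' *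
          (if i \<in> K' then 0 else left_sign i K' * c i * ecoeff v (insert i K')))"
        using S by (simp add: sum_subtractf sum_distrib_left)
      also have "\<dots> = (\<Sum>i\<in>S. if i \<in> K then 0
        else left_sign i K * c i * ecoeff (dx a * v) (insert i K))"
      proof (rule sum.cong[OF refl])
        fix i
        have 1: "left_sign a K' * (left_sign a K' * x) = x" for x :: 'a
          by (simp add: left_sign_sq flip: mult.assoc)
        have 2: "insert i (insert a K') - {a} = insert i K'" if "i \<noteq> a" using K' that by auto
        show "(if i = a then c a * ecoeff v K else 0) - left_sign a K' *
            (if i \<in> K' then 0 else left_sign i K' * c i * ecoeff v (insert i K'))
          = (if i \<in> K then 0 else left_sign i K * c i * ecoeff (dx a * v) (insert i K))"
          using K' by (auto simp: ecoeff_dx_times 2 left_sign_insert 1 mult_ac insert_commute)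
      qed
      finally show ?thesis by (simp add: L)
    qed
  qed (simp add: ecoeff_infinite)
qed

lemma minus_one_power_commute: "x * ((- 1) ^ n * y) = (- 1) ^ n * (x * y)" for x y :: "'m::ring_1"
  by (cases "even n") simp_all

lemma contract_prod_times:
  "contract c (prod_list (map dx xs) * v)
    = contract c (prod_list (map dx xs)) * v + (- 1) ^ length xs * (prod_list (map dx xs) * contract c v)"
  by (induction xs)
     (simp_all add: mult.assoc contract_dx_times escale_times algebra_simps minus_one_power_commute)

lemma contract_leibniz:
  assumes "\<And>I. ecoeff u I \<noteq> 0 \<Longrightarrow> card I = r"
  shows "contract c (u * v) = contract c u * v + (- 1) ^ r * (u * contract c v)"
proof -
  have "contract c (\<Sum>I\<in>S. ecoeff u I *e ordered_prod dx I * v)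
      = contract c (\<Sum>I\<in>S. ecoeff u I *e ordered_prod dx I) * v
        + (- 1) ^ r * ((\<Sum>I\<in>S. ecoeff u I *e ordered_prod dx I) * contract c v)"
    if "finite S" for S
    using that
  proof (induction S)
    case (insert I S)
    have "contract c (ecoeff u I *e ordered_prod dx I * v)
      = contract c (ecoeff u I *e ordered_prod dx I) * v
        + (- 1) ^ r * (ecoeff u I *e ordered_prod dx I * contract c v)"
    proof (cases "ecoeff u I = 0")
      case False
      then have "length (sorted_list_of_set I) = r" using assms by simp
      then show ?thesis
        using contract_prod_times[of c "sorted_list_of_set I" v]
        by (simp add: escale_times contract_escale escale_simps)
    qed (simp add: escale_simps)
    then show ?case using insert by (simp add: contract_add algebra_simps)
  qed simp
  from this[OF finite_ecoeff_support[of u]] show ?thesis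
    by (simp flip: exterior_expansion[OF finite_ecoeff_support order_refl, of u] sum_distrib_right)
qed

section \<open>Polynomials\<close>

text \<open>
  \<open>'a mpoly\<close> is \<open>'a[x\<^sub>0, x\<^sub>1, x\<^sub>2, \<dots>]\<close>: finitely supported coefficient functions on exponent vectors,
  with the convolution product of \<^theory>\<open>HOL-Library.Poly_Mapping\<close>.
\<close>

type_synonym 'a mpoly = "(nat \<Rightarrow>\<^sub>0 nat) \<Rightarrow>\<^sub>0 'a"

definition mconst :: "'a::comm_ring_1 \<Rightarrow> 'a mpoly" where
  "mconst c = Poly_Mapping.single 0 c"

definition mvar :: "nat \<Rightarrow> 'a::comm_ring_1 mpoly" where
  "mvar i = Poly_Mapping.single (Poly_Mapping.single i 1) 1"

definition polys_in :: "nat set \<Rightarrow> 'a::comm_ring_1 mpoly set" where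
  "polys_in V = {p. \<forall>m\<in>Poly_Mapping.keys p. Poly_Mapping.keys m \<subseteq> V}"

text \<open>Here \<open>deg x\<^sub>i = 2\<close>.\<close>

definition homogeneous :: "'a::comm_ring_1 mpoly \<Rightarrow> bool" where
  "homogeneous p \<longleftrightarrow> (\<exists>d. \<forall>m\<in>Poly_Mapping.keys p.
     (\<Sum>i\<in>Poly_Mapping.keys m. 2 * Poly_Mapping.lookup m i) = d)"

definition monom_eval :: "(nat \<Rightarrow> 'b::comm_ring_1) \<Rightarrow> (nat \<Rightarrow>\<^sub>0 nat) \<Rightarrow> 'b" where
  "monom_eval \<sigma> m = (\<Prod>i\<in>Poly_Mapping.keys m. \<sigma> i ^ Poly_Mapping.lookup m i)"

definition psubst :: "(nat \<Rightarrow> 'a::comm_ring_1 mpoly) \<Rightarrow> 'a mpoly \<Rightarrow> 'a mpoly" where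
  "psubst \<sigma> p =
    (\<Sum>m\<in>Poly_Mapping.keys p. mconst (Poly_Mapping.lookup p m) * monom_eval \<sigma> m)"

lemma mconst_simps [simp]:
  "mconst 0 = 0" "mconst 1 = 1" "mconst (a + b) = mconst a + mconst b"
  "mconst (a * b) = mconst a * mconst b"
  by (simp_all add: mconst_def single_add mult_single)

lemma monom_eval_superset:
  "finite S \<Longrightarrow> Poly_Mapping.keys m \<subseteq> S \<Longrightarrow>
     monom_eval \<sigma> m = (\<Prod>i\<in>S. \<sigma> i ^ Poly_Mapping.lookup m i)"
  unfolding monom_eval_def by (rule prod.mono_neutral_left) (auto simp: in_keys_iff)

lemma monom_eval_add: "monom_eval \<sigma> (m + m') = monom_eval \<sigma> m * monom_eval \<sigma> m'"
proof -
  let ?S = "Poly_Mapping.keys m \<union> Poly_Mapping.keys m'"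
  have "monom_eval \<sigma> (m + m') = (\<Prod>i\<in>?S. \<sigma> i ^ Poly_Mapping.lookup (m + m') i)"
    by (rule monom_eval_superset) (simp_all add: Poly_Mapping.keys_add)
  also have "\<dots> = (\<Prod>i\<in>?S. \<sigma> i ^ Poly_Mapping.lookup m i) * (\<Prod>i\<in>?S. \<sigma> i ^ Poly_Mapping.lookup m' i)"
    by (simp add: lookup_add power_add prod.distrib)
  also have "\<dots> = monom_eval \<sigma> m * monom_eval \<sigma> m'"
    by (subst (1 2) monom_eval_superset[of ?S]) simp_all
  finally show ?thesis .
qed

lemma psubst_superset:
  "finite S \<Longrightarrow> Poly_Mapping.keys p \<subseteq> S \<Longrightarrow>
     psubst \<sigma> p = (\<Sum>m\<in>S. mconst (Poly_Mapping.lookup p m) * monom_eval \<sigma> m)"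
  unfolding psubst_def by (rule sum.mono_neutral_left) (auto simp: in_keys_iff)

lemma psubst_0 [simp]: "psubst \<sigma> 0 = 0"
  by (simp add: psubst_def)

lemma psubst_add: "psubst \<sigma> (p + q) = psubst \<sigma> p + psubst \<sigma> q"
proof -
  let ?S = "Poly_Mapping.keys p \<union> Poly_Mapping.keys q"
  have "psubst \<sigma> (p + q) = (\<Sum>m\<in>?S. mconst (Poly_Mapping.lookup (p + q) m) * monom_eval \<sigma> m)"
    by (rule psubst_superset) (simp_all add: Poly_Mapping.keys_add)
  also have "\<dots> = (\<Sum>m\<in>?S. mconst (Poly_Mapping.lookup p m) * monom_eval \<sigma> m)
      + (\<Sum>m\<in>?S. mconst (Poly_Mapping.lookup q m) * monom_eval \<sigma> m)"
    by (simp add: lookup_add distrib_right sum.distrib)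
  also have "\<dots> = psubst \<sigma> p + psubst \<sigma> q"
    by (subst (1 2) psubst_superset[of ?S]) simp_all
  finally show ?thesis .
qed

lemma psubst_sum: "psubst \<sigma> (\<Sum>a\<in>A. f a) = (\<Sum>a\<in>A. psubst \<sigma> (f a))"
  by (induction A rule: infinite_finite_induct) (simp_all add: psubst_add)

lemma psubst_single: "psubst \<sigma> (Poly_Mapping.single m c) = mconst c * monom_eval \<sigma> m"
  by (subst psubst_superset[of "{m}"]) simp_all

lemma psubst_mconst [simp]: "psubst \<sigma> (mconst c) = mconst c"
  by (simp add: mconst_def psubst_single monom_eval_def)

lemma psubst_1 [simp]: "psubst \<sigma> 1 = 1"
  using psubst_mconst[of \<sigma> 1] by simp

lemma psubst_mvar [simp]: "psubst \<sigma> (mvar i) = \<sigma> i"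
  by (simp add: mvar_def psubst_single monom_eval_def)

lemma mpoly_expansion:
  "(\<Sum>m\<in>Poly_Mapping.keys p. Poly_Mapping.single m (Poly_Mapping.lookup p m)) = p"
proof (rule poly_mapping_eqI)
  fix k
  show "Poly_Mapping.lookup (\<Sum>m\<in>Poly_Mapping.keys p. Poly_Mapping.single m (Poly_Mapping.lookup p m)) k
      = Poly_Mapping.lookup p k"
    by (simp add: lookup_sum lookup_single when_def in_keys_iff)
qed

lemma psubst_mult: "psubst \<sigma> (p * q) = psubst \<sigma> p * psubst \<sigma> q"
proof -
  let ?s = "\<lambda>p m. Poly_Mapping.single m (Poly_Mapping.lookup p m)"
  let ?K = "Poly_Mapping.keys"
  have "psubst \<sigma> (p * q) = psubst \<sigma> ((\<Sum>m\<in>?K p. ?s p m) * (\<Sum>m\<in>?K q. ?s q m))"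
    by (simp only: mpoly_expansion)
  also have "\<dots> = (\<Sum>m\<in>?K p. \<Sum>m'\<in>?K q. psubst \<sigma> (?s p m) * psubst \<sigma> (?s q m'))"
    by (simp add: sum_product psubst_sum mult_single psubst_single monom_eval_add mult_ac)
  also have "\<dots> = psubst \<sigma> (\<Sum>m\<in>?K p. ?s p m) * psubst \<sigma> (\<Sum>m\<in>?K q. ?s q m)"
    by (simp add: sum_product psubst_sum)
  finally show ?thesis by (simp only: mpoly_expansion)
qed

section \<open>The algebra \<open>P \<otimes> E\<close> and the action of the general linear group\<close>

text \<open>
  For a set \<open>V\<close> of indices, \<open>forms_in V\<close> is the subalgebra of \<open>'a mpoly exterior\<close> generated by the
  \<open>x\<^sub>i\<close> and \<open>dx\<^sub>i\<close> with \<open>i \<in> V\<close>. Thus \<open>P\<^sub>n \<otimes> E\<^sub>n\<close> is \<open>forms_in {1..n}\<close> and its subalgebra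
  \<open>P\<^sub>n\<^sub>-\<^sub>1 \<otimes> E\<^sub>n\<^sub>-\<^sub>1\<close> is \<open>forms_in {2..n}\<close>; \<open>P\<^sub>n\<close> acts on \<open>P\<^sub>n \<otimes> E\<^sub>n\<close> by \<^const>\<open>escale\<close>.
\<close>

definition forms_in :: "nat set \<Rightarrow> 'a::comm_ring_1 mpoly exterior set" where
  "forms_in V = {w. \<forall>I. ecoeff w I \<in> polys_in V \<and> (ecoeff w I \<noteq> 0 \<longrightarrow> I \<subseteq> V)}"

definition GL :: "nat \<Rightarrow> 'a::field mat monoid" where
  "GL n = units_of (ring_mat TYPE('a) n ())"

definition SL :: "nat \<Rightarrow> 'a::field mat monoid" where
  "SL n = (GL n)\<lparr>carrier := {g \<in> carrier (GL n). det g = 1}\<rparr>"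

text \<open>Matrix entries are numbered from \<open>0\<close>, the variables from \<open>1\<close>; hence the index shift.\<close>

definition row_poly :: "nat \<Rightarrow> 'a::field mat \<Rightarrow> nat \<Rightarrow> 'a mpoly" where
  "row_poly n h i = (\<Sum>j\<in>{1..n}. mconst (h $$ (i - 1, j - 1)) * mvar j)"

definition row_form :: "nat \<Rightarrow> 'a::field mat \<Rightarrow> nat \<Rightarrow> 'a mpoly exterior" where
  "row_form n h i = (\<Sum>j\<in>{1..n}. mconst (h $$ (i - 1, j - 1)) *e dx j)"

text \<open>\<open>act_poly n g\<close> and \<open>act_form n g\<close> are the actions of \<open>g\<close> on \<open>P\<^sub>n\<close> and \<open>P\<^sub>n \<otimes> E\<^sub>n\<close>: the ring
  endomorphisms sending \<open>x\<^sub>i\<close> and \<open>dx\<^sub>i\<close> to the linear forms given by row \<open>i\<close> of the inverse of \<open>g\<close>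
  (see \<open>act_form_times\<close> for multiplicativity).\<close>

definition act_poly :: "nat \<Rightarrow> 'a::field mat \<Rightarrow> 'a mpoly \<Rightarrow> 'a mpoly" where
  "act_poly n g = psubst (row_poly n (inv\<^bsub>GL n\<^esub> g))"

definition act_form :: "nat \<Rightarrow> 'a::field mat \<Rightarrow> 'a mpoly exterior \<Rightarrow> 'a mpoly exterior" where
  "act_form n g w =
    (\<Sum>I | ecoeff w I \<noteq> 0. act_poly n g (ecoeff w I) *e ordered_prod (row_form n (inv\<^bsub>GL n\<^esub> g)) I)"

lemma act_poly_mvar: "act_poly n g (mvar i) = (\<Sum>j\<in>{1..n}. mconst ((inv\<^bsub>GL n\<^esub> g) $$ (i - 1, j - 1)) * mvar j)"
  by (simp add: act_poly_def row_poly_def)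

lemma act_poly_hom:
  "act_poly n g 0 = 0" "act_poly n g 1 = 1" "act_poly n g (mconst c) = mconst c"
  "act_poly n g (p + q) = act_poly n g p + act_poly n g q"
  "act_poly n g (p * q) = act_poly n g p * act_poly n g q"
  by (simp_all add: act_poly_def psubst_add psubst_mult)

lemma act_form_superset:
  assumes "finite S" "{I. ecoeff w I \<noteq> 0} \<subseteq> S"
  shows "act_form n g w =
    (\<Sum>I\<in>S. act_poly n g (ecoeff w I) *e ordered_prod (row_form n (inv\<^bsub>GL n\<^esub> g)) I)"
  unfolding act_form_def
  by (rule sum.mono_neutral_left) (use assms in \<open>auto simp: act_poly_hom escale_simps\<close>)

lemma act_form_0: "act_form n g 0 = 0"
  by (simp add: act_form_def)

lemma act_form_add: "act_form n g (u + v) = act_form n g u + act_form n g v"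
proof -
  let ?S = "{I. ecoeff u I \<noteq> 0} \<union> {I. ecoeff v I \<noteq> 0}"
  have S: "finite ?S" "{I. ecoeff (u + v) I \<noteq> 0} \<subseteq> ?S" by auto
  show ?thesis
    by (subst act_form_superset[OF S], subst (1 2) act_form_superset[of ?S])
       (auto simp: act_poly_hom escale_simps sum.distrib)
qed

lemma act_form_escale: "act_form n g (p *e w) = act_poly n g p *e act_form n g w"
proof -
  have S: "{I. ecoeff (p *e w) I \<noteq> 0} \<subseteq> {I. ecoeff w I \<noteq> 0}" by auto
  have [simp]: "c *e (\<Sum>a\<in>A. f a) = (\<Sum>a\<in>A. c *e f a)"
    for c :: "'a mpoly" and f :: "nat set \<Rightarrow> 'a mpoly exterior" and A
    by (induction A rule: infinite_finite_induct) (simp_all add: escale_simps)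
  show ?thesis
    by (subst act_form_superset[OF finite_ecoeff_support S])
       (simp add: act_form_def act_poly_hom escale_simps)
qed

lemma act_form_ordered_prod_dx:
  assumes "finite I"
  shows "act_form n g (ordered_prod dx I) = ordered_prod (row_form n (inv\<^bsub>GL n\<^esub> g)) I"
proof -
  have "{J. ecoeff (ordered_prod dx I :: 'a mpoly exterior) J \<noteq> 0} \<subseteq> {I}"
    using assms by (auto simp: ecoeff_ordered_prod_dx split: if_splits)
  from act_form_superset[OF _ this] show ?thesis
    using assms by (simp add: ecoeff_ordered_prod_dx act_poly_hom escale_simps)
qed

lemma act_form_dx:
  "act_form n g (dx i) = (\<Sum>j\<in>{1..n}. mconst ((inv\<^bsub>GL n\<^esub> g) $$ (i - 1, j - 1)) *e dx j)"
  using act_form_ordered_prod_dx[of "{i}" n g] by (simp add: row_form_def)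

lemma act_form_1: "act_form n g 1 = 1"
  using act_form_ordered_prod_dx[of "{}" n g] by simp

lemma ecoeff_dx: "ecoeff (dx i) J = (if J = {i} then 1 else 0)"
  by (simp add: dx.rep_eq)

lemma dx_sq: "dx i * dx i = 0"
  by (rule exterior_eqI) (auto simp: ecoeff_dx_times ecoeff_dx)

lemma dx_anticommute: "dx i * dx j = - (dx j * dx i)"
proof (cases "i = j")
  case True
  then show ?thesis by (simp add: dx_sq)
next
  case False
  have 1: "K - {i} = {j} \<longleftrightarrow> K = {i, j}" if "i \<in> K" for K using that False by auto
  have 2: "K - {j} = {i} \<longleftrightarrow> K = {i, j}" if "j \<in> K" for K using that False by auto
  have [simp]: "left_sign a {} = 1" for a by (simp add: left_sign_def)
  have 3: "left_sign i {i, j} = - (left_sign j {i, j} :: 'a)"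
    using False by (simp add: left_sign_insert)
  show ?thesis
  proof (rule exterior_eqI)
    fix K
    show "ecoeff (dx i * dx j) K = ecoeff (- (dx j * dx i) :: 'a exterior) K"
      using 1[of K] 2[of K] 3 by (cases "K = {i, j}") (auto simp: ecoeff_dx_times ecoeff_dx)
  qed
qed

lemma escale_sum: "c *e (\<Sum>a\<in>A. f a) = (\<Sum>a\<in>A. c *e f a)"
  by (induction A rule: infinite_finite_induct) (simp_all add: escale_simps)

lemma escale_minus: "c *e (- u) = - (c *e u)"
  by (rule exterior_eqI) simp

lemma dx_lin_anticommute: "dx i * (\<Sum>j\<in>A. c j *e dx j) = - ((\<Sum>j\<in>A. c j *e dx j) * dx i)"
proof -
  have "dx i * (c j *e dx j) = - (c j *e dx j * dx i)" for j
    by (simp add: escale_times dx_anticommute[of i j] escale_minus)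
  then show ?thesis by (simp add: sum_distrib_left sum_distrib_right sum_negf)
qed

lemma lin_anticommute:
  "(\<Sum>i\<in>A. b i *e dx i) * (\<Sum>j\<in>B. c j *e dx j) = - ((\<Sum>j\<in>B. c j *e dx j) * (\<Sum>i\<in>A. b i *e dx i))"
proof -
  have "b i *e dx i * (\<Sum>j\<in>B. c j *e dx j) = - ((\<Sum>j\<in>B. c j *e dx j) * (b i *e dx i))" for i
    by (simp only: escale_times dx_lin_anticommute escale_minus)
  then show ?thesis
    by (simp only: sum_distrib_right[of _ A] sum_distrib_left[of _ _ A] sum_negf)
qed

lemma lin_sq: "(\<Sum>i\<in>A. b i *e dx i) * (\<Sum>i\<in>A. b i *e dx i) = 0"
proof (induction A rule: infinite_finite_induct)
  case (insert a A)
  then show ?case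
    by (simp add: distrib_left distrib_right escale_times dx_sq escale_simps
        dx_lin_anticommute escale_minus)
qed simp_all

lemma times_ordered_prod:
  fixes \<theta> :: "nat \<Rightarrow> 'r::comm_ring_1 exterior"
  assumes sq: "\<And>i. \<theta> i * \<theta> i = 0" and anti: "\<And>i j. \<theta> i * \<theta> j = - (\<theta> j * \<theta> i)"
    and "finite I"
  shows "\<theta> a * ordered_prod \<theta> I = (if a \<in> I then 0 else left_sign a I *e ordered_prod \<theta> (insert a I))"
  using assms(3)
proof (induction I rule: finite_linorder_min_induct)
  case empty
  have [simp]: "left_sign a {} = (1 :: 'r)" by (simp add: left_sign_def)
  show ?case by (simp add: escale_simps)
next
  case (insert b A)
  have b: "b \<notin> A" using insert by auto
  consider "a = b" | "a < b" | "b < a" by linarith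
  then show ?case
  proof cases
    case 1
    then show ?thesis
      unfolding sorted_list_of_set_insert_min[OF insert(1,2)]
      by (simp add: sq flip: mult.assoc)
  next
    case 2
    have "{k \<in> insert b A. k < a} = {}" using 2 insert by auto
    then have s: "left_sign a (insert b A) = (1 :: 'r)" by (simp only: left_sign_def) simp
    have "sorted_list_of_set (insert a (insert b A)) = a # sorted_list_of_set (insert b A)"
      by (rule sorted_list_of_set_insert_min) (use 2 insert in auto)
    moreover have "a \<notin> insert b A" using 2 insert by auto
    ultimately show ?thesis by (simp only: s) (simp add: escale_simps)
  next
    case 3
    have l: "sorted_list_of_set (insert b (insert a A)) = b # sorted_list_of_set (insert a A)"
      by (rule sorted_list_of_set_insert_min) (use 3 insert in auto)
    have "\<theta> a * ordered_prod \<theta> (insert b A) = - (\<theta> b * (\<theta> a * ordered_prod \<theta> A))"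
      unfolding sorted_list_of_set_insert_min[OF insert(1,2)]
      by (simp add: anti[of a b] flip: mult.assoc)
    also have "\<dots> = (if a \<in> A then 0
        else (- left_sign a A) *e ordered_prod \<theta> (insert b (insert a A)))"
      unfolding insert(3) l by (simp add: escale_times escale_simps)
    also have "\<dots> = (if a \<in> insert b A then 0
        else left_sign a (insert b A) *e ordered_prod \<theta> (insert a (insert b A)))"
      using 3 b insert(1) by (auto simp: left_sign_insert insert_commute[of a b])
    finally show ?thesis .
  qed
qed

lemma act_form_dx_times: "act_form n g (dx a * v) = act_form n g (dx a) * act_form n g v"
proof (induction v rule: exterior_induct)
  case zero
  then show ?case by (simp add: act_form_0)
next
  case (add u v)
  then show ?case by (simp add: distrib_left act_form_add)
next
  case (basis c I)
  let ?\<theta> = "row_form n (inv\<^bsub>GL n\<^esub> g)"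
  have *: "act_poly n g (left_sign a I) = left_sign a I"
  proof -
    have "act_poly n g (- p) = - act_poly n g p" for p :: "'a mpoly"
      using act_poly_hom(4)[of n g p "- p"] by (simp add: act_poly_hom eq_neg_iff_add_eq_0 add.commute)
    then have "act_poly n g ((- 1) ^ k) = (- 1) ^ k" for k
      by (induction k) (simp_all add: act_poly_hom)
    then show ?thesis by (simp add: left_sign_def)
  qed
  have sq: "?\<theta> i * ?\<theta> i = 0" for i unfolding row_form_def by (rule lin_sq)
  have anti: "?\<theta> i * ?\<theta> j = - (?\<theta> j * ?\<theta> i)" for i j
    unfolding row_form_def by (rule lin_anticommute)
  have "act_form n g (dx a * ordered_prod dx I) = ?\<theta> a * ordered_prod ?\<theta> I"
    unfolding times_ordered_prod[of dx I a, OF dx_sq dx_anticommute basis]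
      times_ordered_prod[of ?\<theta> I a, OF sq anti basis]
    using basis act_form_ordered_prod_dx[of "insert a I" n g]
    by (cases "a \<in> I") (simp_all add: act_form_0 act_form_escale *)
  moreover have "act_form n g (dx a) = ?\<theta> a"
    by (simp only: act_form_dx row_form_def)
  ultimately show ?case
    using basis by (simp add: escale_times act_form_escale act_form_ordered_prod_dx)
qed

lemma act_form_times: "act_form n g (u * v) = act_form n g u * act_form n g v"
proof (induction u rule: exterior_induct)
  case zero
  then show ?case by (simp add: act_form_0)
next
  case (add u u')
  then show ?case by (simp add: distrib_right act_form_add)
next
  case (basis c I)
  have "act_form n g (prod_list (map dx xs) * w) = act_form n g (prod_list (map dx xs)) * act_form n g w"
    for xs w
    by (induction xs) (simp_all add: act_form_1 act_form_dx_times mult.assoc)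
  then show ?case by (simp add: escale_times act_form_escale)
qed

section \<open>Invariants\<close>

definition poly_invariants :: "nat \<Rightarrow> nat set \<Rightarrow> 'a::field mat set \<Rightarrow> 'a mpoly set" where
  "poly_invariants n V H = {f \<in> polys_in V. \<forall>g\<in>H. act_poly n g f = f}"

definition form_invariants :: "nat \<Rightarrow> nat set \<Rightarrow> 'a::field mat set \<Rightarrow> 'a mpoly exterior set" where
  "form_invariants n V H = {w \<in> forms_in V. \<forall>g\<in>H. act_form n g w = w}"

text \<open>The matrix with rows \<open>(1, m)\<close> and \<open>(0, g\<^sub>1)\<close>.\<close>

definition block_matrix :: "nat \<Rightarrow> 'a::field mat \<Rightarrow> 'a mat \<Rightarrow> 'a mat" where
  "block_matrix n m g\<^sub>1 = four_block_mat (1\<^sub>m 1) m (0\<^sub>m (n - 1) 1) g\<^sub>1"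

text \<open>\<open>S\<close> is the polynomial algebra over \<open>'a\<close> on the generators \<open>f i\<close>, \<open>i \<in> V\<close>: it consists of
  the polynomials in the \<open>f i\<close>, and the \<open>f i\<close> are algebraically independent.\<close>

definition is_polynomial_algebra :: "'a::comm_ring_1 mpoly set \<Rightarrow> nat set \<Rightarrow> (nat \<Rightarrow> 'a mpoly) \<Rightarrow> bool"
  where "is_polynomial_algebra S V f \<longleftrightarrow>
    S = psubst f ` polys_in V \<and> (\<forall>p\<in>polys_in V. psubst f p = 0 \<longrightarrow> p = 0)"

text \<open>\<open>M\<close> is a free module over the subring \<open>S\<close> of \<open>'r\<close>, with the finite basis \<open>(b i)\<^sub>i\<^sub>\<in>\<^sub>A\<close>. The
  basis is a family, so linear independence includes that the \<open>b i\<close> are pairwise distinct.\<close>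

definition is_free_module :: "'r::comm_ring_1 set \<Rightarrow> 'r exterior set \<Rightarrow> 'i set \<Rightarrow> ('i \<Rightarrow> 'r exterior) \<Rightarrow> bool"
  where "is_free_module S M A b \<longleftrightarrow>
    (1 \<in> S \<and> (\<forall>x\<in>S. \<forall>y\<in>S. x - y \<in> S \<and> x * y \<in> S)) \<and>
    (0 \<in> M \<and> (\<forall>u\<in>M. \<forall>v\<in>M. u + v \<in> M) \<and> (\<forall>x\<in>S. \<forall>u\<in>M. x *e u \<in> M)) \<and>
    finite A \<and> (\<forall>i\<in>A. b i \<in> M) \<and>
    (\<forall>u\<in>M. \<exists>c. (\<forall>i\<in>A. c i \<in> S) \<and> u = (\<Sum>i\<in>A. c i *e b i)) \<and>
    (\<forall>c. (\<forall>i\<in>A. c i \<in> S) \<longrightarrow> (\<Sum>i\<in>A. c i *e b i) = 0 \<longrightarrow> (\<forall>i\<in>A. c i = 0))"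

section \<open>Milnor operations\<close>

text \<open>\<open>milnor j\<close> is \<open>Q\<^sub>j\<close>, and \<open>milnor_set I\<close> is \<open>Q\<^sub>I = Q\<^sub>i\<^sub>1 \<circ> \<dots> \<circ> Q\<^sub>i\<^sub>r\<close> for
  \<open>I = {i\<^sub>1 < \<dots> < i\<^sub>r}\<close>. The lemmas below are the properties that determine \<open>Q\<^sub>j\<close>.\<close>

definition milnor :: "nat \<Rightarrow> 'a::{field, finite} mpoly exterior \<Rightarrow> 'a mpoly exterior" where
  "milnor j = contract (\<lambda>i. mvar i ^ (card (UNIV :: 'a set) ^ j))"

definition milnor_set :: "nat set \<Rightarrow> 'a::{field, finite} mpoly exterior \<Rightarrow> 'a mpoly exterior" where
  "milnor_set I = foldr milnor (sorted_list_of_set I)"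

lemma milnor_polynomial: "milnor j (p *e 1) = 0"
  by (simp add: milnor_def contract_escale escale_simps)

lemma milnor_dx: "milnor j (dx i :: 'a::{field, finite} mpoly exterior) = mvar i ^ (card (UNIV :: 'a set) ^ j) *e 1"
  using contract_dx_times[of _ i 1] by (simp add: milnor_def)

lemma milnor_linear:
  "milnor j (p *e u) = p *e milnor j u" "milnor j (u + v) = milnor j u + milnor j v"
  by (simp_all add: milnor_def contract_add contract_escale)

lemma milnor_leibniz:
  "(\<And>I. ecoeff u I \<noteq> 0 \<Longrightarrow> card I = r) \<Longrightarrow>
     milnor j (u * v) = milnor j u * v + (- 1) ^ r * (u * milnor j v)"
  unfolding milnor_def by (rule contract_leibniz)

end

theory Submission
  imports Defs "HOL-Computational_Algebra.Polynomial"
begin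

text \<open>
  Let \<open>\<partial>\<close> be the contraction with the first basis vector, \<open>\<omega> = dx\<^sub>1 \<dots> dx\<^sub>n\<close> and \<open>\<mu> = dx\<^sub>2 \<dots> dx\<^sub>n\<close>;
  then \<open>\<partial> \<omega> = \<mu>\<close>, and \<open>\<partial>\<close> commutes with \<open>G\<close> and anticommutes with the Milnor operations.
  By Cramer's rule the \<open>Q\<^sub>I \<mu>\<close> form a basis of the forms in \<open>dx\<^sub>2, \<dots>, dx\<^sub>n\<close> once the Moore determinant \<open>L\<close>
  of \<open>x\<^sub>2, \<dots>, x\<^sub>n\<close> is inverted, and the coordinates of \<open>u\<close> are the degree-zero parts of \<open>\<plusminus> Q\<^sub>J u / L\<close>.
  Let \<open>a\<close> be \<open>G\<close>-invariant. Invariance under \<open>x\<^sub>1 \<mapsto> x\<^sub>1 + w\<close>, with \<open>w\<close> a linear form in \<open>x\<^sub>2, \<dots>, x\<^sub>n\<close>, shows that \<open>w\<close> divides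
  \<open>dw \<partial>a\<close>, hence also the degree-zero part of \<open>Q\<^sub>J \<partial>a\<close>. As \<open>L\<close> is the product of the forms \<open>w\<close> with
  leading coefficient \<open>1\<close>, \<open>\<partial>a\<close> is a combination of the \<open>Q\<^sub>I \<mu>\<close> with coefficients in \<open>P\<^sub>n\<close>, which are invariant by
  uniqueness. Subtracting the corresponding combination of the \<open>Q\<^sub>I \<omega>\<close> leaves an invariant form without \<open>dx\<^sub>1\<close>.
  Its coefficients are invariant under the translations of \<open>x\<^sub>1\<close>, so they are polynomials in the product of all
  \<open>x\<^sub>1 + w\<close> over \<open>P\<^sub>n\<^sub>-\<^sub>1\<close>, and the assumed basis takes care of each power of this product.
\<close>

section \<open>Substitutions and linear forms\<close>

text \<open>The ground field enters through Frobenius: q-th powers are additive and fix F_q, so Q_j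
  sends the differential of a linear form w to w^(q^j). Hence the Q_j commute with the linear action
  and, modulo w, preserve the multiples of dw. Determinant 1 makes \<omega> invariant, so \<mu> =
  \<partial>\<omega> is invariant too. The Moore determinants of x_1, ..., x_n and of x_2, ..., x_n,
  obtained from \<omega> and \<mu> by applying Q_0, Q_1, ..., are therefore invariant, and so is
  their quotient, the product of all x_1 + w. The obstacle is to pass from divisibility by every
  single w to divisibility by L. Dividing by x_b + v amounts to evaluating at x_b = - v, which makes
  such forms prime; the factorization of L comes from comparing degrees and leading coefficients in
  one variable at a time. Independence uses the same tools: \<partial> kills the v_i and sends Q_I
  \<omega> to Q_I \<mu> up to sign, so the coefficients of the Q_I \<omega> in a relation vanish.
  Uniqueness of expansions in powers of the product of all x_1 + w reduces what remains to the
  assumed basis.\<close>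

lemma psubst_uminus: "psubst \<sigma> (- p) = - psubst \<sigma> p"
  using psubst_add[of \<sigma> p "- p"] by (simp add: eq_neg_iff_add_eq_0 add.commute)

lemma psubst_diff: "psubst \<sigma> (p - q) = psubst \<sigma> p - psubst \<sigma> q"
  using psubst_add[of \<sigma> p "- q"] by (simp add: psubst_uminus)

lemma psubst_prod: "psubst \<sigma> (\<Prod>a\<in>A. f a) = (\<Prod>a\<in>A. psubst \<sigma> (f a))"
  by (induction A rule: infinite_finite_induct) (simp_all add: psubst_mult)

lemma psubst_power: "psubst \<sigma> (p ^ k) = psubst \<sigma> p ^ k"
  by (induction k) (simp_all add: psubst_mult)

lemma psubst_monom_eval: "psubst \<sigma> (monom_eval \<tau> m) = monom_eval (\<lambda>i. psubst \<sigma> (\<tau> i)) m"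
  by (simp add: monom_eval_def psubst_prod psubst_power)

lemma psubst_psubst: "psubst \<sigma> (psubst \<tau> p) = psubst (\<lambda>i. psubst \<sigma> (\<tau> i)) p"
  by (simp add: psubst_def[of \<tau>] psubst_def[of "\<lambda>i. psubst \<sigma> (\<tau> i)"]
      psubst_sum psubst_mult psubst_monom_eval)

lemma psubst_cong:
  assumes "p \<in> polys_in V" "\<And>i. i \<in> V \<Longrightarrow> \<sigma> i = \<tau> i"
  shows "psubst \<sigma> p = psubst \<tau> p"
proof -
  have "monom_eval \<sigma> m = monom_eval \<tau> m" if "m \<in> Poly_Mapping.keys p" for m
    using that assms(1) unfolding monom_eval_def polys_in_def
    by (intro prod.cong arg_cong2[of _ _ _ _ "(^)"] assms(2)) auto
  then show ?thesis by (simp add: psubst_def)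
qed

lemma single_power: "Poly_Mapping.single m 1 ^ k = Poly_Mapping.single (of_nat k * m) (1 :: 'a::comm_ring_1)"
  for m :: "nat \<Rightarrow>\<^sub>0 nat"
  by (induction k) (simp_all add: mult_single distrib_right)

lemma prod_single:
  "(\<Prod>i\<in>A. Poly_Mapping.single (f i :: nat \<Rightarrow>\<^sub>0 nat) (1 :: 'a::comm_ring_1))
    = Poly_Mapping.single (\<Sum>i\<in>A. f i) 1"
  by (induction A rule: infinite_finite_induct) (simp_all add: mult_single)

lemma monom_eval_mvar: "monom_eval mvar m = Poly_Mapping.single m 1"
proof -
  have 1: "of_nat k * Poly_Mapping.single i (1::nat) = Poly_Mapping.single i k" for i :: nat and k
    by (induction k) (simp_all add: distrib_right flip: single_add)
  have 2: "(\<Sum>i\<in>A. of_nat (f i) * Poly_Mapping.single i (1::nat)) = (\<Sum>i\<in>A. Poly_Mapping.single i (f i))"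
    for A :: "nat set" and f by (simp only: 1)
  have "(\<Sum>i\<in>Poly_Mapping.keys m. Poly_Mapping.single i (Poly_Mapping.lookup m i)) = m"
  proof (rule poly_mapping_eqI)
    fix j
    show "Poly_Mapping.lookup (\<Sum>i\<in>Poly_Mapping.keys m. Poly_Mapping.single i (Poly_Mapping.lookup m i)) j
        = Poly_Mapping.lookup m j"
      by (simp add: lookup_sum lookup_single when_def in_keys_iff)
  qed
  then show ?thesis
    by (simp only: monom_eval_def mvar_def single_power prod_single 2)
qed

lemma psubst_id: "psubst mvar p = p"
  by (simp add: psubst_def monom_eval_mvar mconst_def mult_single mpoly_expansion)

lemma mpoly_induct [case_names zero add single]:
  fixes p :: "'a::comm_ring_1 mpoly"
  assumes "P 0" "\<And>p q. P p \<Longrightarrow> P q \<Longrightarrow> P (p + q)" "\<And>m c. P (Poly_Mapping.single m c)"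
  shows "P p"
proof -
  have "P (\<Sum>m\<in>A. Poly_Mapping.single m (Poly_Mapping.lookup p m))" for A
    using assms by (induction A rule: infinite_finite_induct) auto
  then show ?thesis by (metis mpoly_expansion)
qed

section \<open>Polynomials in prescribed variables\<close>

lemma polys_in_mono: "V \<subseteq> W \<Longrightarrow> polys_in V \<subseteq> polys_in W"
  unfolding polys_in_def by blast

lemma polys_in_0 [simp]: "0 \<in> polys_in V"
  by (simp add: polys_in_def)

lemma polys_in_mconst [simp]: "mconst c \<in> polys_in V"
  by (simp add: polys_in_def mconst_def)

lemma polys_in_1 [simp]: "1 \<in> polys_in V"
  using polys_in_mconst[of 1 V] by simp

lemma polys_in_mvar: "i \<in> V \<Longrightarrow> mvar i \<in> polys_in V"
  by (simp add: polys_in_def mvar_def)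

lemma polys_in_add: "p \<in> polys_in V \<Longrightarrow> q \<in> polys_in V \<Longrightarrow> p + q \<in> polys_in V"
  unfolding polys_in_def using Poly_Mapping.keys_add[of p q] by blast

lemma polys_in_uminus: "p \<in> polys_in V \<Longrightarrow> - p \<in> polys_in V"
  by (simp add: polys_in_def)

lemma polys_in_diff: "p \<in> polys_in V \<Longrightarrow> q \<in> polys_in V \<Longrightarrow> p - q \<in> polys_in V"
  using polys_in_add[of p V "- q"] by (simp add: polys_in_uminus)

lemma polys_in_mult:
  assumes "p \<in> polys_in V" "q \<in> polys_in V"
  shows "p * q \<in> polys_in V"
  unfolding polys_in_def
proof (clarify)
  fix m x assume "m \<in> Poly_Mapping.keys (p * q)" and x: "x \<in> Poly_Mapping.keys m"
  then obtain a b where "m = a + b" "a \<in> Poly_Mapping.keys p" "b \<in> Poly_Mapping.keys q"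
    using keys_mult[of p q] by blast
  then show "x \<in> V" using assms x Poly_Mapping.keys_add[of a b] unfolding polys_in_def by blast
qed

lemma polys_in_power: "p \<in> polys_in V \<Longrightarrow> p ^ k \<in> polys_in V"
  by (induction k) (simp_all add: polys_in_mult)

lemma polys_in_sum: "(\<And>a. a \<in> A \<Longrightarrow> f a \<in> polys_in V) \<Longrightarrow> (\<Sum>a\<in>A. f a) \<in> polys_in V"
  by (induction A rule: infinite_finite_induct) (simp_all add: polys_in_add)

lemma polys_in_prod: "(\<And>a. a \<in> A \<Longrightarrow> f a \<in> polys_in V) \<Longrightarrow> (\<Prod>a\<in>A. f a) \<in> polys_in V"
  by (induction A rule: infinite_finite_induct) (simp_all add: polys_in_mult)

lemmas polys_in_intros = polys_in_mvar polys_in_add polys_in_uminus polys_in_diff polys_in_mult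
  polys_in_power polys_in_sum polys_in_prod

lemma psubst_polys_in:
  assumes "p \<in> polys_in V" "\<And>i. i \<in> V \<Longrightarrow> \<sigma> i \<in> polys_in W"
  shows "psubst \<sigma> p \<in> polys_in W"
  using assms unfolding psubst_def monom_eval_def polys_in_def[of V]
  by (intro polys_in_intros polys_in_mconst) auto

text \<open>The endomorphism killing the variables outside \<open>V\<close> is a retraction onto the
  polynomials in \<open>V\<close>. Membership becomes a fixed-point equation, which passes to
  quotients in \<open>polys_in_cancel\<close>.\<close>

lemma polys_in_psubst_iff:
  "p \<in> polys_in V \<longleftrightarrow> psubst (\<lambda>i. if i \<in> V then mvar i else 0) p = p" (is "_ \<longleftrightarrow> psubst ?\<rho> p = p")
proof
  assume "p \<in> polys_in V"
  then have "psubst ?\<rho> p = psubst mvar p" by (rule psubst_cong) simp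
  then show "psubst ?\<rho> p = p" by (simp add: psubst_id)
next
  assume *: "psubst ?\<rho> p = p"
  have "p \<in> polys_in UNIV" by (simp add: polys_in_def)
  then have "psubst ?\<rho> p \<in> polys_in V" by (rule psubst_polys_in) (simp add: polys_in_mvar)
  then show "p \<in> polys_in V" by (simp add: *)
qed

lemma polys_in_cancel:
  fixes p q :: "'a::idom mpoly"
  assumes "p * q \<in> polys_in V" "p \<in> polys_in V" "p \<noteq> 0"
  shows "q \<in> polys_in V"
  using assms unfolding polys_in_psubst_iff[of _ V] by (simp add: psubst_mult)

lemma dvd_power_diff: "w dvd a - b \<Longrightarrow> w dvd a ^ k - b ^ k" for w :: "'b::comm_ring_1"
  by (simp add: power_diff_sumr2)

lemma dvd_prod_diff:
  fixes w :: "'b::comm_ring_1"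
  assumes "\<And>i. i \<in> A \<Longrightarrow> w dvd f i - g i"
  shows "w dvd (\<Prod>i\<in>A. f i) - (\<Prod>i\<in>A. g i)"
  using assms
proof (induction A rule: infinite_finite_induct)
  case (insert x A)
  have "(\<Prod>i\<in>insert x A. f i) - (\<Prod>i\<in>insert x A. g i)
      = f x * ((\<Prod>i\<in>A. f i) - (\<Prod>i\<in>A. g i)) + (f x - g x) * (\<Prod>i\<in>A. g i)"
    using insert.hyps by (simp add: algebra_simps)
  then show ?case using insert by simp
qed simp_all

lemma dvd_psubst_diff:
  assumes "\<And>i. w dvd \<sigma> i - \<tau> i"
  shows "w dvd psubst \<sigma> p - psubst \<tau> p"
proof -
  have "psubst \<sigma> p - psubst \<tau> p = (\<Sum>m\<in>Poly_Mapping.keys p.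
      mconst (Poly_Mapping.lookup p m) * (monom_eval \<sigma> m - monom_eval \<tau> m))"
    by (simp add: psubst_def right_diff_distrib sum_subtractf)
  moreover have "w dvd monom_eval \<sigma> m - monom_eval \<tau> m" for m
    unfolding monom_eval_def by (intro dvd_prod_diff dvd_power_diff assms)
  ultimately show ?thesis by (simp add: dvd_sum)
qed

section \<open>Linear forms as prime elements\<close>

definition linear_forms :: "nat set \<Rightarrow> 'a::comm_ring_1 mpoly set" where
  "linear_forms V = {\<Sum>j\<in>V. mconst (c j) * mvar j | c. True}"

lemma linear_forms_polys_in: "v \<in> linear_forms V \<Longrightarrow> v \<in> polys_in V"
  unfolding linear_forms_def by (auto intro!: polys_in_intros)

lemma linear_forms_0: "0 \<in> linear_forms V"
  unfolding linear_forms_def by (rule CollectI, rule exI[of _ "\<lambda>_. 0"]) simp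

lemma mconst_uminus: "mconst (- c) = - mconst c"
  by (simp add: mconst_def single_uminus)

lemma linear_forms_uminus: "v \<in> linear_forms V \<Longrightarrow> - v \<in> linear_forms V"
  unfolding linear_forms_def
  by (clarify, rule_tac x = "\<lambda>j. - c j" in exI) (simp add: mconst_uminus sum_negf)

lemma lookup_linear_form:
  assumes "finite V"
  shows "Poly_Mapping.lookup (\<Sum>j\<in>V. mconst (c j) * mvar j :: 'a::comm_ring_1 mpoly) (Poly_Mapping.single i 1)
    = (if i \<in> V then c i else 0)"
proof -
  have "Poly_Mapping.single (j::nat) (1::nat) = Poly_Mapping.single i 1 \<longleftrightarrow> j = i" for j
    by (metis lookup_single_eq lookup_single_not_eq one_neq_zero)
  then show ?thesis using assms
    by (simp add: lookup_sum mconst_def mvar_def mult_single lookup_single when_def)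
qed

lemma card_linear_forms:
  assumes "finite V"
  shows "card (linear_forms V :: 'a::{field, finite} mpoly set) = card (UNIV :: 'a set) ^ card V"
proof -
  let ?f = "\<lambda>c. \<Sum>j\<in>V. mconst (c j) * mvar j :: 'a mpoly"
  \<comment> \<open>Extensional functions carry no free values off \<open>V\<close>, so each form
    has exactly one coefficient vector.\<close>
  have "linear_forms V = ?f ` (V \<rightarrow>\<^sub>E UNIV)"
  proof (intro equalityI subsetI)
    fix v :: "'a mpoly" assume "v \<in> linear_forms V"
    then obtain c where "v = ?f c" unfolding linear_forms_def by auto
    then have "v = ?f (restrict c V)" by (simp cong: sum.cong)
    moreover have "restrict c V \<in> V \<rightarrow>\<^sub>E UNIV" by simp
    ultimately show "v \<in> ?f ` (V \<rightarrow>\<^sub>E UNIV)" by (rule image_eqI)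
  qed (auto simp: linear_forms_def)
  moreover have "inj_on ?f (V \<rightarrow>\<^sub>E UNIV)"
  proof (rule inj_onI)
    fix c d assume cd: "c \<in> V \<rightarrow>\<^sub>E (UNIV :: 'a set)" "d \<in> V \<rightarrow>\<^sub>E (UNIV :: 'a set)" and "?f c = ?f d"
    then have "c i = d i" if "i \<in> V" for i
      using lookup_linear_form[OF assms, of c i] lookup_linear_form[OF assms, of d i] that by simp
    then show "c = d" using cd by (intro PiE_ext)
  qed
  ultimately show ?thesis using assms by (simp add: card_image card_PiE)
qed

lemma finite_linear_forms: "finite V \<Longrightarrow> finite (linear_forms V :: 'a::{field, finite} mpoly set)"
  by (rule card_ge_0_finite) (simp add: card_linear_forms card_gt_0_iff)

text \<open>In x_b the divisor is monic of degree 1, so the remainder of \<open>p\<close> is its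
  value at x_b = - v. Divisibility is thus membership in the kernel of a ring endomorphism of an
  integral domain, which makes these forms prime.\<close>

lemma mvar_plus_dvd_iff:
  fixes v :: "'a::idom mpoly"
  assumes "v \<in> polys_in V" "b \<notin> V"
  shows "mvar b + v dvd p \<longleftrightarrow> psubst (mvar(b := - v)) p = 0"
proof
  have "psubst (mvar(b := - v)) v = psubst mvar v" by (rule psubst_cong[OF assms(1)]) (use assms in auto)
  then have "psubst (mvar(b := - v)) (mvar b + v) = 0"
    by (simp add: psubst_add psubst_id)
  then show "mvar b + v dvd p \<Longrightarrow> psubst (mvar(b := - v)) p = 0"
    by (auto simp: psubst_mult)
next
  assume *: "psubst (mvar(b := - v)) p = 0"
  have "mvar b + v dvd psubst mvar p - psubst (mvar(b := - v)) p"
    by (rule dvd_psubst_diff) simp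
  then show "mvar b + v dvd p" by (simp add: psubst_id *)
qed

text \<open>Each prime divides none of the other factors, so it must divide the cofactor left after
  splitting off their product. Non-associatedness is required in the strong form that divisibility
  within \<open>A\<close> means equality, which normalised linear forms satisfy.\<close>

lemma prod_dvd_of_prime_elements:
  fixes p :: "'b::idom"
  assumes "finite A" "\<And>w. w \<in> A \<Longrightarrow> w dvd p" "\<And>w a b. w \<in> A \<Longrightarrow> w dvd a * b \<Longrightarrow> w dvd a \<or> w dvd b"
    and "\<And>w w'. w \<in> A \<Longrightarrow> w' \<in> A \<Longrightarrow> w dvd w' \<Longrightarrow> w = w'" and "\<And>w. w \<in> A \<Longrightarrow> \<not> w dvd 1"
  shows "\<Prod>A dvd p"
  using assms
proof (induction A)
  case (insert w A)
  have "\<Prod>A dvd p" by (rule insert.IH) (use insert.prems in blast)+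
  then obtain r where r: "p = \<Prod>A * r" ..
  note prime = insert.prems(2) and coprime = insert.prems(3)
  have "\<not> w dvd \<Prod>B" if "finite B" "B \<subseteq> A" for B using that
  proof (induction B)
    case empty
    then show ?case using insert.prems(4)[of w] by simp
  next
    case (insert x B)
    have "\<not> w dvd x" using coprime[of w x] insert.prems \<open>w \<notin> A\<close> by blast
    then show ?case using insert prime[of w x "\<Prod>B"] by auto
  qed
  then have "\<not> w dvd \<Prod>A" using insert.hyps by blast
  then have "w dvd r" using insert.prems(1)[of w] insert.prems(2)[of w "\<Prod>A" r] r by blast
  then show ?case using insert.hyps r by (auto simp: dvd_def mult_ac)
qed simp

text \<open>Coefficient 1 at the first variable x_b selects one representative per class of linear
  forms up to scalars, so that distinct members, also for different \<open>b\<close>, are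
  non-associated primes.\<close>

definition monic_linear_forms :: "nat \<Rightarrow> nat \<Rightarrow> 'a::comm_ring_1 mpoly set" where
  "monic_linear_forms n b = (+) (mvar b) ` linear_forms {Suc b..n}"

lemma monic_linear_forms_prime:
  fixes w :: "'a::idom mpoly"
  assumes "w \<in> monic_linear_forms n b" "w dvd p * q"
  shows "w dvd p \<or> w dvd q"
proof -
  obtain v where v: "w = mvar b + v" "v \<in> polys_in {Suc b..n}"
    using assms(1) linear_forms_polys_in by (auto simp: monic_linear_forms_def)
  then show ?thesis
    using assms(2) mvar_plus_dvd_iff[OF v(2), of b] by (simp add: psubst_mult)
qed

lemma monic_linear_forms_not_dvd_1:
  fixes w :: "'a::idom mpoly"
  assumes "w \<in> monic_linear_forms n b"
  shows "\<not> w dvd 1"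
proof -
  obtain v where v: "w = mvar b + v" "v \<in> polys_in {Suc b..n}"
    using assms(1) linear_forms_polys_in by (auto simp: monic_linear_forms_def)
  then show ?thesis using mvar_plus_dvd_iff[OF v(2), of b 1] by simp
qed

text \<open>Evaluations separate the first variables. If b < b', then w' does not involve x_b, so
  its vanishing at x_b = - v forces w' = 0. If b' < b, the point with x_b' = 1 and all other
  variables 0 kills w but not w'. If b = b', the value v' - v has to vanish.\<close>

lemma monic_linear_forms_dvd:
  fixes w w' :: "'a::idom mpoly"
  assumes w: "w \<in> monic_linear_forms n b" and w': "w' \<in> monic_linear_forms n b'" and dvd: "w dvd w'"
  shows "w = w'"
proof -
  obtain v where v: "w = mvar b + v" "v \<in> polys_in {Suc b..n}"
    using w linear_forms_polys_in by (auto simp: monic_linear_forms_def)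
  obtain v' where v': "w' = mvar b' + v'" "v' \<in> polys_in {Suc b'..n}" "v' \<in> linear_forms {Suc b'..n}"
    using w' linear_forms_polys_in by (auto simp: monic_linear_forms_def)
  have *: "psubst (mvar(b := - v)) w' = 0"
    using dvd mvar_plus_dvd_iff[OF v(2), of b w'] v by simp
  have z: "psubst (\<lambda>_. 0) u = 0" if "u \<in> linear_forms V" for u :: "'a mpoly" and V
    using that by (auto simp: linear_forms_def psubst_sum psubst_mult)
  have one: "psubst (\<lambda>i. if i = c then 1 else 0) u = 0" if "u \<in> linear_forms {Suc c..n}"
    for u :: "'a mpoly" and c
    using that by (auto simp: linear_forms_def psubst_sum psubst_mult intro!: sum.neutral)
  consider "b = b'" | "b < b'" | "b' < b" by linarith
  then show ?thesis
  proof cases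
    case 1
    have "psubst (mvar(b := - v)) v' = psubst mvar v'"
      by (rule psubst_cong[OF v'(2)]) (use 1 in auto)
    then show ?thesis using * v v' 1 by (simp add: psubst_add psubst_id)
  next
    case 2
    have "psubst (mvar(b := - v)) v' = psubst mvar v'"
      by (rule psubst_cong[OF v'(2)]) (use 2 in auto)
    then have "w' = 0" using * v v' 2 by (simp add: psubst_add psubst_id)
    then have "psubst (\<lambda>i. if i = b' then 1 else 0) w' = 0" by simp
    then show ?thesis using one[OF v'(3)] v' by (simp add: psubst_add)
  next
    case 3
    let ?\<tau> = "\<lambda>i. if i = b' then 1 else 0"
    have "v \<in> linear_forms {Suc b..n}" using w v(1) by (auto simp: monic_linear_forms_def)
    then have "psubst ?\<tau> v = 0"
      using 3 by (auto simp: linear_forms_def psubst_sum psubst_mult intro!: sum.neutral)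
    then have "psubst ?\<tau> w = 0" using 3 v by (simp add: psubst_add)
    then have "psubst ?\<tau> w' = 0" using dvd by (auto simp: psubst_mult)
    then show ?thesis using one[OF v'(3)] v' by (simp add: psubst_add)
  qed
qed

lemma prod_monic_linear_forms_dvd:
  fixes p :: "'a::{field, finite} mpoly"
  assumes "A \<subseteq> (\<Union>b. monic_linear_forms n b)" "finite A" "\<And>w. w \<in> A \<Longrightarrow> w dvd p"
  shows "\<Prod>A dvd p"
proof (rule prod_dvd_of_prime_elements[OF assms(2,3)])
  fix w assume "w \<in> A"
  then obtain b where b: "w \<in> monic_linear_forms n b" using assms(1) by blast
  show "w dvd p \<or> w dvd q" if "w dvd p * q" for p q
    using monic_linear_forms_prime[OF b that] .
  show "\<not> w dvd 1" using monic_linear_forms_not_dvd_1[OF b] .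
  show "w = w'" if "w' \<in> A" "w dvd w'" for w'
    using that assms(1) monic_linear_forms_dvd[OF b _ that(2)] by blast
qed

section \<open>Contractions and Milnor operations\<close>

text \<open>Variables and differentials are restricted separately, because \<partial>a loses dx_1
  while its coefficients may still involve x_1.\<close>

definition forms_over :: "nat set \<Rightarrow> nat set \<Rightarrow> 'a::comm_ring_1 mpoly exterior set" where
  "forms_over W V = {w. \<forall>I. ecoeff w I \<in> polys_in W \<and> (ecoeff w I \<noteq> 0 \<longrightarrow> I \<subseteq> V)}"

lemma forms_in_eq_forms_over: "forms_in V = forms_over V V"
  by (simp add: forms_in_def forms_over_def)

lemma forms_over_mono: "W \<subseteq> W' \<Longrightarrow> V \<subseteq> V' \<Longrightarrow> forms_over W V \<subseteq> forms_over W' V'"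
  unfolding forms_over_def using polys_in_mono by blast

lemma forms_over_support: "w \<in> forms_over W V \<Longrightarrow> ecoeff w I \<noteq> 0 \<Longrightarrow> I \<subseteq> V"
  by (simp add: forms_over_def)

lemma forms_over_0 [simp]: "0 \<in> forms_over W V"
  by (simp add: forms_over_def)

lemma forms_over_1 [simp]: "1 \<in> forms_over W V"
  by (auto simp: forms_over_def one_exterior.rep_eq)

lemma forms_over_dx: "i \<in> V \<Longrightarrow> dx i \<in> forms_over W V"
  by (auto simp: forms_over_def ecoeff_dx)

lemma forms_over_add: "u \<in> forms_over W V \<Longrightarrow> v \<in> forms_over W V \<Longrightarrow> u + v \<in> forms_over W V"
  unfolding forms_over_def by (force simp: polys_in_add)

lemma forms_over_uminus: "u \<in> forms_over W V \<Longrightarrow> - u \<in> forms_over W V"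
  by (simp add: forms_over_def polys_in_uminus)

lemma forms_over_diff: "u \<in> forms_over W V \<Longrightarrow> v \<in> forms_over W V \<Longrightarrow> u - v \<in> forms_over W V"
  unfolding diff_conv_add_uminus by (intro forms_over_add forms_over_uminus)

lemma forms_over_escale: "p \<in> polys_in W \<Longrightarrow> u \<in> forms_over W V \<Longrightarrow> p *e u \<in> forms_over W V"
  unfolding forms_over_def by (simp add: polys_in_mult) (metis mult_zero_right)

lemma forms_over_sum: "(\<And>a. a \<in> A \<Longrightarrow> f a \<in> forms_over W V) \<Longrightarrow> (\<Sum>a\<in>A. f a) \<in> forms_over W V"
  by (induction A rule: infinite_finite_induct) (simp_all add: forms_over_add)

lemma forms_over_times:
  assumes u: "u \<in> forms_over W V" and v: "v \<in> forms_over W V"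
  shows "u * v \<in> forms_over W V"
  unfolding forms_over_def mem_Collect_eq times_exterior.rep_eq
proof (intro allI conjI impI)
  fix K
  have "shuffle_sign I J \<in> polys_in W" for I J
    unfolding shuffle_sign_def by (intro polys_in_power polys_in_uminus) simp
  then show "(\<Sum>I\<in>Pow K. shuffle_sign I (K - I) * ecoeff u I * ecoeff v (K - I)) \<in> polys_in W"
    using u v by (intro polys_in_sum polys_in_mult) (auto simp: forms_over_def)
  assume "(\<Sum>I\<in>Pow K. shuffle_sign I (K - I) * ecoeff u I * ecoeff v (K - I)) \<noteq> 0"
  then obtain I where "I \<in> Pow K" "shuffle_sign I (K - I) * ecoeff u I * ecoeff v (K - I) \<noteq> 0"
    by (rule sum.not_neutral_contains_not_neutral)
  then have "ecoeff u I \<noteq> 0" "ecoeff v (K - I) \<noteq> 0" by auto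
  then have "I \<subseteq> V" "K - I \<subseteq> V" using u v by (auto simp: forms_over_def)
  then show "K \<subseteq> V" by blast
qed

lemma forms_over_prod_list: "(\<And>a. a \<in> set xs \<Longrightarrow> f a \<in> forms_over W V) \<Longrightarrow> prod_list (map f xs) \<in> forms_over W V"
  by (induction xs) (simp_all add: forms_over_times)

lemma forms_over_contract:
  assumes c: "\<And>i. i \<in> V \<Longrightarrow> c i \<in> polys_in W" and u: "u \<in> forms_over W V"
  shows "contract c u \<in> forms_over W V"
  unfolding forms_over_def mem_Collect_eq contract.rep_eq
proof (intro allI conjI impI)
  fix J
  let ?s = "\<Sum>i | i \<notin> J \<and> ecoeff u (insert i J) \<noteq> 0. left_sign i J * c i * ecoeff u (insert i J)"
  have "left_sign i K \<in> polys_in W" for i K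
    unfolding left_sign_def by (intro polys_in_power polys_in_uminus) simp
  then show "?s \<in> polys_in W"
    using u c by (intro polys_in_sum polys_in_mult) (auto simp: forms_over_def)
  assume "?s \<noteq> 0"
  then obtain i where "i \<in> {i. i \<notin> J \<and> ecoeff u (insert i J) \<noteq> 0}"
    by (rule sum.not_neutral_contains_not_neutral)
  then show "J \<subseteq> V" using forms_over_support[OF u, of "insert i J"] by auto
qed

lemma contract_uminus: "contract c (- u) = - contract c u"
  using contract_add[of c u "- u"] by (simp add: eq_neg_iff_add_eq_0 add.commute)

lemma contract_diff: "contract c (u - v) = contract c u - contract c v"
  using contract_add[of c u "- v"] by (simp add: contract_uminus)

lemma contract_sum: "contract c (\<Sum>a\<in>A. f a) = (\<Sum>a\<in>A. contract c (f a))"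
  by (induction A rule: infinite_finite_induct) (simp_all add: contract_add)

lemma contract_cong:
  assumes "\<And>I i. ecoeff u I \<noteq> 0 \<Longrightarrow> i \<in> I \<Longrightarrow> c i = d i"
  shows "contract c u = contract d u"
  by (rule exterior_eqI, unfold contract.rep_eq, rule sum.cong[OF refl]) (use assms in auto)

lemma contract_scale_fun: "contract (\<lambda>i. a * c i) u = a *e contract c u"
  by (rule exterior_eqI) (simp add: contract.rep_eq sum_distrib_left mult_ac)

lemma contract_sum_fun: "contract (\<lambda>i. \<Sum>j\<in>A. f j i) u = (\<Sum>j\<in>A. contract (f j) u)"
proof (rule exterior_eqI)
  fix J
  show "ecoeff (contract (\<lambda>i. \<Sum>j\<in>A. f j i) u) J = ecoeff (\<Sum>j\<in>A. contract (f j) u) J"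
    unfolding ecoeff_sum contract.rep_eq sum_distrib_left sum_distrib_right by (rule sum.swap)
qed

lemma contract_linear_times:
  "contract c ((\<Sum>j\<in>A. b j *e dx j) * v)
    = (\<Sum>j\<in>A. b j * c j) *e v - (\<Sum>j\<in>A. b j *e dx j) * contract c v"
proof (induction A rule: infinite_finite_induct)
  case (insert a A)
  have "b a *e (c a *e v - dx a * contract c v) = (b a * c a) *e v - b a *e (dx a * contract c v)"
    by (rule exterior_eqI) (simp add: algebra_simps)
  then show ?case
    using insert by (simp add: distrib_right contract_add contract_escale contract_dx_times escale_times
        escale_simps(2))
qed (simp_all add: escale_simps)

lemma contract_anticommute: "contract c (contract d u) = - contract d (contract c u)"
proof (induction u rule: exterior_induct)
  case (basis a I)
  have "contract c (contract d (prod_list (map dx xs))) = - contract d (contract c (prod_list (map dx xs)))"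
    for xs
    by (induction xs) (simp_all add: contract_dx_times contract_diff contract_escale algebra_simps)
  then show ?case by (simp add: contract_escale escale_minus)
qed (simp_all add: contract_add)

lemma contract_contract: "contract c (contract c u) = 0"
proof (induction u rule: exterior_induct)
  case (basis a I)
  have "contract c (contract c (prod_list (map dx xs))) = 0" for xs
    by (induction xs) (simp_all add: contract_dx_times contract_diff contract_escale)
  then show ?case by (simp add: contract_escale escale_simps)
qed (simp_all add: contract_add)

abbreviation partial_dx :: "nat \<Rightarrow> 'r::comm_ring_1 exterior \<Rightarrow> 'r exterior" where
  "partial_dx i \<equiv> contract (\<lambda>j. if j = i then 1 else 0)"

lemma ecoeff_partial_dx:
  "ecoeff (partial_dx i u) J = (if i \<in> J then 0 else left_sign i J * ecoeff u (insert i J))"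
proof -
  obtain S where S: "finite S" "\<And>i J. ecoeff u (insert i J) \<noteq> 0 \<Longrightarrow> i \<in> S"
    by (rule support_witness[of u]) (rule that)
  have "ecoeff (partial_dx i u) J = (\<Sum>j\<in>insert i S. if j \<in> J then 0
      else left_sign j J * (if j = i then 1 else 0) * ecoeff u (insert j J))"
    by (rule ecoeff_contract) (use S in auto)
  also have "\<dots> = (\<Sum>j\<in>insert i S. if j = i then (if i \<in> J then 0 else left_sign i J * ecoeff u (insert i J)) else 0)"
    by (rule sum.cong) auto
  also have "\<dots> = (if i \<in> J then 0 else left_sign i J * ecoeff u (insert i J))"
    using S(1) by (subst sum.delta) auto
  finally show ?thesis .
qed

lemma partial_dx_eq_0_iff: "partial_dx i u = 0 \<longleftrightarrow> (\<forall>I. i \<in> I \<longrightarrow> ecoeff u I = 0)"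
proof
  assume *: "partial_dx i u = 0"
  show "\<forall>I. i \<in> I \<longrightarrow> ecoeff u I = 0"
  proof (intro allI impI)
    fix I assume "i \<in> I"
    then have "left_sign i (I - {i}) * ecoeff u I = 0"
      using arg_cong[OF *, of "\<lambda>w. ecoeff w (I - {i})"] by (simp add: ecoeff_partial_dx insert_absorb)
    then have "left_sign i (I - {i}) * (left_sign i (I - {i}) * ecoeff u I) = 0" by simp
    then show "ecoeff u I = 0" by (simp add: left_sign_sq flip: mult.assoc)
  qed
next
  assume "\<forall>I. i \<in> I \<longrightarrow> ecoeff u I = 0"
  then show "partial_dx i u = 0" by (intro exterior_eqI) (simp add: ecoeff_partial_dx)
qed

section \<open>Exterior degrees and words in the Milnor operations\<close>

definition has_degree :: "nat \<Rightarrow> 'r::zero exterior \<Rightarrow> bool" where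
  "has_degree r w \<longleftrightarrow> (\<forall>I. ecoeff w I \<noteq> 0 \<longrightarrow> card I = r)"

lemma has_degree_contract:
  assumes "has_degree (Suc r) u"
  shows "has_degree r (contract c u)"
  unfolding has_degree_def contract.rep_eq
proof (intro allI impI)
  fix J
  assume "(\<Sum>i | i \<notin> J \<and> ecoeff u (insert i J) \<noteq> 0. left_sign i J * c i * ecoeff u (insert i J)) \<noteq> 0"
  then obtain i where i: "i \<in> {i. i \<notin> J \<and> ecoeff u (insert i J) \<noteq> 0}"
    by (rule sum.not_neutral_contains_not_neutral)
  then have "card (insert i J) = Suc r" using assms by (simp add: has_degree_def)
  moreover have "finite J" using i ecoeff_infinite[of "insert i J" u] by auto
  ultimately show "card J = r" using i by simp
qed

lemma milnor_0 [simp]: "milnor j 0 = 0"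
  by (simp add: milnor_def)

lemma milnor_diff: "milnor j (u - v) = milnor j u - milnor j v"
  by (simp add: milnor_def contract_diff)

lemma milnor_anticommute: "milnor i (milnor j u) = - milnor j (milnor i u)"
  unfolding milnor_def by (rule contract_anticommute)

lemma milnor_milnor: "milnor i (milnor i u) = 0"
  unfolding milnor_def by (rule contract_contract)

lemma foldr_milnor_0 [simp]: "foldr milnor xs 0 = 0"
  by (induction xs) simp_all

lemma foldr_milnor_add: "foldr milnor xs (u + v) = foldr milnor xs u + foldr milnor xs v"
  by (induction xs) (simp_all add: milnor_linear)

lemma foldr_milnor_diff: "foldr milnor xs (u - v) = foldr milnor xs u - foldr milnor xs v"
  by (induction xs) (simp_all add: milnor_diff)

lemma foldr_milnor_escale: "foldr milnor xs (p *e u) = p *e foldr milnor xs u"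
  by (induction xs) (simp_all add: milnor_linear)

lemma foldr_milnor_sum: "foldr milnor xs (\<Sum>a\<in>A. f a) = (\<Sum>a\<in>A. foldr milnor xs (f a))"
  by (induction A rule: infinite_finite_induct) (simp_all add: foldr_milnor_add)

lemma has_degree_foldr_milnor: "has_degree (length xs + r) u \<Longrightarrow> has_degree r (foldr milnor xs u)"
proof (induction xs arbitrary: r)
  case (Cons x xs)
  then have "has_degree (Suc r) (foldr milnor xs u)" by simp
  then show ?case by (simp add: milnor_def[of x] has_degree_contract)
qed simp

lemma partial_dx_foldr_milnor:
  "partial_dx i (foldr milnor xs u) = (- 1) ^ length xs *e foldr milnor xs (partial_dx i u)"
  by (induction xs)
     (simp_all add: milnor_def contract_anticommute[of "\<lambda>j. if j = i then 1 else 0"]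
       contract_escale escale_simps)

text \<open>The operations square to zero and anticommute like the \<open>dx i\<close>, so the
  insertion argument of \<open>times_ordered_prod\<close> carries over.\<close>

lemma milnor_milnor_set:
  assumes "finite A"
  shows "milnor a (milnor_set A u) = (if a \<in> A then 0 else left_sign a A *e milnor_set (insert a A) u)"
  using assms
proof (induction A rule: finite_linorder_min_induct)
  case empty
  have [simp]: "left_sign a {} = (1 :: 'a mpoly)" by (simp add: left_sign_def)
  show ?case by (simp add: milnor_set_def escale_simps)
next
  case (insert b A)
  have b: "b \<notin> A" using insert by auto
  have Cons: "milnor_set (insert b A) u = milnor b (milnor_set A u)"
    unfolding milnor_set_def sorted_list_of_set_insert_min[OF insert(1,2)] by simp
  consider "a = b" | "a < b" | "b < a" by linarith
  then show ?case
  proof cases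
    case 1
    then show ?thesis by (simp add: Cons milnor_milnor)
  next
    case 2
    have "{k \<in> insert b A. k < a} = {}" using 2 insert by auto
    then have s: "left_sign a (insert b A) = (1 :: 'a mpoly)" by (simp only: left_sign_def) simp
    have "sorted_list_of_set (insert a (insert b A)) = a # sorted_list_of_set (insert b A)"
      by (rule sorted_list_of_set_insert_min) (use 2 insert in auto)
    moreover have "a \<notin> insert b A" using 2 insert by auto
    ultimately show ?thesis by (simp only: s milnor_set_def) (simp add: escale_simps)
  next
    case 3
    have l: "milnor_set (insert b (insert a A)) u = milnor b (milnor_set (insert a A) u)"
      unfolding milnor_set_def by (subst sorted_list_of_set_insert_min) (use 3 insert in auto)
    have "milnor a (milnor_set (insert b A) u) = - milnor b (milnor a (milnor_set A u))"
      by (simp add: Cons milnor_anticommute[of a b])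
    also have "\<dots> = (if a \<in> A then 0
        else (- left_sign a A) *e milnor_set (insert b (insert a A)) u)"
      unfolding insert(3) l by (simp add: milnor_linear escale_simps)
    also have "\<dots> = (if a \<in> insert b A then 0
        else left_sign a (insert b A) *e milnor_set (insert a (insert b A)) u)"
      using 3 b insert(1) by (auto simp: left_sign_insert insert_commute[of a b])
    finally show ?thesis .
  qed
qed

lemma left_sign_cases: "left_sign a A = 1 \<or> left_sign a A = - 1"
  unfolding left_sign_def by (cases "even (card {k \<in> A. k < a})") simp_all

text \<open>Composing operations neither keeps the indices increasing nor excludes repetitions; the
  relations between them reduce any word to a signed Q_I or to 0.\<close>

lemma foldr_milnor_cases:
  "\<exists>s. (s = 1 \<or> s = - 1) \<and> foldr milnor xs u = (if distinct xs then s *e milnor_set (set xs) u else 0)"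
proof (induction xs)
  case Nil
  show ?case by (intro exI[of _ 1]) (simp add: milnor_set_def escale_simps)
next
  case (Cons x xs)
  then obtain s where s: "s = 1 \<or> s = - 1"
    and eq: "foldr milnor xs u = (if distinct xs then s *e milnor_set (set xs) u else 0)" by blast
  show ?case
    using s left_sign_cases[of x "set xs", where 'a = "'a mpoly"]
    by (intro exI[of _ "s * left_sign x (set xs)"])
       (auto simp: eq milnor_linear milnor_milnor_set escale_simps)
qed

text \<open>For a product \<open>u\<close> of differentials these are, up to sign, cofactors of the
  Moore matrix along the row of x_l: the coefficients of x_l^(q^j) in the degree-zero part of Q_0
  ... Q_(k-1) (dx_l u). The recursion expresses Q_k (dx_l u) = x_l^(q^k) u - dx_l Q_k u, the
  operation of largest index acting first. They do not depend on l, which is what Cramer's rule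
  exploits.\<close>

primrec milnor_cofactor :: "nat \<Rightarrow> 'a::{field, finite} mpoly exterior \<Rightarrow> nat \<Rightarrow> 'a mpoly" where
  "milnor_cofactor 0 u j = 0"
| "milnor_cofactor (Suc k) u j =
    (if j = k then ecoeff (foldr milnor [0..<k] u) {} else - milnor_cofactor k (milnor k u) j)"

lemma ecoeff_foldr_milnor_dx_times:
  fixes u :: "'a::{field, finite} mpoly exterior"
  shows "ecoeff (foldr milnor [0..<k] (dx l * u)) {} =
    (\<Sum>j<k. milnor_cofactor k u j * mvar l ^ (card (UNIV :: 'a set) ^ j))"
proof (induction k arbitrary: u)
  case 0
  show ?case by (simp add: ecoeff_dx_times)
next
  case (Suc k)
  have "foldr milnor [0..<Suc k] (dx l * u) = foldr milnor [0..<k] (milnor k (dx l * u))"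
    by simp
  also have "milnor k (dx l * u) = mvar l ^ (card (UNIV :: 'a set) ^ k) *e u - dx l * milnor k u"
    by (simp add: milnor_def contract_dx_times)
  finally show ?case
    by (simp add: foldr_milnor_diff foldr_milnor_escale Suc.IH mult.commute sum_negf)
qed

lemma milnor_forms_over:
  assumes "V \<subseteq> W" "u \<in> forms_over W V"
  shows "milnor j u \<in> forms_over W V"
  unfolding milnor_def by (rule forms_over_contract) (use assms in \<open>auto intro!: polys_in_intros\<close>)

lemma foldr_milnor_forms_over: "V \<subseteq> W \<Longrightarrow> u \<in> forms_over W V \<Longrightarrow> foldr milnor xs u \<in> forms_over W V"
  by (induction xs) (simp_all add: milnor_forms_over)

lemma milnor_cofactor_polys_in: "V \<subseteq> W \<Longrightarrow> u \<in> forms_over W V \<Longrightarrow> milnor_cofactor k u j \<in> polys_in W"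
proof (induction k arbitrary: u)
  case (Suc k)
  have "ecoeff (foldr milnor [0..<k] u) {} \<in> polys_in W"
    using foldr_milnor_forms_over[OF Suc.prems] by (simp add: forms_over_def)
  then show ?case using Suc milnor_forms_over[OF Suc.prems] by (simp add: polys_in_uminus)
qed simp

section \<open>The finite field and Frobenius\<close>

text \<open>Multiplication by a nonzero x permutes the nonzero elements, so the factor x^(q-1)
  leaves their product unchanged.\<close>

lemma power_card_eq_same: "x ^ card (UNIV :: 'a set) = x" for x :: "'a::{field, finite}"
proof (cases "x = 0")
  case False
  have "x * (\<Prod>y\<in>UNIV-{0}. x * y) = x * x ^ (card (UNIV :: 'a set) - 1) * \<Prod>(UNIV-{0})"
    by (simp add: prod.distrib mult_ac)
  also have "x * x ^ (card (UNIV :: 'a set) - 1) = x ^ Suc (card (UNIV :: 'a set) - 1)"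
    by (subst power_Suc) auto
  also have "Suc (card (UNIV :: 'a set) - 1) = card (UNIV :: 'a set)"
    using finite_UNIV_card_ge_0[where ?'a = 'a] by simp
  also have "(\<Prod>y\<in>UNIV-{0}. x * y) = (\<Prod>y\<in>UNIV-{0}. y)"
    by (rule prod.reindex_bij_witness[of _ "\<lambda>y. y / x" "\<lambda>y. x * y"]) (use False in auto)
  finally show ?thesis by simp
qed (use finite_UNIV_card_ge_0[where ?'a = 'a] in auto)

lemma CHAR_mpoly: "CHAR('a::comm_ring_1 mpoly) = CHAR('a)"
proof (rule CHAR_eqI)
  have *: "of_nat n = (mconst (of_nat n) :: 'a mpoly)" for n
    by (induction n) simp_all
  have "mconst c = 0 \<longleftrightarrow> c = 0" for c :: 'a
    by (metis mconst_def lookup_single_eq lookup_zero single_zero)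
  then have "of_nat n = (0 :: 'a mpoly) \<longleftrightarrow> of_nat n = (0 :: 'a)" for n
    by (simp add: *)
  then show "of_nat CHAR('a) = (0 :: 'a mpoly)" "\<And>n. of_nat n = (0 :: 'a mpoly) \<Longrightarrow> CHAR('a) dvd n"
    by (simp_all add: of_nat_eq_0_iff_char_dvd)
qed

lemma CHAR_of_card:
  assumes "prime p" "card (UNIV :: 'a::{field, finite} set) = p ^ k"
  shows "CHAR('a) = p"
proof -
  \<comment> \<open>Translation by 1 permutes the field, so the sum of all differences (x + 1) - x,
    which is the image of q in the field, vanishes.\<close>
  have "of_nat (card (UNIV :: 'a set)) = (\<Sum>x\<in>(UNIV :: 'a set). (x + 1) - x)" by simp
  also have "\<dots> = (\<Sum>x\<in>(UNIV :: 'a set). x + 1) - (\<Sum>x\<in>UNIV. x)" by (rule sum_subtractf)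
  also have "(\<Sum>x\<in>(UNIV :: 'a set). x + 1) = (\<Sum>x\<in>UNIV. x)"
    by (rule sum.reindex_bij_witness[of _ "\<lambda>x. x - 1" "\<lambda>x. x + 1"]) auto
  finally have "of_nat p ^ k = (0 :: 'a)" using assms(2) by simp
  then have "of_nat p = (0 :: 'a)" by simp
  then have "CHAR('a) dvd p" by (simp add: of_nat_eq_0_iff_char_dvd)
  then show ?thesis using assms(1) CHAR_not_1'[where 'a = 'a] by (auto simp: prime_nat_iff)
qed

text \<open>The power is additive in characteristic p and fixes the coefficients, which lie in F_q.
  This makes Q_e of the differential of a linear form a power of that form.\<close>

lemma frobenius_linear:
  fixes b :: "nat \<Rightarrow> 'a::{field, finite}"
  assumes "prime p" "card (UNIV :: 'a set) = p ^ k"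
  shows "(\<Sum>j\<in>A. mconst (b j) * mvar j) ^ (card (UNIV :: 'a set) ^ e)
    = (\<Sum>j\<in>A. mconst (b j) * mvar j ^ (card (UNIV :: 'a set) ^ e))"
proof -
  have 1: "mconst c ^ m = mconst (c ^ m)" for c :: 'a and m by (induction m) simp_all
  have 2: "c ^ (card (UNIV :: 'a set) ^ e) = c" for c :: 'a
    by (induction e) (simp_all add: power_card_eq_same power_mult)
  have "CHAR('a mpoly) = p" using CHAR_of_card[OF assms] by (simp add: CHAR_mpoly)
  then have "(\<Sum>j\<in>A. mconst (b j) * mvar j) ^ (card (UNIV :: 'a set) ^ e)
      = (\<Sum>j\<in>A. (mconst (b j) * mvar j) ^ (card (UNIV :: 'a set) ^ e))"
    by (intro freshmans_dream_sum'[of _ "k * e"]) (use assms in \<open>simp_all add: power_mult\<close>)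
  then show ?thesis by (simp add: power_mult_distrib 1 2)
qed

text \<open>Congruence of forms modulo \<open>w\<close>, taken coordinatewise so that no quotient
  ring has to be formed.\<close>

definition dvd_form :: "'r::comm_ring_1 \<Rightarrow> 'r exterior \<Rightarrow> bool" where
  "dvd_form w u \<longleftrightarrow> (\<forall>I. w dvd ecoeff u I)"

lemma dvd_form_add: "dvd_form w u \<Longrightarrow> dvd_form w v \<Longrightarrow> dvd_form w (u + v)"
  by (simp add: dvd_form_def)

lemma dvd_form_contract: "dvd_form w u \<Longrightarrow> dvd_form w (contract c u)"
  unfolding dvd_form_def contract.rep_eq by (intro allI dvd_sum dvd_mult) simp

lemma dvd_form_foldr_milnor: "dvd_form w u \<Longrightarrow> dvd_form w (foldr milnor xs u)"
  by (induction xs) (simp_all add: milnor_def dvd_form_contract)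

text \<open>Modulo w, the form Q_x (\<theta> u') = w^(q^x) u' - \<theta> Q_x u' is again a multiple
  of \<theta>, since the exponent q^x is positive. The existential cofactor absorbs the
  signs.\<close>

lemma foldr_milnor_linear_times:
  fixes b :: "nat \<Rightarrow> 'a::{field, finite}"
  assumes q: "prime p" "card (UNIV :: 'a set) = p ^ k"
  shows "\<exists>u'. dvd_form (\<Sum>j\<in>A. mconst (b j) * mvar j)
    (foldr milnor xs ((\<Sum>j\<in>A. mconst (b j) *e dx j) * u) - (\<Sum>j\<in>A. mconst (b j) *e dx j) * u')"
proof (induction xs)
  case Nil
  show ?case by (intro exI[of _ u]) (simp add: dvd_form_def)
next
  case (Cons x xs)
  let ?w = "\<Sum>j\<in>A. mconst (b j) * mvar j" and ?\<theta> = "\<Sum>j\<in>A. mconst (b j) *e dx j"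
  obtain u' where u': "dvd_form ?w (foldr milnor xs (?\<theta> * u) - ?\<theta> * u')" using Cons.IH ..
  let ?e = "card (UNIV :: 'a set) ^ x"
  have "milnor x (?\<theta> * u') = ?w ^ ?e *e u' - ?\<theta> * milnor x u'"
    unfolding milnor_def contract_linear_times frobenius_linear[OF q] ..
  then have eq: "foldr milnor (x # xs) (?\<theta> * u) - ?\<theta> * (- milnor x u')
      = milnor x (foldr milnor xs (?\<theta> * u) - ?\<theta> * u') + ?w ^ ?e *e u'"
    by (simp only: milnor_diff foldr.simps o_apply) (simp add: algebra_simps)
  have "dvd_form ?w (?w ^ ?e *e u')"
    unfolding dvd_form_def ecoeff_escale by (intro allI dvd_mult2 dvd_power) (simp add: finite_UNIV_card_ge_0)
  moreover have "dvd_form ?w (milnor x (foldr milnor xs (?\<theta> * u) - ?\<theta> * u'))"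
    unfolding milnor_def[of x] by (rule dvd_form_contract[OF u'])
  ultimately show ?case
    by (intro exI[of _ "- milnor x u'"]) (simp only: eq dvd_form_add)
qed

section \<open>The Moore determinant\<close>

text \<open>Writing \<open>\<theta> = dx\<^sub>b + \<dots>\<close> for the differential of the linear form \<open>w = x\<^sub>b + \<dots>\<close>, the identity
  \<open>u = \<partial>\<^sub>b (\<theta> u) + \<theta> \<partial>\<^sub>b u\<close> shows that \<open>u\<close> is a multiple of \<open>\<theta>\<close> modulo \<open>w\<close>, and every
  \<open>Q\<^sub>j \<theta>\<close> is a power of \<open>w\<close>.\<close>

lemma linear_form_dvd_foldr_milnor:
  fixes b :: "nat \<Rightarrow> 'a::{field, finite}"
  assumes q: "prime p" "card (UNIV :: 'a set) = p ^ k"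
    and A: "finite A" "i \<in> A" "b i = 1"
    and dvd: "dvd_form (\<Sum>j\<in>A. mconst (b j) * mvar j) ((\<Sum>j\<in>A. mconst (b j) *e dx j) * u)"
  shows "(\<Sum>j\<in>A. mconst (b j) * mvar j) dvd ecoeff (foldr milnor xs u) {}"
proof -
  let ?w = "\<Sum>j\<in>A. mconst (b j) * mvar j" and ?\<theta> = "\<Sum>j\<in>A. mconst (b j) *e dx j"
  have "(\<Sum>j\<in>A. mconst (b j) * (if j = i then 1 else 0)) = (1 :: 'a mpoly)"
    using A by (subst sum.remove[of A i]) (auto intro!: sum.neutral)
  then have "partial_dx i (?\<theta> * u) = u - ?\<theta> * partial_dx i u"
    unfolding contract_linear_times by (simp only: escale_simps)
  then have u: "u = partial_dx i (?\<theta> * u) + ?\<theta> * partial_dx i u" by simp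
  then have 1: "foldr milnor xs u = foldr milnor xs (partial_dx i (?\<theta> * u)) + foldr milnor xs (?\<theta> * partial_dx i u)"
    unfolding foldr_milnor_add[symmetric] by (rule arg_cong)
  obtain u' where u': "dvd_form ?w (foldr milnor xs (?\<theta> * partial_dx i u) - ?\<theta> * u')"
    using foldr_milnor_linear_times[OF q] by blast
  have "dvd_form ?w (foldr milnor xs (partial_dx i (?\<theta> * u)))"
    by (intro dvd_form_foldr_milnor dvd_form_contract dvd)
  from dvd_form_add[OF this u'] have "dvd_form ?w (foldr milnor xs u - ?\<theta> * u')"
    by (simp only: 1 add_diff_eq)
  then have "?w dvd ecoeff (foldr milnor xs u - ?\<theta> * u') {}"
    unfolding dvd_form_def by (rule spec)
  moreover have "ecoeff (?\<theta> * u') {} = 0"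
    unfolding sum_distrib_right escale_times ecoeff_sum ecoeff_escale ecoeff_dx_times by simp
  ultimately show ?thesis by (simp only: ecoeff_minus diff_zero)
qed

text \<open>The value \<open>a = 1\<close> gives \<omega> and \<open>a = 2\<close> gives \<mu>; the
  other values serve the descent from the empty product at \<open>a = Suc n\<close>, by which the
  Moore determinant is factored.\<close>

definition top_form :: "nat \<Rightarrow> nat \<Rightarrow> 'r::comm_ring_1 exterior" where
  "top_form n a = prod_list (map dx [a..<Suc n])"

lemma top_form_Suc_same [simp]: "top_form n (Suc n) = 1"
  by (simp add: top_form_def)

lemma top_form_step: "a \<le> n \<Longrightarrow> top_form n a = dx a * top_form n (Suc a)"
  by (simp only: top_form_def upt_conv_Cons[of a "Suc n"] less_Suc_eq_le list.map prod_list.Cons)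

lemma top_form_eq_ordered_prod: "top_form n a = ordered_prod dx {a..n}"
  by (metis atLeastLessThanSuc_atLeastAtMost sorted_list_of_set_range top_form_def)

lemma ecoeff_top_form: "ecoeff (top_form n a) J = (if J = {a..n} then 1 else 0)"
  by (simp add: top_form_eq_ordered_prod ecoeff_ordered_prod_dx)

lemma dx_times_top_form: "i \<in> {a..n} \<Longrightarrow> dx i * top_form n a = 0"
  unfolding top_form_eq_ordered_prod by (subst times_ordered_prod[OF dx_sq dx_anticommute]) auto

lemma top_form_forms_over: "top_form n a \<in> forms_over W {a..n}"
  unfolding top_form_def by (rule forms_over_prod_list) (auto intro: forms_over_dx)

lemma has_degree_top_form: "has_degree (Suc n - a) (top_form n a :: 'r::comm_ring_1 exterior)"
  by (auto simp: has_degree_def ecoeff_top_form split: if_splits)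

text \<open>Up to sign, \<open>moore n a\<close> is the Moore determinant \<open>det (x\<^sub>i\<^sup>q\<^sup>^\<^sup>j)\<close> of \<open>x\<^sub>a, \<dots>, x\<^sub>n\<close>.\<close>

definition moore :: "nat \<Rightarrow> nat \<Rightarrow> 'a::{field, finite} mpoly" where
  "moore n a = ecoeff (foldr milnor [0..<Suc n - a] (top_form n a)) {}"

lemma moore_Suc_same: "moore n (Suc n) = 1"
  by (simp add: moore_def one_exterior.rep_eq)

lemma monic_linear_formsE:
  fixes w :: "'a::comm_ring_1 mpoly"
  assumes "w \<in> monic_linear_forms n b" "b \<le> n"
  obtains c where "c b = 1" "w = (\<Sum>j\<in>{b..n}. mconst (c j) * mvar j)"
proof -
  obtain c where c: "w = mvar b + (\<Sum>j\<in>{Suc b..n}. mconst (c j) * mvar j)"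
    using assms(1) by (auto simp: monic_linear_forms_def linear_forms_def)
  have "{b..n} = insert b {Suc b..n}" using assms(2) by auto
  moreover have "(\<Sum>j\<in>{Suc b..n}. mconst ((c(b := 1)) j) * mvar j) = (\<Sum>j\<in>{Suc b..n}. mconst (c j) * mvar j)"
    by (rule sum.cong) auto
  ultimately have "w = (\<Sum>j\<in>{b..n}. mconst ((c(b := 1)) j) * mvar j)" using c by simp
  then show ?thesis by (rule that[rotated]) simp
qed

text \<open>The differential of \<open>w\<close> is a combination of dx_a, ..., dx_n and annihilates
  their product, so \<open>linear_form_dvd_foldr_milnor\<close> applies with the zero form in its
  divisibility premise.\<close>

lemma monic_linear_form_dvd_moore:
  fixes w :: "'a::{field, finite} mpoly"
  assumes q: "prime p" "card (UNIV :: 'a set) = p ^ k"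
    and w: "w \<in> monic_linear_forms n b" "a \<le> b" "b \<le> n"
  shows "w dvd moore n a"
proof -
  obtain c where c: "c b = 1" "w = (\<Sum>j\<in>{b..n}. mconst (c j) * mvar j)"
    using monic_linear_formsE[OF w(1,3)] .
  have "mconst (c j) *e dx j * top_form n a = 0" if "j \<in> {b..n}" for j
    unfolding escale_times by (subst dx_times_top_form) (use that w in \<open>auto simp: escale_simps\<close>)
  then have "(\<Sum>j\<in>{b..n}. mconst (c j) *e dx j) * top_form n a = 0"
    by (simp add: sum_distrib_right)
  then have "dvd_form w ((\<Sum>j\<in>{b..n}. mconst (c j) *e dx j) * top_form n a)"
    by (simp add: dvd_form_def)
  then show ?thesis
    using linear_form_dvd_foldr_milnor[OF q, of "{b..n}" b c "top_form n a"] c w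
    by (simp add: moore_def)
qed

text \<open>This is the Laplace expansion along the row of x_a; only the exponents q^j occur, and
  the cofactors are free of x_a.\<close>

lemma moore_expansion:
  assumes "a \<le> n"
  shows "moore n a = (\<Sum>j<Suc n - a. milnor_cofactor (Suc n - a) (top_form n (Suc a)) j
      * (mvar a :: 'a::{field, finite} mpoly) ^ (card (UNIV :: 'a set) ^ j))"
  unfolding moore_def top_form_step[OF assms] by (rule ecoeff_foldr_milnor_dx_times)

lemma moore_leading_cofactor:
  "a \<le> n \<Longrightarrow> milnor_cofactor (Suc n - a) (top_form n (Suc a)) (n - a) = moore n (Suc a)"
  by (simp add: Suc_diff_le moore_def)

text \<open>Makes degree and leading coefficient in x_a available. The coefficients stay in the same
  ring, so evaluation at x_a recovers \<open>p\<close>.\<close>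

definition univ_poly :: "nat \<Rightarrow> 'a::comm_ring_1 mpoly \<Rightarrow> 'a mpoly poly" where
  "univ_poly a p = (\<Sum>m\<in>Poly_Mapping.keys p. [:mconst (Poly_Mapping.lookup p m):]
     * monom_eval (\<lambda>i. if i = a then [:0, 1:] else [:mvar i:]) m)"

lemma univ_poly_superset:
  "finite S \<Longrightarrow> Poly_Mapping.keys p \<subseteq> S \<Longrightarrow> univ_poly a p = (\<Sum>m\<in>S.
     [:mconst (Poly_Mapping.lookup p m):] * monom_eval (\<lambda>i. if i = a then [:0, 1:] else [:mvar i:]) m)"
  unfolding univ_poly_def by (rule sum.mono_neutral_left) (auto simp: in_keys_iff)

lemma univ_poly_0 [simp]: "univ_poly a 0 = 0"
  by (simp add: univ_poly_def)

lemma univ_poly_add: "univ_poly a (p + q) = univ_poly a p + univ_poly a q"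
proof -
  let ?S = "Poly_Mapping.keys p \<union> Poly_Mapping.keys q"
  have *: "[:x + y:] * z = [:x:] * z + [:y:] * z" for x y :: "'a mpoly" and z
    by (simp flip: smult_add_left)
  show ?thesis
    by (subst (1 2 3) univ_poly_superset[of ?S])
       (simp_all add: Poly_Mapping.keys_add lookup_add * del: mult_pCons_left flip: sum.distrib)
qed

lemma univ_poly_sum: "univ_poly a (\<Sum>x\<in>A. f x) = (\<Sum>x\<in>A. univ_poly a (f x))"
  by (induction A rule: infinite_finite_induct) (simp_all add: univ_poly_add)

lemma univ_poly_single: "univ_poly a (Poly_Mapping.single m c)
    = [:mconst c:] * monom_eval (\<lambda>i. if i = a then [:0, 1:] else [:mvar i:]) m"
  by (subst univ_poly_superset[of "{m}"]) simp_all

lemma univ_poly_mult: "univ_poly a (p * q) = univ_poly a p * univ_poly a q"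
proof (induction p rule: mpoly_induct)
  case (single m c)
  show ?case
  proof (induction q rule: mpoly_induct)
    case (single m' c')
    have "[:x * y:] = [:x:] * [:y:]" for x y :: "'a mpoly" by simp
    then show ?case by (simp only: mult_single univ_poly_single monom_eval_add mconst_simps mult_ac)
  qed (simp_all add: distrib_left univ_poly_add)
qed (simp_all add: distrib_right univ_poly_add)

lemma monom_eval_const_poly: "monom_eval (\<lambda>i. [:\<sigma> i:]) m = [:monom_eval \<sigma> m:]"
proof -
  have "(\<Prod>i\<in>A. [:f i:]) = [:\<Prod>i\<in>A. f i:]" for A and f :: "nat \<Rightarrow> 'a"
    by (induction A rule: infinite_finite_induct) (simp_all add: one_pCons)
  then show ?thesis by (simp add: monom_eval_def poly_const_pow)
qed

lemma univ_poly_const: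
  assumes "p \<in> polys_in V" "a \<notin> V"
  shows "univ_poly a p = [:p:]"
proof -
  have "univ_poly a p = (\<Sum>m\<in>Poly_Mapping.keys p. [:Poly_Mapping.single m (Poly_Mapping.lookup p m):])"
    unfolding univ_poly_def
  proof (rule sum.cong[OF refl])
    fix m assume "m \<in> Poly_Mapping.keys p"
    then have "a \<notin> Poly_Mapping.keys m" using assms by (auto simp: polys_in_def)
    then have "monom_eval (\<lambda>i. if i = a then [:0, 1:] else [:mvar i:]) m = monom_eval (\<lambda>i. [:mvar i :: 'a mpoly:]) m"
      unfolding monom_eval_def by (intro prod.cong) auto
    then show "[:mconst (Poly_Mapping.lookup p m):] * monom_eval (\<lambda>i. if i = a then [:0, 1:] else [:mvar i:]) m
        = [:Poly_Mapping.single m (Poly_Mapping.lookup p m):]"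
      by (simp add: monom_eval_const_poly monom_eval_mvar mconst_def mult_single)
  qed
  also have "\<dots> = [:\<Sum>m\<in>Poly_Mapping.keys p. Poly_Mapping.single m (Poly_Mapping.lookup p m):]"
  proof -
    have "(\<Sum>m\<in>A. [:f m:]) = [:\<Sum>m\<in>A. f m:]" for A and f :: "(nat \<Rightarrow>\<^sub>0 nat) \<Rightarrow> 'a mpoly"
      by (induction A rule: infinite_finite_induct) simp_all
    then show ?thesis .
  qed
  finally show ?thesis by (simp only: mpoly_expansion)
qed

lemma univ_poly_mvar: "univ_poly a (mvar a) = [:0, 1:]"
  by (simp add: mvar_def univ_poly_single monom_eval_def)

lemma univ_poly_1 [simp]: "univ_poly a 1 = 1"
  using univ_poly_const[of 1 "{}" a] by (simp add: one_pCons)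

lemma univ_poly_power: "univ_poly a (p ^ k) = univ_poly a p ^ k"
  by (induction k) (simp_all add: univ_poly_mult)

lemma univ_poly_prod: "univ_poly a (\<Prod>x\<in>A. f x) = (\<Prod>x\<in>A. univ_poly a (f x))"
  by (induction A rule: infinite_finite_induct) (simp_all add: univ_poly_mult)

lemma poly_univ_poly: "poly (univ_poly a p) (mvar a) = p"
proof (induction p rule: mpoly_induct)
  case (single m c)
  have "poly (monom_eval (\<lambda>i. if i = a then [:0, 1:] else [:mvar i:]) m) (mvar a) = (monom_eval mvar m :: 'a mpoly)"
    unfolding monom_eval_def by (auto simp: poly_prod intro!: prod.cong)
  then show ?case by (simp add: univ_poly_single monom_eval_mvar mconst_def mult_single)
qed (simp_all add: univ_poly_add)

lemma univ_poly_monic_linear_form: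
  fixes w :: "'a::comm_ring_1 mpoly"
  shows "w \<in> monic_linear_forms n a \<Longrightarrow> univ_poly a w = [:w - mvar a, 1:]"
  using univ_poly_const[OF linear_forms_polys_in, of _ "{Suc a..n}" a, where 'a = 'a]
  by (auto simp: monic_linear_forms_def univ_poly_add univ_poly_mvar)

text \<open>There is one factor for each of the q^(n-a) linear forms in the later variables, and
  each is monic of degree 1 in x_a.\<close>

lemma univ_poly_prod_monic_linear_forms:
  fixes a n :: nat
  defines "P \<equiv> univ_poly a (\<Prod>(monic_linear_forms n a :: 'a::{field, finite} mpoly set))"
  shows "lead_coeff P = 1" "degree P = card (UNIV :: 'a set) ^ (n - a)"
proof -
  let ?W = "monic_linear_forms n a :: 'a mpoly set"
  have P: "P = (\<Prod>w\<in>?W. [:w - mvar a, 1:])"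
    unfolding P_def univ_poly_prod by (rule prod.cong) (simp_all add: univ_poly_monic_linear_form)
  show "lead_coeff P = 1" unfolding P lead_coeff_prod by simp
  have "card ?W = card (UNIV :: 'a set) ^ (n - a)"
    unfolding monic_linear_forms_def by (simp add: card_image card_linear_forms)
  then show "degree P = card (UNIV :: 'a set) ^ (n - a)"
    unfolding P by (simp add: degree_prod_eq_sum_degree)
qed

lemma two_le_card_UNIV: "2 \<le> card (UNIV :: 'a::{field, finite} set)"
proof -
  have "card {0, 1 :: 'a} \<le> card (UNIV :: 'a set)" by (rule card_mono) simp_all
  then show ?thesis by simp
qed

text \<open>Since q \<ge> 2, the exponents q^j are distinct, and only j = n - a contributes at the
  top. The degree is merely bounded, as the leading coefficient is not yet known to be
  nonzero.\<close>

lemma moore_univ_poly: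
  assumes "a \<le> n"
  shows "coeff (univ_poly a (moore n a :: 'a::{field, finite} mpoly)) (card (UNIV :: 'a set) ^ (n - a)) = moore n (Suc a)"
    and "degree (univ_poly a (moore n a :: 'a mpoly)) \<le> card (UNIV :: 'a set) ^ (n - a)"
proof -
  let ?q = "card (UNIV :: 'a set)" and ?c = "milnor_cofactor (Suc n - a) (top_form n (Suc a)) :: nat \<Rightarrow> 'a mpoly"
  have c: "?c j \<in> polys_in {Suc a..n}" for j
    by (rule milnor_cofactor_polys_in[OF order_refl]) (rule top_form_forms_over)
  have "univ_poly a (?c j * mvar a ^ (?q ^ j)) = monom (?c j) (?q ^ j)" for j
    by (simp add: univ_poly_mult univ_poly_const[OF c] univ_poly_power univ_poly_mvar monom_altdef)
  then have eq: "univ_poly a (moore n a) = (\<Sum>j<Suc n - a. monom (?c j) (?q ^ j))"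
    unfolding moore_expansion[OF assms] univ_poly_sum by simp
  have "?q ^ j = ?q ^ (n - a) \<longleftrightarrow> j = n - a" for j
    using two_le_card_UNIV[where 'a = 'a] by (intro power_inject_exp) simp
  then have "coeff (univ_poly a (moore n a)) (?q ^ (n - a)) = (\<Sum>j<Suc n - a. if j = n - a then ?c j else 0)"
    unfolding eq by (simp add: coeff_sum coeff_monom cong: if_cong)
  also have "\<dots> = ?c (n - a)" using assms by (simp add: Suc_diff_le)
  finally show "coeff (univ_poly a (moore n a :: 'a mpoly)) (?q ^ (n - a)) = moore n (Suc a)"
    by (simp only: moore_leading_cofactor[OF assms])
  show "degree (univ_poly a (moore n a :: 'a mpoly)) \<le> ?q ^ (n - a)"
    unfolding eq
  proof (rule degree_sum_le)
    fix j assume "j \<in> {..<Suc n - a}"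
    then have "?q ^ j \<le> ?q ^ (n - a)"
      using two_le_card_UNIV[where 'a = 'a] by (intro power_increasing) auto
    then show "degree (monom (?c j) (?q ^ j)) \<le> ?q ^ (n - a)"
      using degree_monom_le order_trans by blast
  qed simp
qed

lemma finite_monic_linear_forms: "finite (monic_linear_forms n b :: 'a::{field, finite} mpoly set)"
  by (simp add: monic_linear_forms_def finite_linear_forms)

text \<open>The product of the forms divides the left side and already has the maximal degree
  q^(n-a) in x_a, so the quotient is constant in x_a; comparing coefficients of that power
  identifies it. The nonvanishing premise is supplied by the induction in
  \<open>moore_nonzero\<close>.\<close>

lemma moore_step_aux:
  assumes q: "prime p" "card (UNIV :: 'a::{field, finite} set) = p ^ k" and "a \<le> n"
    and nz: "moore n (Suc a) \<noteq> (0 :: 'a mpoly)"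
  shows "moore n a = \<Prod>(monic_linear_forms n a) * (moore n (Suc a) :: 'a mpoly)"
proof -
  let ?W = "monic_linear_forms n a :: 'a mpoly set" and ?N = "card (UNIV :: 'a set) ^ (n - a)"
  have "\<Prod>?W dvd moore n a"
    by (rule prod_monic_linear_forms_dvd)
       (use finite_monic_linear_forms monic_linear_form_dvd_moore[OF q] assms in auto)
  then obtain r where r: "moore n a = \<Prod>?W * r" ..
  note W = univ_poly_prod_monic_linear_forms[of a n, where 'a = 'a]
  have eq: "univ_poly a (moore n a) = univ_poly a (\<Prod>?W) * univ_poly a r"
    by (simp only: r univ_poly_mult)
  have "univ_poly a (moore n a :: 'a mpoly) \<noteq> 0"
    using moore_univ_poly(1)[OF assms(3), where 'a = 'a] nz by auto
  then have ne: "univ_poly a (\<Prod>?W) \<noteq> 0" "univ_poly a r \<noteq> 0" unfolding eq by auto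
  then have "degree (univ_poly a (moore n a :: 'a mpoly)) = ?N + degree (univ_poly a r)"
    unfolding eq by (subst degree_mult_eq) (simp_all add: W)
  then have deg: "degree (univ_poly a r) = 0"
    using moore_univ_poly(2)[OF assms(3), where 'a = 'a] by simp
  have "coeff (univ_poly a (moore n a)) ?N = coeff (univ_poly a (\<Prod>?W) * univ_poly a r)
      (degree (univ_poly a (\<Prod>?W)) + degree (univ_poly a r))"
    unfolding eq by (simp add: deg W)
  also have "\<dots> = coeff (univ_poly a r) 0"
    by (subst coeff_mult_degree_sum) (simp add: W(1) deg)
  finally have "coeff (univ_poly a r) 0 = moore n (Suc a)"
    by (simp only: moore_univ_poly(1)[OF assms(3)])
  moreover have "univ_poly a r = [:coeff (univ_poly a r) 0:]"
    using degree_0_id[OF deg] by simp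
  ultimately have "r = moore n (Suc a)"
    using poly_univ_poly[of a r] by simp
  then show ?thesis using r by simp
qed

lemma moore_nonzero:
  assumes q: "prime p" "card (UNIV :: 'a::{field, finite} set) = p ^ k" and "a \<le> Suc n"
  shows "moore n a \<noteq> (0 :: 'a mpoly)"
  using assms(3)
proof (induction rule: inc_induct)
  case base
  show ?case by (simp add: moore_Suc_same)
next
  case (step b)
  have "\<Prod>(monic_linear_forms n b :: 'a mpoly set) \<noteq> 0"
    using univ_poly_prod_monic_linear_forms(1)[of b n, where 'a = 'a] by auto
  then show ?case using moore_step_aux[OF q _ step.IH] step by simp
qed

lemma moore_step:
  assumes q: "prime p" "card (UNIV :: 'a::{field, finite} set) = p ^ k" and "a \<le> n"
  shows "moore n a = \<Prod>(monic_linear_forms n a) * (moore n (Suc a) :: 'a mpoly)"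
  by (rule moore_step_aux[OF assms moore_nonzero[OF q]]) (use assms in simp)

text \<open>The point with x_b = 1 and all other variables 0 gives 1 on forms starting at x_b and 0
  on those starting later.\<close>

lemma monic_linear_forms_disjoint:
  assumes "b < b'"
  shows "monic_linear_forms n b \<inter> monic_linear_forms n b' = ({} :: 'a::comm_ring_1 mpoly set)"
proof -
  have *: "psubst (\<lambda>i. if i = b then 1 else 0) w = (if c = b then 1 else 0)"
    if "b \<le> c" "w \<in> monic_linear_forms n c" for c and w :: "'a mpoly"
    using that by (auto simp: monic_linear_forms_def linear_forms_def psubst_add psubst_sum psubst_mult
        intro!: sum.neutral)
  show ?thesis using *[of b] *[of b'] assms by fastforce
qed

text \<open>Iterating \<open>moore_step\<close> writes the determinant as a product of pairwise
  non-associated primes, so divisibility can be tested one factor at a time.\<close>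

lemma moore_dvd:
  fixes r :: "'a::{field, finite} mpoly"
  assumes q: "prime p" "card (UNIV :: 'a set) = p ^ k" and "a \<le> Suc n"
    and dvd: "\<And>b w. a \<le> b \<Longrightarrow> b \<le> n \<Longrightarrow> w \<in> monic_linear_forms n b \<Longrightarrow> w dvd r"
  shows "moore n a dvd r"
proof -
  have disj: "monic_linear_forms n b \<inter> monic_linear_forms n b' = ({} :: 'a mpoly set)" if "b \<noteq> b'" for b b'
    using that monic_linear_forms_disjoint[of b b' n] monic_linear_forms_disjoint[of b' b n]
    by (cases "b < b'") auto
  have "moore n a = (\<Prod>b\<in>{a..n}. \<Prod>(monic_linear_forms n b :: 'a mpoly set))"
    using assms(3)
  proof (induction rule: inc_induct)
    case (step b)
    then have "{b..n} = insert b {Suc b..n}" by auto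
    then show ?case using step moore_step[OF q, of b n] by simp
  qed (simp add: moore_Suc_same)
  also have "\<dots> = \<Prod>(\<Union>b\<in>{a..n}. monic_linear_forms n b)"
    by (rule prod.UNION_disjoint[symmetric]) (simp_all add: finite_monic_linear_forms disj)
  also have "\<dots> dvd r"
    by (rule prod_monic_linear_forms_dvd) (use finite_monic_linear_forms dvd in auto)
  finally show ?thesis .
qed

section \<open>Milnor operations on the top form\<close>

text \<open>Contract the zero form dx_l dx_a ... dx_n. The outcome is the Kronecker delta of
  Cramer's rule.\<close>

lemma dx_times_partial_dx_top_form:
  assumes "l \<in> {a..n}"
  shows "dx l * partial_dx i (top_form n a) = (if l = i then top_form n a else 0)"
proof -
  have "0 = partial_dx i (dx l * top_form n a)"
    by (simp add: dx_times_top_form[OF assms])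
  also have "\<dots> = (if l = i then 1 else 0) *e top_form n a - dx l * partial_dx i (top_form n a)"
    by (rule contract_dx_times)
  finally show ?thesis by (auto simp: escale_simps)
qed

text \<open>Cramer's rule for the vectors \<open>(x\<^sub>l\<^sup>q\<^sup>^\<^sup>j)\<^sub>l\<close>, read as an identity between contractions.\<close>

lemma moore_partial_dx:
  fixes u :: "'a::{field, finite} mpoly exterior"
  assumes u: "u \<in> forms_over UNIV {a..n}" and "a \<le> n"
  shows "moore n a *e partial_dx i u =
    (\<Sum>j<Suc n - a. milnor_cofactor (Suc n - a) (partial_dx i (top_form n a)) j *e milnor j u)"
proof -
  let ?c = "milnor_cofactor (Suc n - a) (partial_dx i (top_form n a)) :: nat \<Rightarrow> 'a mpoly"
  let ?Q = "\<lambda>j l. mvar l ^ (card (UNIV :: 'a set) ^ j) :: 'a mpoly"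
  have *: "moore n a * (if l = i then 1 else 0) = (\<Sum>j<Suc n - a. ?c j * ?Q j l)" if "l \<in> {a..n}" for l
    using ecoeff_foldr_milnor_dx_times[of "Suc n - a" l "partial_dx i (top_form n a) :: 'a mpoly exterior"]
    unfolding dx_times_partial_dx_top_form[OF that] by (auto simp: moore_def)
  have "moore n a *e partial_dx i u = contract (\<lambda>l. moore n a * (if l = i then 1 else 0)) u"
    by (rule contract_scale_fun[symmetric])
  also have "\<dots> = contract (\<lambda>l. \<Sum>j<Suc n - a. ?c j * ?Q j l) u"
  proof (rule contract_cong)
    fix I l assume "ecoeff u I \<noteq> 0" "l \<in> I"
    then have "l \<in> {a..n}" using forms_over_support[OF u] by blast
    then show "moore n a * (if l = i then 1 else 0) = (\<Sum>j<Suc n - a. ?c j * ?Q j l)" by (rule *)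
  qed
  also have "\<dots> = (\<Sum>j<Suc n - a. ?c j *e contract (?Q j) u)"
    unfolding contract_sum_fun contract_scale_fun ..
  finally show ?thesis by (simp only: milnor_def)
qed

text \<open>Up to the nonzero factor L, each \<partial>_i is a combination of the Q_j. If every word
  in the Q_j has zero degree-zero part on \<open>u\<close>, the same holds for \<partial>_i u, and
  iteration reaches every coordinate of \<open>u\<close>.\<close>

lemma form_eq_0_if_pairings_0:
  fixes u :: "'a::{field, finite} mpoly exterior"
  assumes q: "prime p" "card (UNIV :: 'a set) = p ^ k" and "a \<le> n"
    and u: "u \<in> forms_over UNIV {a..n}"
    and pair: "\<And>J. J \<subseteq> {..<Suc n - a} \<Longrightarrow> ecoeff (milnor_set J u) {} = 0"
  shows "u = 0"
proof (rule exterior_eqI)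
  \<comment> \<open>Sets are exchanged for words, since the induction appends an arbitrary index at
    the right end.\<close>
  have "ecoeff (foldr milnor xs u) {} = 0" if "set xs \<subseteq> {..<Suc n - a}" for xs
    using foldr_milnor_cases[of xs u] pair[OF that] by auto
  moreover have "ecoeff u K = 0"
    if "finite K" "u \<in> forms_over UNIV {a..n}"
      "\<And>xs. set xs \<subseteq> {..<Suc n - a} \<Longrightarrow> ecoeff (foldr milnor xs u) {} = 0"
    for K and u :: "'a mpoly exterior"
    using that
  proof (induction K arbitrary: u)
    case empty
    then show ?case using empty.prems(2)[of "[]"] by simp
  next
    case (insert i K)
    have "ecoeff (partial_dx i u) K = 0"
    proof (rule insert.IH)
      show "partial_dx i u \<in> forms_over UNIV {a..n}"
        by (rule forms_over_contract[OF _ insert.prems(1)]) (simp add: polys_in_def)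
      fix xs assume xs: "set xs \<subseteq> {..<Suc n - a}"
      have "moore n a * ecoeff (foldr milnor xs (partial_dx i u)) {}
          = ecoeff (foldr milnor xs (moore n a *e partial_dx i u)) {}"
        by (simp add: foldr_milnor_escale)
      also have "\<dots> = (\<Sum>j<Suc n - a. milnor_cofactor (Suc n - a) (partial_dx i (top_form n a)) j
          * ecoeff (foldr milnor (xs @ [j]) u) {})"
        unfolding moore_partial_dx[OF insert.prems(1) \<open>a \<le> n\<close>] foldr_milnor_sum foldr_milnor_escale
        by simp
      also have "\<dots> = 0" using xs insert.prems(2)[of "xs @ [_]"] by (intro sum.neutral) simp
      finally show "ecoeff (foldr milnor xs (partial_dx i u)) {} = 0"
        using moore_nonzero[OF q, of a n] \<open>a \<le> n\<close> by simp
    qed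
    then have "left_sign i K * ecoeff u (insert i K) = 0"
      using insert.hyps by (simp add: ecoeff_partial_dx)
    moreover have "left_sign i K \<noteq> (0 :: 'a mpoly)" using left_sign_sq[of i K, where 'a = "'a mpoly"] by auto
    ultimately show ?case by simp
  qed
  ultimately show "ecoeff u K = ecoeff 0 K" for K
    using u by (cases "finite K") (simp_all add: ecoeff_infinite)
qed

text \<open>A shared index gives 0 because Q_j squares to 0. For disjoint sets only the complement
  of \<open>I\<close> exhausts the degree of the top form, and the result is then L up to
  reordering. The pairing matrix is thus L times a signed permutation matrix.\<close>

lemma milnor_set_pairing:
  fixes n a :: nat
  defines "T \<equiv> {0..<Suc n - a}"
  assumes "I \<subseteq> T"
  shows "\<exists>s. (s = 1 \<or> s = - 1) \<and> (\<forall>J\<subseteq>T. ecoeff (milnor_set J (milnor_set I (top_form n a))) {}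
    = (if J = T - I then s * moore n a else (0 :: 'a::{field, finite} mpoly)))"
proof -
  let ?l = sorted_list_of_set
  have fin: "finite J" if "J \<subseteq> T" for J using that by (rule finite_subset) (simp add: T_def)
  have app: "milnor_set J (milnor_set I u) = foldr milnor (?l J @ ?l I) u" for J and u :: "'a mpoly exterior"
    by (simp add: milnor_set_def)
  obtain s where s: "s = 1 \<or> s = - 1" and eq: "foldr milnor (?l (T - I) @ ?l I) (top_form n a :: 'a mpoly exterior)
      = (if distinct (?l (T - I) @ ?l I) then s *e milnor_set (set (?l (T - I) @ ?l I)) (top_form n a) else 0)"
    using foldr_milnor_cases by blast
  have "distinct (?l (T - I) @ ?l I)" "set (?l (T - I) @ ?l I) = T"
    using assms fin[of I] fin[of "T - I"] by auto
  then have 1: "ecoeff (milnor_set (T - I) (milnor_set I (top_form n a :: 'a mpoly exterior))) {} = s * moore n a"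
    unfolding app eq by (simp add: moore_def milnor_set_def T_def)
  have 2: "ecoeff (milnor_set J (milnor_set I (top_form n a :: 'a mpoly exterior))) {} = 0"
    if J: "J \<subseteq> T" "J \<noteq> T - I" for J
  proof (cases "J \<inter> I = {}")
    case False
    then have "\<not> distinct (?l J @ ?l I)" using fin J assms by simp
    then show ?thesis using foldr_milnor_cases[of "?l J @ ?l I" "top_form n a :: 'a mpoly exterior"]
      unfolding app by auto
  next
    case True
    then have "J \<union> I \<subset> T" using J assms by blast
    then have "card (J \<union> I) < card T" by (intro psubset_card_mono) (simp_all add: T_def)
    moreover have "card (J \<union> I) = card J + card I"
      using True fin J assms by (intro card_Un_disjoint) auto
    ultimately have less: "length (?l J @ ?l I) < Suc n - a" by (simp add: T_def)
    then have "has_degree (length (?l J @ ?l I) + (Suc n - a - length (?l J @ ?l I))) (top_form n a :: 'a mpoly exterior)"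
      using has_degree_top_form[of n a] by simp
    from has_degree_foldr_milnor[OF this]
    have "ecoeff (foldr milnor (?l J @ ?l I) (top_form n a :: 'a mpoly exterior)) {} \<noteq> 0 \<longrightarrow>
        card ({} :: nat set) = Suc n - a - length (?l J @ ?l I)"
      unfolding has_degree_def by (rule spec)
    then show ?thesis using less unfolding app card.empty by arith
  qed
  show ?thesis using s by (intro exI[of _ s] conjI allI impI) (simp_all add: 1 2)
qed

text \<open>With T the full index set, applying Q_(T - I) and taking degree-zero parts leaves d_I L
  up to sign, and L is nonzero.\<close>

lemma milnor_top_forms_independent:
  fixes d :: "nat set \<Rightarrow> 'a::{field, finite} mpoly"
  assumes q: "prime p" "card (UNIV :: 'a set) = p ^ k" and "a \<le> n"
    and eq: "(\<Sum>I\<in>Pow {0..<Suc n - a}. d I *e milnor_set I (top_form n a)) = 0"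
    and I: "I \<subseteq> {0..<Suc n - a}"
  shows "d I = 0"
proof -
  let ?T = "{0..<Suc n - a}"
  have "d K * ecoeff (milnor_set (?T - I) (milnor_set K (top_form n a))) {} = 0" if "K \<subseteq> ?T" "K \<noteq> I" for K
  proof -
    have K: "K \<subseteq> ?T" and "?T - I \<noteq> ?T - K" using that I by blast+
    moreover obtain s where *: "\<forall>J\<subseteq>?T. ecoeff (milnor_set J (milnor_set K (top_form n a))) {}
        = (if J = ?T - K then s * moore n a else (0 :: 'a mpoly))"
      using milnor_set_pairing[OF K, where 'a = 'a] by blast
    from * have "ecoeff (milnor_set (?T - I) (milnor_set K (top_form n a))) {}
        = (if ?T - I = ?T - K then s * moore n a else (0 :: 'a mpoly))"
      by (elim allE impE) auto
    ultimately show ?thesis by simp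
  qed
  then have "(\<Sum>K\<in>Pow ?T. d K * ecoeff (milnor_set (?T - I) (milnor_set K (top_form n a))) {})
      = (\<Sum>K\<in>{I}. d K * ecoeff (milnor_set (?T - I) (milnor_set K (top_form n a))) {})"
    using I by (intro sum.mono_neutral_right) auto
  moreover have "(\<Sum>K\<in>Pow ?T. d K * ecoeff (milnor_set (?T - I) (milnor_set K (top_form n a))) {}) = 0"
    using arg_cong[OF eq, of "\<lambda>u. ecoeff (milnor_set (?T - I) u) {}"]
    by (simp add: milnor_set_def foldr_milnor_sum foldr_milnor_escale)
  moreover obtain s where "s = 1 \<or> s = - 1"
      "ecoeff (milnor_set (?T - I) (milnor_set I (top_form n a))) {} = s * (moore n a :: 'a mpoly)"
    using milnor_set_pairing[OF I, where 'a = 'a] by (metis Diff_subset)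
  ultimately show "d I = 0" using moore_nonzero[OF q, of a n] \<open>a \<le> n\<close> by auto
qed

lemma moore_polys_in: "{a..n} \<subseteq> W \<Longrightarrow> (moore n a :: 'a::{field, finite} mpoly) \<in> polys_in W"
  using foldr_milnor_forms_over[OF _ top_form_forms_over, of a n W "[0..<Suc n - a]", where 'a = 'a]
  by (simp add: moore_def forms_over_def)

text \<open>The pairing forces the coefficient at I to be, up to sign, the degree-zero part of Q_(T
  - I) u divided by L; the divisibility premise makes it a polynomial. The resulting combination has
  the same pairings as \<open>u\<close>, hence equals it.\<close>

lemma milnor_top_forms_span:
  fixes u :: "'a::{field, finite} mpoly exterior"
  assumes q: "prime p" "card (UNIV :: 'a set) = p ^ k" and "a \<le> n" and W: "{a..n} \<subseteq> W"
    and u: "u \<in> forms_over W {a..n}"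
    and dvd: "\<And>J. J \<subseteq> {0..<Suc n - a} \<Longrightarrow> moore n a dvd ecoeff (milnor_set J u) {}"
  obtains d where "\<And>I. I \<subseteq> {0..<Suc n - a} \<Longrightarrow> d I \<in> polys_in W"
    and "u = (\<Sum>I\<in>Pow {0..<Suc n - a}. d I *e milnor_set I (top_form n a))"
proof -
  let ?T = "{0..<Suc n - a}"
  have L: "moore n a \<noteq> (0 :: 'a mpoly)" "moore n a \<in> (polys_in W :: 'a mpoly set)"
    using moore_nonzero[OF q, of a n] \<open>a \<le> n\<close> moore_polys_in[OF W] by simp_all
  have "\<forall>I\<in>Pow ?T. \<exists>s. (s = 1 \<or> s = - 1) \<and> (\<forall>J\<subseteq>?T. ecoeff (milnor_set J (milnor_set I (top_form n a))) {}
      = (if J = ?T - I then s * moore n a else (0 :: 'a mpoly)))"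
    using milnor_set_pairing[of _ n a, where 'a = 'a] by blast
  then have "\<exists>s. \<forall>I\<in>Pow ?T. (s I = 1 \<or> s I = - 1) \<and> (\<forall>J\<subseteq>?T. ecoeff (milnor_set J (milnor_set I (top_form n a))) {}
      = (if J = ?T - I then s I * moore n a else (0 :: 'a mpoly)))"
    by (rule bchoice)
  then obtain s where s': "\<forall>I\<in>Pow ?T. (s I = 1 \<or> s I = - 1) \<and> (\<forall>J\<subseteq>?T. ecoeff (milnor_set J (milnor_set I (top_form n a))) {}
      = (if J = ?T - I then s I * moore n a else (0 :: 'a mpoly)))" ..
  have s: "s I = 1 \<or> s I = - 1" if "I \<subseteq> ?T" for I
    using s' that by blast
  have pair: "ecoeff (milnor_set J (milnor_set I (top_form n a))) {}
      = (if J = ?T - I then s I * moore n a else (0 :: 'a mpoly))" if "I \<subseteq> ?T" "J \<subseteq> ?T" for I J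
    using s' that by (metis (no_types, lifting) PowI)
  have "\<forall>J\<in>Pow ?T. \<exists>r. ecoeff (milnor_set J u) {} = moore n a * r"
    using dvd by (simp add: dvd_def)
  then obtain r where r: "\<And>J. J \<subseteq> ?T \<Longrightarrow> ecoeff (milnor_set J u) {} = moore n a * r J"
    unfolding bchoice_iff by auto
  \<comment> \<open>Multiplying by the sign \<open>s I\<close> also inverts it.\<close>
  define d where "d = (\<lambda>I. s I * r (?T - I))"
  have d: "d I \<in> polys_in W" if "I \<subseteq> ?T" for I
  proof -
    have "ecoeff (milnor_set (?T - I) u) {} \<in> polys_in W"
      using foldr_milnor_forms_over[OF W u] by (auto simp: milnor_set_def forms_over_def)
    then have "r (?T - I) \<in> polys_in W"
      using r[of "?T - I"] L by (intro polys_in_cancel[of "moore n a" "r (?T - I)"]) auto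
    then show ?thesis using s[OF that] by (auto simp: d_def polys_in_uminus)
  qed
  let ?v = "\<Sum>I\<in>Pow ?T. d I *e milnor_set I (top_form n a)"
  have "u - ?v = 0"
  proof (rule form_eq_0_if_pairings_0[OF q \<open>a \<le> n\<close>])
    have U: "forms_over W {a..n} \<subseteq> (forms_over UNIV {a..n} :: 'a mpoly exterior set)"
      by (rule forms_over_mono) auto
    have "?v \<in> forms_over W {a..n}"
      unfolding milnor_set_def
      by (intro forms_over_sum forms_over_escale foldr_milnor_forms_over W top_form_forms_over d) auto
    then show "u - ?v \<in> forms_over UNIV {a..n}" using u U by (intro forms_over_diff) auto
    fix J assume "J \<subseteq> {..<Suc n - a}"
    then have J: "J \<subseteq> ?T" by auto
    have "ecoeff (milnor_set J ?v) {} = (\<Sum>I\<in>Pow ?T. d I * ecoeff (milnor_set J (milnor_set I (top_form n a))) {})"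
      by (simp add: milnor_set_def foldr_milnor_sum foldr_milnor_escale)
    also have "\<dots> = (\<Sum>I\<in>Pow ?T. if I = ?T - J then moore n a * r J else 0)"
    proof (rule sum.cong[OF refl])
      fix I assume "I \<in> Pow ?T"
      then have I: "I \<subseteq> ?T" by simp
      then have "J = ?T - I \<longleftrightarrow> I = ?T - J" using J by blast
      moreover have "?T - (?T - J) = J" using J by blast
      ultimately show "d I * ecoeff (milnor_set J (milnor_set I (top_form n a))) {}
          = (if I = ?T - J then moore n a * r J else 0)"
        using s[OF I] by (auto simp: pair[OF I J] d_def)
    qed
    also have "\<dots> = moore n a * r J" by simp
    finally show "ecoeff (milnor_set J (u - ?v)) {} = 0"
      using r[OF J] by (simp add: milnor_set_def foldr_milnor_diff)
  qed
  then show ?thesis using that[of d] d by simp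
qed

section \<open>The group action\<close>

lemma act_form_uminus: "act_form n g (- u) = - act_form n g u"
  using act_form_add[of n g u "- u"] by (simp add: act_form_0 eq_neg_iff_add_eq_0 add.commute)

lemma act_form_diff: "act_form n g (u - v) = act_form n g u - act_form n g v"
  using act_form_add[of n g u "- v"] by (simp add: act_form_uminus)

lemma act_form_sum: "act_form n g (\<Sum>a\<in>A. f a) = (\<Sum>a\<in>A. act_form n g (f a))"
  by (induction A rule: infinite_finite_induct) (simp_all add: act_form_0 act_form_add)

lemma act_poly_diff: "act_poly n g (p - q) = act_poly n g p - act_poly n g q"
  by (simp add: act_poly_def psubst_diff)

lemma act_poly_power: "act_poly n g (p ^ k) = act_poly n g p ^ k"
  by (simp add: act_poly_def psubst_power)

lemma act_poly_sum: "act_poly n g (\<Sum>a\<in>A. f a) = (\<Sum>a\<in>A. act_poly n g (f a))"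
  by (simp add: act_poly_def psubst_sum)

lemma act_form_dx_row: "act_form n g (dx i) = row_form n (inv\<^bsub>GL n\<^esub> g) i"
  by (simp only: act_form_dx row_form_def)

text \<open>The premise is the conclusion for u = dx_i, and both sides obey the same Leibniz rule.
  One statement covers the Q_j and \<partial>.\<close>

lemma contract_act_form:
  assumes c: "\<And>i. i \<in> V \<Longrightarrow>
      (\<Sum>j\<in>{1..n}. mconst ((inv\<^bsub>GL n\<^esub> g) $$ (i - 1, j - 1)) * c j) = act_poly n g (d i)"
    and u: "u \<in> forms_over UNIV V"
  shows "contract c (act_form n g u) = act_form n g (contract d u)"
proof -
  have list: "contract c (act_form n g (prod_list (map dx xs))) = act_form n g (contract d (prod_list (map dx xs)))"
    if "set xs \<subseteq> V" for xs
    using that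
  proof (induction xs)
    case Nil
    show ?case by (simp add: act_form_1 act_form_0)
  next
    case (Cons a xs)
    let ?w = "prod_list (map dx xs) :: 'a mpoly exterior"
    have "contract c (act_form n g (dx a * ?w))
        = act_poly n g (d a) *e act_form n g ?w - act_form n g (dx a) * contract c (act_form n g ?w)"
      using Cons.prems unfolding act_form_times act_form_dx
      by (subst contract_linear_times) (simp only: c list.set insert_subset)
    also have "\<dots> = act_form n g (contract d (dx a * ?w))"
      using Cons by (simp add: contract_dx_times act_form_diff act_form_escale act_form_times)
    finally show ?case by simp
  qed
  have "contract c (act_form n g (ecoeff u I *e ordered_prod dx I))
      = act_form n g (contract d (ecoeff u I *e ordered_prod dx I))" for I
  proof (cases "ecoeff u I = 0")
    case False
    then have "I \<subseteq> V" "finite I" using forms_over_support[OF u] ecoeff_infinite by blast+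
    then show ?thesis using list[of "sorted_list_of_set I"]
      by (simp add: act_form_escale contract_escale)
  qed (simp add: escale_simps act_form_0)
  then show ?thesis
    by (subst (1 2) exterior_expansion[OF finite_ecoeff_support order_refl, of u])
       (simp add: act_form_sum contract_sum)
qed

lemma milnor_act_form:
  fixes u :: "'a::{field, finite} mpoly exterior"
  assumes q: "prime p" "card (UNIV :: 'a set) = p ^ k"
  shows "milnor j (act_form n g u) = act_form n g (milnor j u)"
  unfolding milnor_def
  by (rule contract_act_form[of UNIV])
     (simp_all add: act_poly_power act_poly_mvar frobenius_linear[OF q] forms_over_def polys_in_def)

lemma foldr_milnor_act_form:
  fixes u :: "'a::{field, finite} mpoly exterior"
  assumes q: "prime p" "card (UNIV :: 'a set) = p ^ k"
  shows "foldr milnor xs (act_form n g u) = act_form n g (foldr milnor xs u)"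
  by (induction xs) (simp_all add: milnor_act_form[OF q])

section \<open>Determinants as coordinates of products of linear forms\<close>

lemma ecoeff_linear_times:
  "ecoeff ((\<Sum>j\<in>C. b j *e dx j) * v) K = (\<Sum>j\<in>C. if j \<in> K then b j * left_sign j K * ecoeff v (K - {j}) else 0)"
  by (simp add: sum_distrib_right escale_times ecoeff_dx_times mult.assoc if_distrib cong: if_cong)

lemma has_degree_prod_linear:
  "has_degree (length is) (prod_list (map (\<lambda>i. \<Sum>j\<in>C. A i j *e dx j) is))"
proof (induction "is")
  case Nil
  show ?case by (simp add: has_degree_def one_exterior.rep_eq)
next
  case (Cons i "is")
  show ?case
    unfolding has_degree_def
  proof (intro allI impI)
    fix K
    let ?v = "prod_list (map (\<lambda>i. \<Sum>j\<in>C. A i j *e dx j) is)"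
    assume nz: "ecoeff (prod_list (map (\<lambda>i. \<Sum>j\<in>C. A i j *e dx j) (i # is))) K \<noteq> 0"
    then have "(\<Sum>j\<in>C. if j \<in> K then A i j * left_sign j K * ecoeff ?v (K - {j}) else 0) \<noteq> 0"
      by (simp add: ecoeff_linear_times)
    then obtain j where "(if j \<in> K then A i j * left_sign j K * ecoeff ?v (K - {j}) else 0) \<noteq> 0"
      by (rule sum.not_neutral_contains_not_neutral)
    then have j: "j \<in> K" "ecoeff ?v (K - {j}) \<noteq> 0" by (auto split: if_splits)
    have "finite K" using nz ecoeff_infinite by blast
    then show "card K = length (i # is)"
      using j Cons.IH by (simp add: has_degree_def card.remove)
  qed
qed

text \<open>The recursion on the left is the Laplace expansion along the first row.\<close>

lemma ecoeff_prod_linear_det: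
  assumes "finite C" "sorted_wrt (<) cs" "set cs \<subseteq> C"
  shows "ecoeff (prod_list (map (\<lambda>i. \<Sum>j\<in>C. A i j *e dx j) [i..<i + length cs])) (set cs)
    = det (mat (length cs) (length cs) (\<lambda>(r, c). A (i + r) (cs ! c)))"
  using assms(2,3)
proof (induction "length cs" arbitrary: cs i)
  case 0
  then show ?case by (simp add: one_exterior.rep_eq)
next
  case (Suc k)
  let ?\<theta> = "\<lambda>i. \<Sum>j\<in>C. A i j *e dx j"
  let ?M = "mat (Suc k) (Suc k) (\<lambda>(r, c). A (i + r) (cs ! c))"
  define v where "v = prod_list (map ?\<theta> [Suc i..<Suc i + k])"
  note len = \<open>Suc k = length cs\<close>[symmetric]
  have dist: "distinct cs" using Suc.prems(1) by (simp add: strict_sorted_iff)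
  have bij: "bij_betw ((!) cs) {..<Suc k} (set cs)"
    using bij_betw_nth[OF dist, of "{..<Suc k}" "set cs"] len by simp
  have less: "cs ! l < cs ! l' \<longleftrightarrow> l < l'" if "l < Suc k" "l' < Suc k" for l l'
    using that Suc.prems(1) len sorted_wrt_nth_less[of "(<)" cs]
    by (metis linorder_less_linear order_less_asym)
  have term_l: "left_sign (cs ! l) (set cs) * ecoeff v (set cs - {cs ! l}) = cofactor ?M 0 l"
    if l: "l < Suc k" for l
  proof -
    define cs' where "cs' = take l cs @ drop (Suc l) cs"
    have cs: "cs = take l cs @ cs ! l # drop (Suc l) cs"
      using l len by (simp add: id_take_nth_drop)
    have "{x \<in> set cs. x < cs ! l} = (!) cs ` {..<l}"
      using less l len by (force simp: set_conv_nth image_iff)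
    moreover have "inj_on ((!) cs) {..<l}"
      using bij l by (auto simp: bij_betw_def inj_on_def)
    ultimately have "card {x \<in> set cs. x < cs ! l} = l" by (simp add: card_image)
    then have 1: "left_sign (cs ! l) (set cs) = ((- 1) ^ l :: 'a)" by (simp add: left_sign_def)
    have sorted: "sorted_wrt (<) cs'"
      using Suc.prems(1) by (subst (asm) cs) (auto simp: cs'_def sorted_wrt_append)
    have "set cs - {cs ! l} = set cs'"
      using dist by (subst (asm) cs, subst (1) cs) (auto simp: cs'_def)
    moreover have len': "length cs' = k" using l len by (simp add: cs'_def)
    moreover have "set cs' \<subseteq> C" using \<open>set cs - {cs ! l} = set cs'\<close> Suc.prems(2) by blast
    ultimately have "ecoeff v (set cs - {cs ! l}) = det (mat k k (\<lambda>(r, c). A (Suc i + r) (cs' ! c)))"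
      using Suc.hyps(1)[of cs' "Suc i"] sorted by (simp only: v_def)
    also have "mat k k (\<lambda>(r, c). A (Suc i + r) (cs' ! c)) = mat_delete ?M 0 l"
      unfolding mat_delete_def
      by (rule eq_matI) (use l len in \<open>auto simp: cs'_def nth_append min_def\<close>)
    finally show ?thesis by (simp add: 1 cofactor_def)
  qed
  have "[i..<i + length cs] = i # [Suc i..<Suc i + k]"
    using len by (simp add: upt_conv_Cons del: upt_Suc)
  then have "ecoeff (prod_list (map ?\<theta> [i..<i + length cs])) (set cs) = ecoeff (?\<theta> i * v) (set cs)"
    by (simp add: v_def)
  also have "\<dots> = (\<Sum>j\<in>set cs. A i j * (left_sign j (set cs) * ecoeff v (set cs - {j})))"
    unfolding ecoeff_linear_times using assms(1) Suc.prems(2)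
    by (intro sum.mono_neutral_cong_right) (auto simp: mult.assoc)
  also have "\<dots> = (\<Sum>l<Suc k. A i (cs ! l) * (left_sign (cs ! l) (set cs) * ecoeff v (set cs - {cs ! l})))"
    by (rule sum.reindex_bij_betw[OF bij, symmetric])
  also have "\<dots> = (\<Sum>l<Suc k. ?M $$ (0, l) * cofactor ?M 0 l)"
    by (rule sum.cong) (simp_all add: term_l del: sum.lessThan_Suc)
  also have "\<dots> = det ?M"
    by (rule laplace_expansion_row[symmetric]) auto
  finally show ?case by (simp only: len)
qed

text \<open>A product of n linear forms in n differentials has exterior degree n, so only the
  coordinate at {1..n} can survive, and that one is a determinant.\<close>

lemma act_form_top_form:
  fixes g :: "'a::field mat"
  assumes h: "inv\<^bsub>GL n\<^esub> g \<in> carrier_mat n n"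
  shows "act_form n g (top_form n 1) = mconst (det (inv\<^bsub>GL n\<^esub> g)) *e top_form n 1"
proof (rule exterior_eqI)
  fix K
  let ?h = "inv\<^bsub>GL n\<^esub> g"
  let ?A = "\<lambda>i j. mconst (?h $$ (i - 1, j - 1)) :: 'a mpoly"
  let ?cs = "[1..<1 + n]"
  have set: "set ?cs = {1..n}" by auto
  have act: "act_form n g (top_form n 1) = prod_list (map (\<lambda>i. \<Sum>j\<in>{1..n}. ?A i j *e dx j) ?cs)"
    unfolding top_form_eq_ordered_prod
    by (subst act_form_ordered_prod_dx)
       (simp_all only: row_form_def[abs_def] sorted_list_of_set_range finite_atLeastLessThan
          atLeastLessThanSuc_atLeastAtMost[symmetric] plus_1_eq_Suc)
  show "ecoeff (act_form n g (top_form n 1)) K = ecoeff (mconst (det ?h) *e top_form n 1) K"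
  proof (cases "K = {1..n}")
    case True
    interpret comm_ring_hom "mconst :: 'a \<Rightarrow> 'a mpoly" by standard simp_all
    have "ecoeff (act_form n g (top_form n 1)) {1..n} = det (mat n n (\<lambda>(r, c). ?A (1 + r) (?cs ! c)))"
      using ecoeff_prod_linear_det[OF _ sorted_wrt_upt, of "{1..n}" 1 "1 + n" ?A 1]
      unfolding act set length_upt diff_add_inverse by (simp only: finite_atLeastAtMost order_refl)
    also have "mat n n (\<lambda>(r, c). ?A (1 + r) (?cs ! c)) = map_mat mconst ?h"
      by (rule eq_matI) (use h in \<open>auto simp del: upt_Suc\<close>)
    finally show ?thesis using True by (simp add: ecoeff_top_form)
  next
    case False
    have "act_form n g (top_form n 1) \<in> forms_over UNIV {1..n}"
      unfolding act
      by (intro forms_over_prod_list forms_over_sum forms_over_escale forms_over_dx) (auto simp: polys_in_def)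
    moreover have "has_degree n (act_form n g (top_form n 1))"
      using has_degree_prod_linear[of ?cs ?A "{1..n}"] unfolding act length_upt diff_add_inverse .
    ultimately have "ecoeff (act_form n g (top_form n 1)) K = 0"
      using False card_subset_eq[of "{1..n}" K] by (force simp: forms_over_def has_degree_def)
    then show ?thesis using False by (simp add: ecoeff_top_form)
  qed
qed

lemma ecoeff_act_form_fixed_dx:
  assumes u: "u \<in> forms_over W V" and row: "\<And>i. i \<in> V \<Longrightarrow> row_form n (inv\<^bsub>GL n\<^esub> g) i = dx i"
  shows "ecoeff (act_form n g u) K = act_poly n g (ecoeff u K)"
proof (cases "finite K")
  case True
  have "act_form n g u = (\<Sum>I | ecoeff u I \<noteq> 0. act_poly n g (ecoeff u I) *e ordered_prod dx I)"
    unfolding act_form_def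
  proof (rule sum.cong[OF refl])
    fix I assume "I \<in> {I. ecoeff u I \<noteq> 0}"
    then have "I \<subseteq> V" "finite I" using forms_over_support[OF u] ecoeff_infinite by blast+
    then have "map (row_form n (inv\<^bsub>GL n\<^esub> g)) (sorted_list_of_set I) = map dx (sorted_list_of_set I)"
      using row by auto
    then show "act_poly n g (ecoeff u I) *e ordered_prod (row_form n (inv\<^bsub>GL n\<^esub> g)) I
        = act_poly n g (ecoeff u I) *e ordered_prod dx I" by (simp only:)
  qed
  then have "ecoeff (act_form n g u) K = (\<Sum>I | ecoeff u I \<noteq> 0. act_poly n g (ecoeff u I) * ecoeff (ordered_prod dx I) K)"
    by simp
  also have "\<dots> = (\<Sum>I | ecoeff u I \<noteq> 0. if I = K then act_poly n g (ecoeff u K) else 0)"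
  proof (rule sum.cong[OF refl])
    fix I assume "I \<in> {I. ecoeff u I \<noteq> 0}"
    then have "finite I" using ecoeff_infinite by blast
    then show "act_poly n g (ecoeff u I) * ecoeff (ordered_prod dx I) K
        = (if I = K then act_poly n g (ecoeff u K) else 0)"
      by (simp add: ecoeff_ordered_prod_dx)
  qed
  also have "\<dots> = act_poly n g (ecoeff u K)"
    by (simp add: act_poly_hom)
  finally show ?thesis .
qed (simp add: ecoeff_infinite act_poly_hom)

lemma act_form_forms_over:
  assumes u: "u \<in> forms_over W V"
    and "\<And>i. i \<in> W \<Longrightarrow> row_poly n (inv\<^bsub>GL n\<^esub> g) i \<in> polys_in W"
    and "\<And>i. i \<in> V \<Longrightarrow> row_form n (inv\<^bsub>GL n\<^esub> g) i \<in> forms_over W V"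
  shows "act_form n g u \<in> forms_over W V"
  unfolding act_form_def
proof (intro forms_over_sum forms_over_escale forms_over_prod_list)
  fix I i assume I: "I \<in> {I. ecoeff u I \<noteq> 0}"
  show "act_poly n g (ecoeff u I) \<in> polys_in W"
    unfolding act_poly_def by (rule psubst_polys_in) (use assms in \<open>auto simp: forms_over_def\<close>)
  assume "i \<in> set (sorted_list_of_set I)"
  moreover have "finite I" "I \<subseteq> V" using I forms_over_support[OF u] ecoeff_infinite by blast+
  ultimately show "row_form n (inv\<^bsub>GL n\<^esub> g) i \<in> forms_over W V"
    using assms(3) by auto
qed

lemma act_poly_cong:
  assumes "p \<in> polys_in W"
    and "\<And>i. i \<in> W \<Longrightarrow> row_poly n (inv\<^bsub>GL n\<^esub> g) i = row_poly n (inv\<^bsub>GL n\<^esub> g') i"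
  shows "act_poly n g p = act_poly n g' p"
  unfolding act_poly_def by (rule psubst_cong[OF assms])

lemma act_form_cong:
  assumes u: "u \<in> forms_over W V"
    and poly: "\<And>i. i \<in> W \<Longrightarrow> row_poly n (inv\<^bsub>GL n\<^esub> g) i = row_poly n (inv\<^bsub>GL n\<^esub> g') i"
    and form: "\<And>i. i \<in> V \<Longrightarrow> row_form n (inv\<^bsub>GL n\<^esub> g) i = row_form n (inv\<^bsub>GL n\<^esub> g') i"
  shows "act_form n g u = act_form n g' u"
  unfolding act_form_def
proof (rule sum.cong[OF refl])
  fix I assume I: "I \<in> {I. ecoeff u I \<noteq> 0}"
  have "act_poly n g (ecoeff u I) = act_poly n g' (ecoeff u I)"
    by (rule act_poly_cong[of _ W]) (use u poly in \<open>auto simp: forms_over_def\<close>)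
  moreover have "map (row_form n (inv\<^bsub>GL n\<^esub> g)) (sorted_list_of_set I) = map (row_form n (inv\<^bsub>GL n\<^esub> g')) (sorted_list_of_set I)"
  proof (rule map_cong[OF refl])
    have "finite I" "I \<subseteq> V" using I forms_over_support[OF u] ecoeff_infinite by blast+
    then show "row_form n (inv\<^bsub>GL n\<^esub> g) i = row_form n (inv\<^bsub>GL n\<^esub> g') i"
      if "i \<in> set (sorted_list_of_set I)" for i using that form by auto
  qed
  ultimately show "act_poly n g (ecoeff u I) *e ordered_prod (row_form n (inv\<^bsub>GL n\<^esub> g)) I
      = act_poly n g' (ecoeff u I) *e ordered_prod (row_form n (inv\<^bsub>GL n\<^esub> g')) I" by (simp only:)
qed

section \<open>Inverses of block matrices\<close>

lemma GL_inv_eqI: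
  fixes g h :: "'a::field mat"
  assumes "g \<in> carrier_mat n n" "h \<in> carrier_mat n n" "g * h = 1\<^sub>m n" "h * g = 1\<^sub>m n"
  shows "inv\<^bsub>GL n\<^esub> g = h"
proof -
  interpret ring "ring_mat TYPE('a) n ()" by (rule ring_mat)
  interpret GL: group "GL n :: 'a mat monoid" unfolding GL_def by (rule units_group)
  have "g \<in> carrier (GL n)" "h \<in> carrier (GL n)"
    using assms by (auto simp: GL_def units_of_carrier Units_def ring_mat_simps)
  moreover have "h \<otimes>\<^bsub>GL n\<^esub> g = \<one>\<^bsub>GL n\<^esub>"
    using assms by (simp add: GL_def units_of_mult units_of_one ring_mat_simps)
  ultimately show ?thesis using GL.inv_equality by blast
qed

lemma SL_inv:
  fixes g :: "'a::field mat"
  assumes "g \<in> carrier (SL n)"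
  shows "g \<in> carrier_mat n n" "inv\<^bsub>GL n\<^esub> g \<in> carrier_mat n n" "g * inv\<^bsub>GL n\<^esub> g = 1\<^sub>m n"
    "inv\<^bsub>GL n\<^esub> g * g = 1\<^sub>m n" "det (inv\<^bsub>GL n\<^esub> g) = 1"
proof -
  have g: "g \<in> Units (ring_mat TYPE('a) n ())" "det g = 1"
    using assms by (simp_all add: SL_def GL_def units_of_carrier)
  then obtain h where h: "h \<in> carrier_mat n n" "g * h = 1\<^sub>m n" "h * g = 1\<^sub>m n"
    by (auto simp: Units_def ring_mat_simps)
  show c: "g \<in> carrier_mat n n" using g by (auto simp: Units_def ring_mat_simps)
  have inv: "inv\<^bsub>GL n\<^esub> g = h" by (rule GL_inv_eqI[OF c h])
  have "det g * det h = 1" using det_mult[OF c h(1)] h(2) by simp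
  then show "inv\<^bsub>GL n\<^esub> g \<in> carrier_mat n n" "g * inv\<^bsub>GL n\<^esub> g = 1\<^sub>m n"
    "inv\<^bsub>GL n\<^esub> g * g = 1\<^sub>m n" "det (inv\<^bsub>GL n\<^esub> g) = 1"
    using h g inv by simp_all
qed

lemma index_block_matrix:
  assumes "m \<in> carrier_mat 1 (n - 1)" "h \<in> carrier_mat (n - 1) (n - 1)" "i < n" "j < n"
  shows "block_matrix n m h $$ (i, j) = (if i = 0 then if j = 0 then 1 else m $$ (0, j - 1)
    else if j = 0 then 0 else h $$ (i - 1, j - 1))"
  using assms by (auto simp: block_matrix_def)

lemma block_matrix_carrier:
  assumes "m \<in> carrier_mat 1 (n - 1)" "h \<in> carrier_mat (n - 1) (n - 1)" "1 \<le> n"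
  shows "block_matrix n m h \<in> carrier_mat n n"
  using four_block_carrier_mat[of "1\<^sub>m 1" 1 1 h "n - 1" "n - 1"] assms by (simp add: block_matrix_def)

lemma block_matrix_mult:
  fixes m m' :: "'a::field mat"
  assumes "m \<in> carrier_mat 1 (n - 1)" "h \<in> carrier_mat (n - 1) (n - 1)"
    "m' \<in> carrier_mat 1 (n - 1)" "h' \<in> carrier_mat (n - 1) (n - 1)"
  shows "block_matrix n m h * block_matrix n m' h' = block_matrix n (m' + m * h') (h * h')"
  unfolding block_matrix_def using assms
  by (subst mult_four_block_mat[of _ 1 1 _ "n - 1" _ "n - 1" _ _ 1 _ "n - 1"]) auto

text \<open>The action reads rows of the inverse, so its block shape is what later computations use.
  The corner is the solution m' of m' + m h = 0.\<close>

lemma inv_block_matrix: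
  fixes g :: "'a::field mat"
  assumes g: "g \<in> carrier (SL (n - 1))" and m: "m \<in> carrier_mat 1 (n - 1)" and "1 \<le> n"
  defines "h \<equiv> inv\<^bsub>GL (n - 1)\<^esub> g"
  shows "inv\<^bsub>GL n\<^esub> (block_matrix n m g) = block_matrix n (- (m * h)) h"
proof -
  note c = SL_inv[OF g, folded h_def]
  have one: "block_matrix n (0\<^sub>m 1 (n - 1)) (1\<^sub>m (n - 1)) = (1\<^sub>m n :: 'a mat)"
    using four_block_one_mat[of 1 "n - 1"] assms(3) by (simp add: block_matrix_def)
  have mh: "m * h \<in> carrier_mat 1 (n - 1)" "- (m * h) \<in> carrier_mat 1 (n - 1)" using m c by auto
  have 1: "- (m * h) + m * h = 0\<^sub>m 1 (n - 1)"
    using mh(1) by (rule uminus_l_inv_mat)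
  have 2: "m + - (m * h) * g = 0\<^sub>m 1 (n - 1)"
  proof -
    have "- (m * h) * g = - (m * h * g)" by (rule uminus_mult_left_mat) (use mh c in auto)
    also have "m * h * g = m" using m c by (simp add: assoc_mult_mat[of m 1 "n - 1" h "n - 1" g "n - 1"])
    finally show ?thesis using m by (intro eq_matI) auto
  qed
  have "block_matrix n m g * block_matrix n (- (m * h)) h = 1\<^sub>m n"
    "block_matrix n (- (m * h)) h * block_matrix n m g = 1\<^sub>m n"
    unfolding block_matrix_mult[OF m c(1) mh(2) c(2)] block_matrix_mult[OF mh(2) c(2) m c(1)] 1 2 c(3,4)
    by (rule one)+
  then show ?thesis
    using c(1,2) m mh(2) assms(3) by (intro GL_inv_eqI block_matrix_carrier)
qed

lemma det_block_matrix:
  fixes m :: "'a::field mat"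
  assumes "m \<in> carrier_mat 1 (n - 1)" "h \<in> carrier_mat (n - 1) (n - 1)"
  shows "det (block_matrix n m h) = det h"
  unfolding block_matrix_def
  by (subst det_four_block_mat_lower_left_zero_col[of _ _ "n - 1"]) (use assms in auto)

section \<open>Expansion in powers of the orbit product\<close>

declare One_nat_def [simp del]

text \<open>Lower rows start with 0. Variables are numbered from 2 and entries of the lower block
  from 0, hence the shift by 2.\<close>

lemma row_block_matrix:
  assumes "m \<in> carrier_mat 1 (n - 1)" "h \<in> carrier_mat (n - 1) (n - 1)" "i \<in> {2..n}"
  shows "row_poly n (block_matrix n m h) i = (\<Sum>j\<in>{2..n}. mconst (h $$ (i - 2, j - 2)) * mvar j)"
    and "row_form n (block_matrix n m h) i = (\<Sum>j\<in>{2..n}. mconst (h $$ (i - 2, j - 2)) *e dx j)"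
proof -
  have "{1..n} = insert 1 {2..n}" using assms(3) by auto
  moreover have "block_matrix n m h $$ (i - 1, 0) = 0"
    using assms by (subst index_block_matrix) auto
  moreover have "block_matrix n m h $$ (i - 1, j - 1) = h $$ (i - 2, j - 2)" if "j \<in> {2..n}" for j
    using assms that by (subst index_block_matrix) (auto simp: numeral_2_eq_2)
  ultimately show "row_poly n (block_matrix n m h) i = (\<Sum>j\<in>{2..n}. mconst (h $$ (i - 2, j - 2)) * mvar j)"
    "row_form n (block_matrix n m h) i = (\<Sum>j\<in>{2..n}. mconst (h $$ (i - 2, j - 2)) *e dx j)"
    by (simp_all add: row_poly_def row_form_def escale_simps)
qed

lemma row_block_matrix_1:
  assumes "m \<in> carrier_mat 1 (n - 1)" "h \<in> carrier_mat (n - 1) (n - 1)" "1 \<le> n"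
  shows "row_poly n (block_matrix n m h) 1 = mvar 1 + (\<Sum>j\<in>{2..n}. mconst (m $$ (0, j - 2)) * mvar j)"
    and "row_form n (block_matrix n m h) 1 = dx 1 + (\<Sum>j\<in>{2..n}. mconst (m $$ (0, j - 2)) *e dx j)"
proof -
  have "{1..n} = insert 1 {2..n}" using assms(3) by auto
  moreover have "block_matrix n m h $$ (0, 0) = 1"
    using assms by (subst index_block_matrix) auto
  moreover have "block_matrix n m h $$ (0, j - 1) = m $$ (0, j - 2)" if "j \<in> {2..n}" for j
    using assms that by (subst index_block_matrix) (auto simp: numeral_2_eq_2)
  ultimately show "row_poly n (block_matrix n m h) 1 = mvar 1 + (\<Sum>j\<in>{2..n}. mconst (m $$ (0, j - 2)) * mvar j)"
    "row_form n (block_matrix n m h) 1 = dx 1 + (\<Sum>j\<in>{2..n}. mconst (m $$ (0, j - 2)) *e dx j)"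
    by (simp_all add: row_poly_def row_form_def escale_simps)
qed

lemma has_degree_0_eq: "has_degree 0 w \<Longrightarrow> w = ecoeff w {} *e 1"
proof (rule exterior_eqI)
  fix I assume *: "has_degree 0 w"
  have "ecoeff w I = 0" if "I \<noteq> {}"
    using * that ecoeff_infinite[of I w] by (cases "finite I") (auto simp: has_degree_def)
  then show "ecoeff w I = ecoeff (ecoeff w {} *e 1) I" by (simp add: one_exterior.rep_eq)
qed

lemma foldr_milnor_top_form:
  "foldr milnor [0..<Suc n - a] (top_form n a) = moore n a *e 1"
  unfolding moore_def
  by (rule has_degree_0_eq, rule has_degree_foldr_milnor) (simp add: has_degree_top_form)

lemma milnor_set_act_form:
  fixes u :: "'a::{field, finite} mpoly exterior"
  assumes q: "prime p" "card (UNIV :: 'a set) = p ^ k"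
  shows "milnor_set I (act_form n g u) = act_form n g (milnor_set I u)"
  unfolding milnor_set_def by (rule foldr_milnor_act_form[OF q])

lemma partial_dx_top_form:
  assumes "1 \<le> n"
  shows "partial_dx 1 (top_form n 1) = (top_form n 2 :: 'r::comm_ring_1 exterior)"
proof -
  have "top_form n 1 = dx 1 * (top_form n 2 :: 'r exterior)"
    using top_form_step[OF assms] by (simp add: numeral_2_eq_2)
  moreover have "partial_dx 1 (top_form n 2 :: 'r exterior) = 0"
    unfolding partial_dx_eq_0_iff by (auto simp: ecoeff_top_form)
  ultimately show ?thesis by (simp add: contract_dx_times escale_simps)
qed

lemma partial_dx_milnor_set:
  "partial_dx i (milnor_set I u) = (- 1) ^ card I *e milnor_set I (partial_dx i u)"
  unfolding milnor_set_def partial_dx_foldr_milnor by simp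

text \<open>\<open>x\<^sub>1\<close>-translates: the action on \<open>P\<^sub>n\<close> of the matrices with \<open>g\<^sub>1 = 1\<close>.\<close>

abbreviation translate :: "'a::comm_ring_1 mpoly \<Rightarrow> 'a mpoly \<Rightarrow> 'a mpoly" where
  "translate v \<equiv> psubst (mvar(1 := mvar 1 + v))"

text \<open>Multiplies up the orbit of x_1 under translations. By \<open>moore_step\<close> it is
  also a quotient of two Moore determinants, from which its invariance is derived.\<close>

definition orbit_prod :: "nat \<Rightarrow> 'a::{field, finite} mpoly" where
  "orbit_prod n = \<Prod>(monic_linear_forms n 1)"

lemma orbit_prod_polys_in: "1 \<le> n \<Longrightarrow> orbit_prod n \<in> polys_in {1..n}"
  unfolding orbit_prod_def
proof (rule polys_in_prod)
  fix w :: "'a mpoly" assume n: "1 \<le> n" and "w \<in> monic_linear_forms n 1"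
  then obtain v where v: "w = mvar 1 + v" "v \<in> linear_forms {Suc 1..n}" by (auto simp: monic_linear_forms_def)
  have "v \<in> polys_in {1..n}" using linear_forms_polys_in[OF v(2)] polys_in_mono[of "{Suc 1..n}" "{1..n}"] by auto
  then show "w \<in> polys_in {1..n}" unfolding v using n by (intro polys_in_intros) auto
qed

lemma orbit_prod_nonzero: "orbit_prod n \<noteq> (0 :: 'a::{field, finite} mpoly)"
  using univ_poly_prod_monic_linear_forms(1)[of 1 n, where 'a = 'a] unfolding orbit_prod_def by auto

lemma psubst_1_0_orbit_prod: "psubst (mvar(1 := 0)) (orbit_prod n :: 'a::{field, finite} mpoly) = 0"
proof -
  have "mvar 1 \<in> (monic_linear_forms n 1 :: 'a mpoly set)"
    using linear_forms_0[of "{Suc 1..n}"] by (force simp: monic_linear_forms_def)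
  then have "mvar 1 dvd (orbit_prod n :: 'a mpoly)"
    unfolding orbit_prod_def by (rule dvd_prod_eqI[OF finite_monic_linear_forms]) simp
  then show ?thesis by (auto simp: psubst_mult)
qed

lemma psubst_id_on: "q \<in> polys_in V \<Longrightarrow> a \<notin> V \<Longrightarrow> psubst (mvar(a := r)) q = q"
  by (subst psubst_cong[of q V "mvar(a := r)" mvar]) (auto simp: psubst_id)

text \<open>At x_1 = 0 the orbit product vanishes while the coefficients are unchanged, so
  \<open>c 0 = 0\<close>; cancelling one factor leaves a shorter relation.\<close>

lemma orbit_prod_expansion_unique:
  fixes c :: "nat \<Rightarrow> 'a::{field, finite} mpoly"
  assumes "\<And>k. k < N \<Longrightarrow> c k \<in> polys_in {2..n}" "(\<Sum>k<N. c k * orbit_prod n ^ k) = 0" "k < N"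
  shows "c k = 0"
  using assms
proof (induction N arbitrary: c k)
  case (Suc N)
  let ?z = "psubst (mvar(1 := 0)) :: 'a mpoly \<Rightarrow> 'a mpoly"
  have eq: "c 0 + orbit_prod n * (\<Sum>k<N. c (Suc k) * orbit_prod n ^ k) = 0"
    using Suc.prems(2) unfolding sum.lessThan_Suc_shift by (simp add: sum_distrib_left mult_ac)
  have "?z (c 0) = 0"
    using arg_cong[OF eq, of ?z] by (simp add: psubst_add psubst_mult psubst_1_0_orbit_prod)
  moreover have "?z (c 0) = c 0" using Suc.prems(1)[of 0] by (intro psubst_id_on) auto
  ultimately have c0: "c 0 = 0" by simp
  then have sum0: "(\<Sum>k<N. c (Suc k) * orbit_prod n ^ k) = 0"
    using eq orbit_prod_nonzero[of n, where 'a = 'a] by simp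
  from sum0 have "c (Suc k) = 0" if "k < N" for k
    using Suc.prems(1) that by (intro Suc.IH[of "\<lambda>k. c (Suc k)" k]) auto
  then show ?case using c0 Suc.prems(3) by (cases k) simp_all
qed simp

text \<open>By invariance \<open>p\<close> takes the same value at every x_1 = - v as at x_1 = 0.
  Subtracting that value gives a multiple of the orbit product, and the quotient is invariant of
  smaller degree in x_1. Coefficients from \<open>N\<close> on are 0 so that expansions can be
  padded to a common length.\<close>

lemma translation_invariant_expansion:
  fixes p :: "'a::{field, finite} mpoly"
  assumes "1 \<le> n" and orbit: "\<And>v. v \<in> linear_forms {2..n} \<Longrightarrow> translate v (orbit_prod n) = (orbit_prod n :: 'a mpoly)"
    and "p \<in> polys_in {1..n}" "\<And>v. v \<in> linear_forms {2..n} \<Longrightarrow> translate v p = p"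
  shows "\<exists>N c. (\<forall>k. c k \<in> polys_in {2..n}) \<and> (\<forall>k\<ge>N. c k = 0) \<and> p = (\<Sum>k<N. c k * orbit_prod n ^ k)"
  using assms(3,4)
proof (induction "degree (univ_poly 1 p)" arbitrary: p rule: less_induct)
  case less
  let ?z = "psubst (mvar(1 := 0)) :: 'a mpoly \<Rightarrow> 'a mpoly" and ?O = "orbit_prod n :: 'a mpoly"
  have z: "?z p \<in> polys_in {2..n}"
    by (rule psubst_polys_in[OF less.prems(1)]) (auto intro: polys_in_mvar)
  have "w dvd p - ?z p" if w: "w \<in> monic_linear_forms n 1" for w
  proof -
    obtain v where v: "w = mvar 1 + v" "v \<in> linear_forms {2..n}"
      using w by (auto simp: monic_linear_forms_def numeral_2_eq_2)
    have v': "v \<in> polys_in {2..n}" by (rule linear_forms_polys_in[OF v(2)])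
    \<comment> \<open>Setting x_1 = - v is translation by - v followed by x_1 = 0.\<close>
    have "psubst (mvar(1 := - v)) p = ?z (translate (- v) p)"
    proof -
      have "?z v = v" using v' by (rule psubst_id_on) simp
      then have "(\<lambda>i. ?z ((mvar(1 := mvar 1 + - v)) i)) = mvar(1 := - v)"
        by (auto simp: fun_eq_iff psubst_diff)
      then show ?thesis unfolding psubst_psubst by simp
    qed
    also have "translate (- v) p = p"
      by (rule less.prems(2)[OF linear_forms_uminus[OF v(2)]])
    finally have 1: "psubst (mvar(1 := - v)) p = ?z p" .
    have 2: "psubst (mvar(1 := - v)) (?z p) = ?z p"
      by (rule psubst_id_on[OF z]) simp
    have "psubst (mvar(1 := - v)) (p - ?z p) = 0"
      unfolding psubst_diff 1 2 by simp
    then show ?thesis unfolding v(1) using v' by (subst mvar_plus_dvd_iff[of _ "{2..n}"]) auto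
  qed
  then have "?O dvd p - ?z p"
    unfolding orbit_prod_def by (intro prod_monic_linear_forms_dvd) (auto intro: finite_monic_linear_forms)
  then obtain r where r: "p - ?z p = ?O * r" ..
  show ?case
  proof (cases "r = 0")
    case True
    then have "p = (\<Sum>k<Suc 0. (if k = 0 then ?z p else 0) * ?O ^ k)" using r by simp
    then show ?thesis
      using z by (intro exI[of _ "Suc 0"] exI[of _ "\<lambda>k. if k = 0 then ?z p else 0"]) auto
  next
    case False
    have r1: "r \<in> polys_in {1..n}"
    proof (rule polys_in_cancel)
      show "?O * r \<in> polys_in {1..n}"
        using less.prems(1) z polys_in_mono[of "{2..n}" "{1..n}"] by (auto simp flip: r intro: polys_in_diff)
    qed (use orbit_prod_polys_in[OF \<open>1 \<le> n\<close>] orbit_prod_nonzero in auto)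
    have r2: "translate v r = r" if v: "v \<in> linear_forms {2..n}" for v
    proof -
      have "?O * translate v r = translate v (p - ?z p)" by (simp add: r psubst_mult orbit[OF v])
      also have "translate v (?z p) = ?z p" by (rule psubst_id_on[OF z]) simp
      then have "translate v (p - ?z p) = p - ?z p" by (simp only: psubst_diff less.prems(2)[OF v])
      also note r
      finally show ?thesis using orbit_prod_nonzero[of n, where 'a = 'a] by simp
    qed
    have p: "p = ?O * r + ?z p" using r by (simp add: algebra_simps)
    have "univ_poly 1 (?z p) = [:?z p:]" by (rule univ_poly_const[OF z]) simp
    then have "univ_poly 1 p = univ_poly 1 ?O * univ_poly 1 r + [:?z p:]"
      using arg_cong[OF p, of "univ_poly 1"] by (simp only: univ_poly_mult univ_poly_add)
    moreover have "degree (univ_poly 1 ?O * univ_poly 1 r) = degree (univ_poly 1 ?O) + degree (univ_poly 1 r)"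
      using False orbit_prod_nonzero[of n, where 'a = 'a] poly_univ_poly[of 1 r] poly_univ_poly[of 1 ?O]
      by (intro degree_mult_eq) auto
    moreover have "0 < degree (univ_poly 1 ?O)"
      unfolding orbit_prod_def univ_poly_prod_monic_linear_forms(2) by (simp add: finite_UNIV_card_ge_0)
    ultimately have "degree (univ_poly 1 r) < degree (univ_poly 1 p)"
      by (simp add: degree_add_eq_left)
    from less.hyps[OF this r1 r2] obtain N c where c: "\<And>k. c k \<in> polys_in {2..n}" "\<And>k. k \<ge> N \<Longrightarrow> c k = 0"
      and rc: "r = (\<Sum>k<N. c k * ?O ^ k)" by blast
    let ?c = "\<lambda>k. case k of 0 \<Rightarrow> ?z p | Suc k \<Rightarrow> c k"
    have "p = ?z p + ?O * r" by (rule trans[OF p add.commute])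
    also have "\<dots> = (\<Sum>k<Suc N. ?c k * ?O ^ k)"
      unfolding sum.lessThan_Suc_shift by (simp add: rc sum_distrib_left mult_ac)
    finally have "p = (\<Sum>k<Suc N. ?c k * ?O ^ k)" .
    moreover have "?c k \<in> polys_in {2..n}" for k using z c by (cases k) auto
    moreover have "?c k = 0" if "k \<ge> Suc N" for k using that c by (cases k) auto
    ultimately show ?thesis by blast
  qed
qed

lemma orbit_prod_form_expansion_unique:
  fixes U :: "nat \<Rightarrow> 'a::{field, finite} mpoly exterior"
  assumes U: "\<And>k. k < N \<Longrightarrow> U k \<in> forms_in {2..n}" and eq: "(\<Sum>k<N. orbit_prod n ^ k *e U k) = 0" and "k < N"
  shows "U k = 0"
proof (rule exterior_eqI)
  fix K
  have "(\<Sum>k<N. ecoeff (U k) K * orbit_prod n ^ k) = 0"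
    using arg_cong[OF eq, of "\<lambda>u. ecoeff u K"] by (simp add: mult.commute)
  then show "ecoeff (U k) K = ecoeff 0 K"
    using orbit_prod_expansion_unique[of N "\<lambda>k. ecoeff (U k) K" n k] U \<open>k < N\<close>
    by (simp add: forms_in_def)
qed

lemma translation_invariant_form_expansion:
  fixes u :: "'a::{field, finite} mpoly exterior"
  assumes n: "1 \<le> n" and orbit: "\<And>v. v \<in> linear_forms {2..n} \<Longrightarrow> translate v (orbit_prod n) = (orbit_prod n :: 'a mpoly)"
    and u: "u \<in> forms_over {1..n} {2..n}"
    and inv: "\<And>v K. v \<in> linear_forms {2..n} \<Longrightarrow> translate v (ecoeff u K) = ecoeff u K"
  shows "\<exists>N U. (\<forall>k. U k \<in> forms_in {2..n}) \<and> u = (\<Sum>k<N. orbit_prod n ^ k *e U k)"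
proof -
  let ?O = "orbit_prod n :: 'a mpoly"
  have "\<forall>K. \<exists>N c. (\<forall>k. c k \<in> polys_in {2..n}) \<and> (\<forall>k\<ge>N. c k = 0) \<and> ecoeff u K = (\<Sum>k<N. c k * ?O ^ k)"
  proof
    fix K
    have "ecoeff u K \<in> polys_in {1..n}" using u by (simp add: forms_over_def)
    then show "\<exists>N c. (\<forall>k. c k \<in> polys_in {2..n}) \<and> (\<forall>k\<ge>N. c k = 0) \<and> ecoeff u K = (\<Sum>k<N. c k * ?O ^ k)"
      by (intro translation_invariant_expansion[OF n] orbit inv)
  qed
  from choice[OF this] obtain N where "\<forall>K. \<exists>c. (\<forall>k. c k \<in> polys_in {2..n}) \<and> (\<forall>k\<ge>N K. c k = 0)
      \<and> ecoeff u K = (\<Sum>k<N K. c k * ?O ^ k)" ..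
  from choice[OF this] obtain c where "\<forall>K. (\<forall>k. c K k \<in> polys_in {2..n}) \<and> (\<forall>k\<ge>N K. c K k = 0)
      \<and> ecoeff u K = (\<Sum>k<N K. c K k * ?O ^ k)" ..
  then have c: "\<And>K k. c K k \<in> polys_in {2..n}" "\<And>K k. k \<ge> N K \<Longrightarrow> c K k = 0"
    "\<And>K. ecoeff u K = (\<Sum>k<N K. c K k * ?O ^ k)" by blast+
  \<comment> \<open>A common bound for the lengths of all coordinate expansions.\<close>
  define M where "M = (\<Sum>K\<in>Pow {2..n}. N K)"
  define U where "U k = (\<Sum>K\<in>Pow {2..n}. c K k *e ordered_prod dx K)" for k
  have ext: "ecoeff u K = (\<Sum>k<M. c K k * ?O ^ k)" if "K \<in> Pow {2..n}" for K
  proof -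
    have "N K \<le> M" unfolding M_def by (rule member_le_sum) (use that in auto)
    then have "(\<Sum>k<N K. c K k * ?O ^ k) = (\<Sum>k<M. c K k * ?O ^ k)"
      using c(2)[of K] by (intro sum.mono_neutral_left) auto
    then show ?thesis by (simp add: c(3))
  qed
  have "u = (\<Sum>K\<in>Pow {2..n}. ecoeff u K *e ordered_prod dx K)"
    by (rule exterior_expansion) (use forms_over_support[OF u] in auto)
  also have "\<dots> = (\<Sum>K\<in>Pow {2..n}. (\<Sum>k<M. c K k * ?O ^ k) *e ordered_prod dx K)"
    by (rule sum.cong[OF refl]) (simp only: ext)
  also have "\<dots> = (\<Sum>k<M. ?O ^ k *e U k)"
  proof -
    have "(\<Sum>k<M. f k) *e w = (\<Sum>k<M. f k *e w)" for f :: "nat \<Rightarrow> 'a mpoly" and w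
      by (induction M) (simp_all add: escale_simps)
    then show ?thesis
      unfolding U_def escale_sum by (subst sum.swap) (simp add: escale_simps mult.commute)
  qed
  finally have "u = (\<Sum>k<M. ?O ^ k *e U k)" .
  moreover have "U k \<in> forms_in {2..n}" for k
    unfolding U_def forms_in_eq_forms_over
  proof (intro forms_over_sum forms_over_escale c forms_over_prod_list forms_over_dx)
    fix K i assume "K \<in> Pow {2..n}" "i \<in> set (sorted_list_of_set K)"
    then show "i \<in> {2..n}" using finite_subset[of K "{2..n}"] by auto
  qed
  ultimately show ?thesis by blast
qed

section \<open>Invariants of the extended group\<close>

lemma poly_invariants_closed:
  shows "1 \<in> poly_invariants n V H"
    and "x \<in> poly_invariants n V H \<Longrightarrow> y \<in> poly_invariants n V H \<Longrightarrow> x - y \<in> poly_invariants n V H"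
    and "x \<in> poly_invariants n V H \<Longrightarrow> y \<in> poly_invariants n V H \<Longrightarrow> x * y \<in> poly_invariants n V H"
    and "x \<in> poly_invariants n V H \<Longrightarrow> y \<in> poly_invariants n V H \<Longrightarrow> x + y \<in> poly_invariants n V H"
    and "0 \<in> poly_invariants n V H"
  unfolding poly_invariants_def
  by (simp_all add: act_poly_hom act_poly_diff polys_in_diff polys_in_mult polys_in_add)

lemma poly_invariants_sum:
  "(\<And>a. a \<in> A \<Longrightarrow> f a \<in> poly_invariants n V H) \<Longrightarrow> (\<Sum>a\<in>A. f a) \<in> poly_invariants n V H"
  by (induction A rule: infinite_finite_induct) (simp_all add: poly_invariants_closed)

lemma poly_invariants_power: "x \<in> poly_invariants n V H \<Longrightarrow> x ^ j \<in> poly_invariants n V H"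
  by (induction j) (simp_all add: poly_invariants_closed)

lemma form_invariants_closed:
  shows "0 \<in> form_invariants n V H"
    and "u \<in> form_invariants n V H \<Longrightarrow> w \<in> form_invariants n V H \<Longrightarrow> u + w \<in> form_invariants n V H"
    and "u \<in> form_invariants n V H \<Longrightarrow> w \<in> form_invariants n V H \<Longrightarrow> u - w \<in> form_invariants n V H"
    and "x \<in> poly_invariants n V H \<Longrightarrow> u \<in> form_invariants n V H \<Longrightarrow> x *e u \<in> form_invariants n V H"
  unfolding form_invariants_def forms_in_eq_forms_over poly_invariants_def
  by (simp_all add: act_form_0 act_form_add act_form_diff act_form_escale
      forms_over_add forms_over_diff forms_over_escale)

lemma form_invariants_sum:
  "(\<And>a. a \<in> A \<Longrightarrow> f a \<in> form_invariants n V H) \<Longrightarrow> (\<Sum>a\<in>A. f a) \<in> form_invariants n V H"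
  by (induction A rule: infinite_finite_induct) (simp_all add: form_invariants_closed)

text \<open>\<open>G\<^sub>1'\<close> is \<open>G\<^sub>1\<close> embedded as block-diagonal
  matrices of size n, so that both invariant rings refer to one and the same action.\<close>

locale parabolic_extension =
  fixes p k n :: nat and G\<^sub>1 G G\<^sub>1' :: "'a::{field, finite} mat set"
  assumes prime_p: "prime p" and card_field: "card (UNIV :: 'a set) = p ^ k" and two_le_n: "2 \<le> n"
    and subgroup: "subgroup G\<^sub>1 (SL (n - 1))"
    and G: "G = {block_matrix n m g\<^sub>1 | m g\<^sub>1. m \<in> carrier_mat 1 (n - 1) \<and> g\<^sub>1 \<in> G\<^sub>1}"
    and G': "G\<^sub>1' = {block_matrix n (0\<^sub>m 1 (n - 1)) g\<^sub>1 | g\<^sub>1. g\<^sub>1 \<in> G\<^sub>1}"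
begin

lemmas q = prime_p card_field

lemma G1_SL: "g \<in> G\<^sub>1 \<Longrightarrow> g \<in> carrier (SL (n - 1))"
  using subgroup.subset[OF subgroup] by blast

text \<open>The inverses of \<open>g\<close> and of its block-diagonal part \<open>g'\<close> share
  the lower block \<open>h\<close>, which is all that the action on x_2, ..., x_n sees.\<close>

lemma G_elem:
  assumes "g \<in> G"
  obtains m h g' where "m \<in> carrier_mat 1 (n - 1)" "h \<in> carrier_mat (n - 1) (n - 1)" "det h = 1"
    "inv\<^bsub>GL n\<^esub> g = block_matrix n m h" "g' \<in> G\<^sub>1'" "inv\<^bsub>GL n\<^esub> g' = block_matrix n (0\<^sub>m 1 (n - 1)) h"
proof -
  obtain m g\<^sub>1 where g: "g = block_matrix n m g\<^sub>1" "m \<in> carrier_mat 1 (n - 1)" "g\<^sub>1 \<in> G\<^sub>1"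
    using assms unfolding G by blast
  let ?h = "inv\<^bsub>GL (n - 1)\<^esub> g\<^sub>1"
  note h = SL_inv[OF G1_SL[OF g(3)]]
  have n: "1 \<le> n" using two_le_n by simp
  have "- (0\<^sub>m 1 (n - 1) * ?h) = 0\<^sub>m 1 (n - 1)"
    using h(2) by (intro eq_matI) auto
  then have "inv\<^bsub>GL n\<^esub> (block_matrix n (0\<^sub>m 1 (n - 1)) g\<^sub>1) = block_matrix n (0\<^sub>m 1 (n - 1)) ?h"
    using inv_block_matrix[OF G1_SL[OF g(3)] zero_carrier_mat n] by (simp only:)
  moreover have "block_matrix n (0\<^sub>m 1 (n - 1)) g\<^sub>1 \<in> G\<^sub>1'" using g(3) unfolding G' by blast
  moreover have "- (m * ?h) \<in> carrier_mat 1 (n - 1)" using g(2) h(2) by auto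
  ultimately show ?thesis
    using that h(2,5) inv_block_matrix[OF G1_SL[OF g(3)] g(2) n] g(1) by blast
qed

lemma G'_subset_G: "G\<^sub>1' \<subseteq> G"
  unfolding G G' using zero_carrier_mat by blast

lemma translation:
  obtains t where "t \<in> G"
    "row_poly n (inv\<^bsub>GL n\<^esub> t) 1 = mvar 1 + (\<Sum>j\<in>{2..n}. mconst (c j) * mvar j)"
    "row_form n (inv\<^bsub>GL n\<^esub> t) 1 = dx 1 + (\<Sum>j\<in>{2..n}. mconst (c j) *e dx j)"
    "\<And>i. i \<in> {2..n} \<Longrightarrow> row_poly n (inv\<^bsub>GL n\<^esub> t) i = mvar i"
    "\<And>i. i \<in> {2..n} \<Longrightarrow> row_form n (inv\<^bsub>GL n\<^esub> t) i = dx i"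
proof -
  \<comment> \<open>Column \<open>j\<close> belongs to x_(j+2). The group element carries the
    negative of this row because the action uses the inverse.\<close>
  let ?m = "mat 1 (n - 1) (\<lambda>(r, j). c (j + 2))" and ?I = "1\<^sub>m (n - 1) :: 'a mat"
  let ?t = "block_matrix n (- ?m) ?I"
  have n: "1 \<le> n" using two_le_n by simp
  have I: "?I \<in> G\<^sub>1" using subgroup.one_closed[OF subgroup]
    by (simp add: SL_def GL_def units_of_one ring_mat_simps)
  have m: "?m \<in> carrier_mat 1 (n - 1)" "- ?m \<in> carrier_mat 1 (n - 1)" by auto
  then have t: "?t \<in> G" using I unfolding G by blast
  have inv_I: "inv\<^bsub>GL (n - 1)\<^esub> ?I = ?I" by (rule GL_inv_eqI) auto
  have "- (- ?m * ?I) = ?m" using m by (simp add: right_mult_one_mat)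
  then have inv: "inv\<^bsub>GL n\<^esub> ?t = block_matrix n ?m ?I"
    using inv_block_matrix[OF G1_SL[OF I] m(2) n] unfolding inv_I by (simp only:)
  note Ic = one_carrier_mat[of "n - 1"]
  have entry: "mconst (?I $$ (i - 2, j - 2)) = (if j = i then 1 else 0 :: 'a mpoly)"
    if "i \<in> {2..n}" "j \<in> {2..n}" for i j
  proof -
    have "i - 2 < n - 1" "j - 2 < n - 1" "i - 2 = j - 2 \<longleftrightarrow> j = i" using that by auto
    then show ?thesis by simp
  qed
  have c: "?m $$ (0, j - 2) = c j" if "j \<in> {2..n}" for j
  proof -
    have "j - 2 < n - 1" "j - 2 + 2 = j" using that by auto
    then show ?thesis by (subst index_mat) (simp_all only: prod.case zero_less_one)
  qed
  have poly: "row_poly n (block_matrix n ?m ?I) i = mvar i" if "i \<in> {2..n}" for i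
  proof -
    have "row_poly n (block_matrix n ?m ?I) i = (\<Sum>j\<in>{2..n}. if j = i then mvar i else 0)"
      unfolding row_block_matrix(1)[OF m(1) Ic that]
    proof (rule sum.cong[OF refl])
      fix j assume "j \<in> {2..n}"
      from entry[OF that this] show "mconst (?I $$ (i - 2, j - 2)) * mvar j = (if j = i then mvar i else 0 :: 'a mpoly)"
        by (simp only:) simp
    qed
    then show ?thesis using that by simp
  qed
  have form: "row_form n (block_matrix n ?m ?I) i = dx i" if "i \<in> {2..n}" for i
  proof -
    have "row_form n (block_matrix n ?m ?I) i = (\<Sum>j\<in>{2..n}. if j = i then dx i else 0)"
      unfolding row_block_matrix(2)[OF m(1) Ic that]
    proof (rule sum.cong[OF refl])
      fix j assume "j \<in> {2..n}"
      from entry[OF that this] show "mconst (?I $$ (i - 2, j - 2)) *e dx j = (if j = i then dx i else 0 :: 'a mpoly exterior)"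
        by (simp only:) (simp add: escale_simps)
    qed
    then show ?thesis using that by simp
  qed
  show ?thesis
  proof (rule that[OF t])
    show "row_poly n (inv\<^bsub>GL n\<^esub> ?t) 1 = mvar 1 + (\<Sum>j\<in>{2..n}. mconst (c j) * mvar j)"
      unfolding inv row_block_matrix_1(1)[OF m(1) Ic n] using c by (intro arg_cong2[of _ _ _ _ "(+)"] sum.cong) simp_all
    show "row_form n (inv\<^bsub>GL n\<^esub> ?t) 1 = dx 1 + (\<Sum>j\<in>{2..n}. mconst (c j) *e dx j)"
      unfolding inv row_block_matrix_1(2)[OF m(1) Ic n] using c by (intro arg_cong2[of _ _ _ _ "(+)"] sum.cong) simp_all
  qed (unfold inv, simp_all only: poly form)
qed

lemma act_poly_translation:
  assumes "row_poly n (inv\<^bsub>GL n\<^esub> t) 1 = mvar 1 + v" "\<And>i. i \<in> {2..n} \<Longrightarrow> row_poly n (inv\<^bsub>GL n\<^esub> t) i = mvar i"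
    and "r \<in> polys_in {1..n}"
  shows "act_poly n t r = translate v r"
  unfolding act_poly_def
proof (rule psubst_cong[OF assms(3)])
  fix i assume i: "i \<in> {1..n}"
  show "row_poly n (inv\<^bsub>GL n\<^esub> t) i = (mvar(1 := mvar 1 + v)) i"
  proof (cases "i = 1")
    case False
    then have "i \<in> {2..n}" using i by auto
    then show ?thesis using assms(2) False by simp
  qed (simp add: assms(1))
qed

lemma rows_equal:
  assumes "inv\<^bsub>GL n\<^esub> g = block_matrix n m h" "inv\<^bsub>GL n\<^esub> g' = block_matrix n m' h" "i \<in> {2..n}"
    "m \<in> carrier_mat 1 (n - 1)" "m' \<in> carrier_mat 1 (n - 1)" "h \<in> carrier_mat (n - 1) (n - 1)"
  shows "row_poly n (inv\<^bsub>GL n\<^esub> g) i = row_poly n (inv\<^bsub>GL n\<^esub> g') i"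
    "row_form n (inv\<^bsub>GL n\<^esub> g) i = row_form n (inv\<^bsub>GL n\<^esub> g') i"
  using assms row_block_matrix[of m n h i] row_block_matrix[of m' n h i] by simp_all

lemma act_agrees:
  assumes "g \<in> G"
  obtains g' where "g' \<in> G\<^sub>1'" "\<And>r. r \<in> polys_in {2..n} \<Longrightarrow> act_poly n g r = act_poly n g' r"
    "\<And>u. u \<in> forms_in {2..n} \<Longrightarrow> act_form n g u = act_form n g' u"
proof -
  obtain m h g' where *: "m \<in> carrier_mat 1 (n - 1)" "h \<in> carrier_mat (n - 1) (n - 1)"
    "inv\<^bsub>GL n\<^esub> g = block_matrix n m h" "g' \<in> G\<^sub>1'" "inv\<^bsub>GL n\<^esub> g' = block_matrix n (0\<^sub>m 1 (n - 1)) h"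
    using G_elem[OF assms] by metis
  note rows = rows_equal[OF *(3,5) _ *(1) zero_carrier_mat *(2)]
  show ?thesis
  proof (rule that[OF *(4)])
    show "act_poly n g r = act_poly n g' r" if "r \<in> polys_in {2..n}" for r
      by (rule act_poly_cong[OF that rows(1)])
    show "act_form n g u = act_form n g' u" if "u \<in> forms_in {2..n}" for u
      by (rule act_form_cong[OF that[unfolded forms_in_eq_forms_over] rows])
  qed
qed

lemma G_rows_closed:
  assumes "g \<in> G" "i \<in> {2..n}"
  shows "row_poly n (inv\<^bsub>GL n\<^esub> g) i \<in> polys_in {2..n}" "row_form n (inv\<^bsub>GL n\<^esub> g) i \<in> forms_over {2..n} {2..n}"
proof -
  obtain m h where *: "m \<in> carrier_mat 1 (n - 1)" "h \<in> carrier_mat (n - 1) (n - 1)" "inv\<^bsub>GL n\<^esub> g = block_matrix n m h"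
    using G_elem[OF assms(1)] by metis
  show "row_poly n (inv\<^bsub>GL n\<^esub> g) i \<in> polys_in {2..n}"
    unfolding *(3) row_block_matrix(1)[OF *(1,2) assms(2)] by (intro polys_in_intros polys_in_mconst)
  show "row_form n (inv\<^bsub>GL n\<^esub> g) i \<in> forms_over {2..n} {2..n}"
    unfolding *(3) row_block_matrix(2)[OF *(1,2) assms(2)]
    by (intro forms_over_sum forms_over_escale polys_in_mconst forms_over_dx)
qed

lemma act_poly_closed: "r \<in> polys_in {2..n} \<Longrightarrow> g \<in> G \<Longrightarrow> act_poly n g r \<in> polys_in {2..n}"
  unfolding act_poly_def by (rule psubst_polys_in) (auto intro: G_rows_closed)

lemma act_form_closed: "u \<in> forms_in {2..n} \<Longrightarrow> g \<in> G \<Longrightarrow> act_form n g u \<in> forms_in {2..n}"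
  unfolding forms_in_eq_forms_over by (rule act_form_forms_over) (auto intro: G_rows_closed)

text \<open>The first column of the inverse is (1, 0, ..., 0), so dx_1 occurs in g dx_i with
  coefficient 1 for i = 1 and 0 otherwise.\<close>

lemma partial_dx_act_form:
  assumes "g \<in> G" "u \<in> forms_in {1..n}"
  shows "partial_dx 1 (act_form n g u) = act_form n g (partial_dx 1 u)"
proof (rule contract_act_form)
  show "u \<in> forms_over UNIV {1..n}"
    using assms(2) forms_over_mono[of "{1..n}" UNIV "{1..n}" "{1..n}"] by (auto simp: forms_in_eq_forms_over)
  obtain m h where *: "m \<in> carrier_mat 1 (n - 1)" "h \<in> carrier_mat (n - 1) (n - 1)" "inv\<^bsub>GL n\<^esub> g = block_matrix n m h"
    using G_elem[OF assms(1)] by metis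
  fix i assume i: "i \<in> {1..n}"
  have "(\<Sum>j\<in>{1..n}. mconst ((inv\<^bsub>GL n\<^esub> g) $$ (i - 1, j - 1)) * (if j = 1 then 1 else 0))
      = (\<Sum>j\<in>{1..n}. if j = 1 then mconst ((inv\<^bsub>GL n\<^esub> g) $$ (i - 1, 0)) else 0 :: 'a mpoly)"
    by (rule sum.cong) auto
  also have "\<dots> = mconst (block_matrix n m h $$ (i - 1, 0))"
    using two_le_n by (simp add: *(3))
  also have "block_matrix n m h $$ (i - 1, 0) = (if i = 1 then 1 else 0)"
    using i by (subst index_block_matrix[OF *(1,2)]) auto
  also have "mconst (if i = 1 then 1 else 0) = act_poly n g (if i = 1 then 1 else 0)"
    by (simp add: act_poly_hom)
  finally show "(\<Sum>j\<in>{1..n}. mconst ((inv\<^bsub>GL n\<^esub> g) $$ (i - 1, j - 1)) * (if j = 1 then 1 else 0))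
      = act_poly n g (if i = 1 then 1 else 0)" .
qed

lemma top_form_invariant: "g \<in> G \<Longrightarrow> act_form n g (top_form n 1) = top_form n 1"
proof -
  assume "g \<in> G"
  then obtain m h where *: "m \<in> carrier_mat 1 (n - 1)" "h \<in> carrier_mat (n - 1) (n - 1)" "det h = 1"
    "inv\<^bsub>GL n\<^esub> g = block_matrix n m h"
    using G_elem by metis
  have "inv\<^bsub>GL n\<^esub> g \<in> carrier_mat n n"
    unfolding *(4) using two_le_n by (intro block_matrix_carrier * ) simp
  moreover have "det (inv\<^bsub>GL n\<^esub> g) = 1"
    unfolding *(4) det_block_matrix[OF *(1,2)] by (rule *(3))
  ultimately show ?thesis by (simp add: act_form_top_form escale_simps)
qed

lemma top_form_2_invariant: "g \<in> G \<Longrightarrow> act_form n g (top_form n 2) = top_form n 2"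
  using partial_dx_act_form[of g "top_form n 1"] partial_dx_top_form[of n, where 'r = "'a mpoly"]
    two_le_n top_form_forms_over[of n 1 "{1..n}", where 'a = 'a]
  by (simp add: forms_in_eq_forms_over top_form_invariant)

text \<open>The determinant, as a scalar form, arises from the top form by operations that commute
  with the action.\<close>

lemma moore_invariant:
  fixes g :: "'a mat"
  assumes "act_form n g (top_form n a) = top_form n a"
  shows "act_poly n g (moore n a) = moore n a"
proof -
  have "act_form n g (moore n a *e 1) = moore n a *e 1"
    using foldr_milnor_act_form[OF q, of "[0..<Suc n - a]" n g "top_form n a"]
    unfolding assms foldr_milnor_top_form by simp
  then have "act_poly n g (moore n a) *e 1 = moore n a *e 1"
    by (simp only: act_form_escale act_form_1)
  from arg_cong[OF this, of "\<lambda>u. ecoeff u {}"] show ?thesis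
    by (simp add: one_exterior.rep_eq)
qed

text \<open>Both Moore determinants in the quotient are invariant, which spares following the
  permutation of the factors.\<close>

lemma orbit_prod_invariant:
  assumes "g \<in> G"
  shows "act_poly n g (orbit_prod n) = orbit_prod n"
proof -
  have step: "moore n 1 = orbit_prod n * (moore n 2 :: 'a mpoly)"
    using moore_step[OF q, of 1 n] two_le_n by (simp add: orbit_prod_def numeral_2_eq_2 One_nat_def)
  have "act_poly n g (moore n 1) = moore n 1" "act_poly n g (moore n 2) = moore n 2"
    using moore_invariant top_form_invariant top_form_2_invariant assms by blast+
  then have "act_poly n g (orbit_prod n) * moore n 2 = orbit_prod n * (moore n 2 :: 'a mpoly)"
    unfolding step act_poly_hom by simp
  then show ?thesis using moore_nonzero[OF q, of 2 n] two_le_n by simp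
qed

lemma poly_invariantD:
  assumes "r \<in> poly_invariants n {1..n} G" "v \<in> linear_forms {2..n}"
  shows "translate v r = r"
proof -
  obtain c where v: "v = (\<Sum>j\<in>{2..n}. mconst (c j) * mvar j)" using assms(2) by (auto simp: linear_forms_def)
  obtain t where t: "t \<in> G" "row_poly n (inv\<^bsub>GL n\<^esub> t) 1 = mvar 1 + v"
      "row_form n (inv\<^bsub>GL n\<^esub> t) 1 = dx 1 + (\<Sum>j\<in>{2..n}. mconst (c j) *e dx j)"
      "\<And>i. i \<in> {2..n} \<Longrightarrow> row_poly n (inv\<^bsub>GL n\<^esub> t) i = mvar i"
      "\<And>i. i \<in> {2..n} \<Longrightarrow> row_form n (inv\<^bsub>GL n\<^esub> t) i = dx i"
    by (rule translation[of c, folded v]) (rule that)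
  have r: "r \<in> polys_in {1..n}" "act_poly n t r = r" using assms(1) t(1) by (simp_all add: poly_invariants_def)
  have "act_poly n t r = translate v r"
    by (rule act_poly_translation[OF t(2) _ r(1)]) (rule t(4))
  then show ?thesis using r(2) by simp
qed

lemma orbit_prod_poly_invariant: "orbit_prod n \<in> poly_invariants n {1..n} G"
  using orbit_prod_polys_in[of n] two_le_n orbit_prod_invariant by (simp add: poly_invariants_def)

lemmas translate_orbit_prod = poly_invariantD[OF orbit_prod_poly_invariant]

lemma poly_invariants_mono: "poly_invariants n {2..n} G\<^sub>1' \<subseteq> poly_invariants n {1..n} G"
proof
  fix r assume r: "r \<in> poly_invariants n {2..n} G\<^sub>1'"
  have "act_poly n g r = r" if g: "g \<in> G" for g
  proof -
    obtain g' where "g' \<in> G\<^sub>1'" "\<And>r. r \<in> polys_in {2..n} \<Longrightarrow> act_poly n g r = act_poly n g' r"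
      "\<And>u. u \<in> forms_in {2..n} \<Longrightarrow> act_form n g u = act_form n g' u"
      by (rule act_agrees[OF g]) (rule that)
    then show ?thesis using r by (simp add: poly_invariants_def)
  qed
  then show "r \<in> poly_invariants n {1..n} G"
    using r polys_in_mono[of "{2..n}" "{1..n}"] by (auto simp: poly_invariants_def)
qed

lemma form_invariants_mono: "form_invariants n {2..n} G\<^sub>1' \<subseteq> form_invariants n {1..n} G"
proof
  fix u assume u: "u \<in> form_invariants n {2..n} G\<^sub>1'"
  have "act_form n g u = u" if g: "g \<in> G" for g
  proof -
    obtain g' where "g' \<in> G\<^sub>1'" "\<And>r. r \<in> polys_in {2..n} \<Longrightarrow> act_poly n g r = act_poly n g' r"
      "\<And>u. u \<in> forms_in {2..n} \<Longrightarrow> act_form n g u = act_form n g' u"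
      by (rule act_agrees[OF g]) (rule that)
    then show ?thesis using u by (simp add: form_invariants_def)
  qed
  then show "u \<in> form_invariants n {1..n} G"
    using u forms_over_mono[of "{2..n}" "{1..n}" "{2..n}" "{1..n}"]
    by (auto simp: form_invariants_def forms_in_eq_forms_over)
qed

lemma milnor_top_form_invariant: "milnor_set I (top_form n 1) \<in> form_invariants n {1..n} G"
  using foldr_milnor_forms_over[OF order_refl top_form_forms_over[of n 1], where xs = "sorted_list_of_set I" and 'a = 'a]
  by (simp add: form_invariants_def forms_in_eq_forms_over top_form_invariant flip: milnor_set_def milnor_set_act_form[OF q])

lemma partial_dx_milnor_top_form:
  "partial_dx 1 (milnor_set I (top_form n 1)) = (- 1) ^ card I *e milnor_set I (top_form n 2 :: 'a mpoly exterior)"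
  using partial_dx_top_form[of n, where 'r = "'a mpoly"] two_le_n by (simp add: partial_dx_milnor_set)

lemma partial_dx_2: "u \<in> forms_in {2..n} \<Longrightarrow> partial_dx 1 u = 0"
  unfolding partial_dx_eq_0_iff by (force simp: forms_in_def)

lemma partial_dx_forms_over:
  assumes "a \<in> forms_over {1..n} {1..n}"
  shows "partial_dx 1 a \<in> forms_over {1..n} {2..n}"
proof -
  have "partial_dx 1 a \<in> forms_over {1..n} {1..n}"
    by (rule forms_over_contract[OF _ assms]) simp
  moreover have "1 \<notin> K" if "ecoeff (partial_dx 1 a) K \<noteq> 0" for K
    using that by (auto simp: ecoeff_partial_dx)
  moreover have "K \<subseteq> {2..n}" if "K \<subseteq> {1..n}" "1 \<notin> K" for K
  proof
    fix x assume "x \<in> K"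
    then have "x \<in> {1..n}" "x \<noteq> 1" using that by auto
    then show "x \<in> {2..n}" by auto
  qed
  ultimately show ?thesis unfolding forms_over_def by blast
qed

lemma kernel_partial_dx_forms_over:
  assumes "a \<in> forms_over {1..n} {1..n}" "partial_dx 1 a = 0"
  shows "a \<in> forms_over {1..n} {2..n}"
proof -
  have "K \<subseteq> {2..n}" if "ecoeff a K \<noteq> 0" for K
  proof
    fix x assume "x \<in> K"
    then have "x \<in> {1..n}" "x \<noteq> 1"
      using that assms forms_over_support[OF assms(1)] unfolding partial_dx_eq_0_iff by blast+
    then show "x \<in> {2..n}" by auto
  qed
  then show ?thesis using assms(1) unfolding forms_over_def by blast
qed

text \<open>For a translation \<open>t\<close> by \<open>w\<close> with differential \<open>\<theta>\<close>, comparing the parts without \<open>dx\<^sub>1\<close> of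
  \<open>t a = a\<close> gives \<open>t \<alpha> - \<alpha> = - \<theta> \<beta>\<close> where \<open>a = \<alpha> + dx\<^sub>1 \<beta>\<close>, and \<open>w\<close> divides the left side.\<close>

lemma dvd_form_linear_times_partial_dx:
  assumes a: "a \<in> form_invariants n {1..n} G"
  shows "dvd_form (\<Sum>j\<in>{2..n}. mconst (c j) * mvar j) ((\<Sum>j\<in>{2..n}. mconst (c j) *e dx j) * partial_dx 1 a)"
proof -
  let ?w = "\<Sum>j\<in>{2..n}. mconst (c j) * mvar j" and ?\<theta> = "\<Sum>j\<in>{2..n}. mconst (c j) *e dx j" and ?\<beta> = "partial_dx 1 a"
  obtain t where t: "t \<in> G" "row_poly n (inv\<^bsub>GL n\<^esub> t) 1 = mvar 1 + ?w" "row_form n (inv\<^bsub>GL n\<^esub> t) 1 = dx 1 + ?\<theta>"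
    "\<And>i. i \<in> {2..n} \<Longrightarrow> row_poly n (inv\<^bsub>GL n\<^esub> t) i = mvar i"
    "\<And>i. i \<in> {2..n} \<Longrightarrow> row_form n (inv\<^bsub>GL n\<^esub> t) i = dx i"
    by (rule translation[of c]) (rule that)
  have a1: "a \<in> forms_over {1..n} {1..n}" and ta: "act_form n t a = a"
    using a t(1) by (simp_all add: form_invariants_def forms_in_eq_forms_over)
  have t\<beta>: "act_form n t ?\<beta> = ?\<beta>"
    using partial_dx_act_form[OF t(1), of a] a1 ta by (simp add: forms_in_eq_forms_over)
  define \<alpha> where "\<alpha> = a - dx 1 * ?\<beta>"
  have "partial_dx 1 \<alpha> = 0"
    by (simp add: \<alpha>_def contract_diff contract_dx_times contract_contract escale_simps)
  moreover have "\<alpha> \<in> forms_over {1..n} {1..n}"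
    unfolding \<alpha>_def using partial_dx_forms_over[OF a1] forms_over_mono[of "{1..n}" "{1..n}" "{2..n}" "{1..n}"] two_le_n
    by (intro forms_over_diff forms_over_times forms_over_dx a1) auto
  ultimately have \<alpha>: "\<alpha> \<in> forms_over {1..n} {2..n}" by (intro kernel_partial_dx_forms_over)
  have "a = act_form n t \<alpha> + (dx 1 + ?\<theta>) * ?\<beta>"
    using ta t\<beta> by (simp add: \<alpha>_def act_form_diff act_form_times act_form_dx_row t(3) del: One_nat_def)
  then have eq: "?\<theta> * ?\<beta> = \<alpha> - act_form n t \<alpha>"
    by (simp add: \<alpha>_def algebra_simps)
  show ?thesis
    unfolding dvd_form_def
  proof
    fix K
    let ?r = "ecoeff \<alpha> K"
    have r: "?r \<in> polys_in {1..n}" using \<alpha> by (simp add: forms_over_def)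
    have "act_poly n t ?r = translate ?w ?r"
      by (rule act_poly_translation[OF t(2) _ r]) (rule t(4))
    moreover have "ecoeff (act_form n t \<alpha>) K = act_poly n t ?r"
      by (rule ecoeff_act_form_fixed_dx[OF \<alpha>]) (rule t(5))
    ultimately have "ecoeff (?\<theta> * ?\<beta>) K = psubst mvar ?r - translate ?w ?r"
      unfolding eq ecoeff_minus psubst_id by (simp only:)
    also have "?w dvd \<dots>" by (rule dvd_psubst_diff) simp
    finally show "?w dvd ecoeff (?\<theta> * ?\<beta>) K" .
  qed
qed

lemma moore_dvd_partial_dx:
  assumes a: "a \<in> form_invariants n {1..n} G"
  shows "moore n 2 dvd ecoeff (milnor_set J (partial_dx 1 a)) {}"
proof (rule moore_dvd[OF q])
  show "2 \<le> Suc n" using two_le_n by simp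
  fix b and w :: "'a mpoly" assume b: "2 \<le> b" "b \<le> n" and w: "w \<in> monic_linear_forms n b"
  obtain c where c: "c b = 1" "w = (\<Sum>j\<in>{b..n}. mconst (c j) * mvar j)"
    using monic_linear_formsE[OF w b(2)] .
  \<comment> \<open>The form starts at x_b, whereas the translation is indexed by all of x_2, ...,
    x_n; the coefficients are extended by 0.\<close>
  let ?c = "\<lambda>j. if b \<le> j then c j else 0"
  have sub: "{b..n} \<subseteq> {2..n}" using b by auto
  have 1: "(\<Sum>j\<in>{2..n}. mconst (?c j) * mvar j) = w"
    unfolding c(2) by (rule sum.mono_neutral_cong_right[OF _ sub]) auto
  show "w dvd ecoeff (milnor_set J (partial_dx 1 a)) {}"
    using linear_form_dvd_foldr_milnor[OF q, of "{2..n}" b ?c "partial_dx 1 a" "sorted_list_of_set J"]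
      dvd_form_linear_times_partial_dx[OF a, of ?c] b c(1)
    unfolding 1 milnor_set_def by simp
qed

lemma partial_dx_span:
  assumes a: "a \<in> form_invariants n {1..n} G"
  obtains d where "\<And>I. I \<subseteq> {0..n - 2} \<Longrightarrow> d I \<in> poly_invariants n {1..n} G"
    "partial_dx 1 a = (\<Sum>I\<in>Pow {0..n - 2}. d I *e milnor_set I (top_form n 2))"
proof -
  \<comment> \<open>For \<mu> there are n - 1 operations Q_0, ..., Q_(n-2), matching the index range
    of the basis.\<close>
  have T: "{0..<Suc n - 2} = {0..n - 2}" using two_le_n by auto
  have a1: "a \<in> forms_over {1..n} {1..n}" using a by (simp add: form_invariants_def forms_in_eq_forms_over)
  have "{2..n} \<subseteq> {1..n}" by auto
  from milnor_top_forms_span[OF q two_le_n this partial_dx_forms_over[OF a1] moore_dvd_partial_dx[OF a]]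
  obtain d where d: "\<And>I. I \<subseteq> {0..n - 2} \<Longrightarrow> d I \<in> polys_in {1..n}"
    and eq: "partial_dx 1 a = (\<Sum>I\<in>Pow {0..n - 2}. d I *e milnor_set I (top_form n 2))"
    unfolding T by blast
  have "act_poly n g (d I) = d I" if g: "g \<in> G" and I: "I \<subseteq> {0..n - 2}" for g I
  proof -
    have "act_form n g a = a" using a g by (simp add: form_invariants_def)
    then have "act_form n g (partial_dx 1 a) = partial_dx 1 a"
      using partial_dx_act_form[OF g, of a] a1 by (simp add: forms_in_eq_forms_over)
    moreover have "act_form n g (milnor_set I (top_form n 2)) = milnor_set I (top_form n 2)" for I
      using milnor_set_act_form[OF q, of I n g "top_form n 2"] by (simp add: top_form_2_invariant[OF g])
    ultimately have "(\<Sum>I\<in>Pow {0..n - 2}. act_poly n g (d I) *e milnor_set I (top_form n 2))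
        = (\<Sum>I\<in>Pow {0..n - 2}. d I *e milnor_set I (top_form n 2))"
      unfolding eq by (simp add: act_form_sum act_form_escale)
    then have "(\<Sum>I\<in>Pow {0..<Suc n - 2}. (act_poly n g (d I) - d I) *e milnor_set I (top_form n 2)) = 0"
      unfolding T diff_conv_add_uminus escale_simps sum.distrib sum_negf by simp
    from milnor_top_forms_independent[OF q two_le_n this, unfolded T, OF I] show ?thesis by simp
  qed
  then show ?thesis using that[of d] d eq by (simp add: poly_invariants_def)
qed

section \<open>Invariants expanded in powers of the orbit product\<close>

text \<open>Translations in \<open>G\<close> give the expansion. As the orbit product is invariant,
  elements of \<open>G\<^sub>1'\<close> act on the coefficients alone, and uniqueness shows that
  these are fixed.\<close>

lemma poly_invariant_expansion:
  assumes r: "r \<in> poly_invariants n {1..n} G"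
  obtains N c where "\<And>k. k < N \<Longrightarrow> c k \<in> poly_invariants n {2..n} G\<^sub>1'" "\<And>k. k \<ge> N \<Longrightarrow> c k = 0"
    "r = (\<Sum>k<N. c k * orbit_prod n ^ k)"
proof -
  have "1 \<le> n" using two_le_n by simp
  moreover have "r \<in> polys_in {1..n}" using r by (simp add: poly_invariants_def)
  ultimately obtain N c where c: "\<forall>k. c k \<in> polys_in {2..n}" "\<forall>k\<ge>N. c k = 0" and eq: "r = (\<Sum>k<N. c k * orbit_prod n ^ k)"
    using translation_invariant_expansion[of n r] translate_orbit_prod poly_invariantD[OF r] by blast
  have "act_poly n g (c k) = c k" if g: "g \<in> G\<^sub>1'" and "k < N" for g k
  proof -
    have gG: "g \<in> G" using g G'_subset_G by blast
    have "act_poly n g r = r" using r gG by (simp add: poly_invariants_def)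
    then have "(\<Sum>k<N. act_poly n g (c k) * orbit_prod n ^ k) = (\<Sum>k<N. c k * orbit_prod n ^ k)"
      unfolding eq by (simp add: act_poly_sum act_poly_hom act_poly_power orbit_prod_invariant[OF gG])
    then have "(\<Sum>k<N. (act_poly n g (c k) - c k) * orbit_prod n ^ k) = 0"
      by (simp add: left_diff_distrib sum_subtractf)
    then have "act_poly n g (c k) - c k = 0"
      using \<open>k < N\<close> c(1) act_poly_closed[OF _ gG]
      by (intro orbit_prod_expansion_unique[of N "\<lambda>k. act_poly n g (c k) - c k" n k]) (auto intro: polys_in_diff)
    then show ?thesis by simp
  qed
  then show ?thesis using that[of N c] c eq by (simp add: poly_invariants_def)
qed

text \<open>Translations fix dx_2, ..., dx_n, so in the absence of dx_1 they act coefficientwise and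
  each coefficient is translation invariant. Uniqueness again makes the coefficient forms
  invariant.\<close>

lemma form_invariant_expansion:
  assumes a: "a \<in> form_invariants n {1..n} G" and "partial_dx 1 a = 0"
  obtains N U where "\<And>k. k < N \<Longrightarrow> U k \<in> form_invariants n {2..n} G\<^sub>1'" "a = (\<Sum>k<N. orbit_prod n ^ k *e U k)"
proof -
  have a2: "a \<in> forms_over {1..n} {2..n}"
    using a assms(2) by (intro kernel_partial_dx_forms_over) (simp_all add: form_invariants_def forms_in_eq_forms_over)
  have coeff: "translate v (ecoeff a K) = ecoeff a K" if v: "v \<in> linear_forms {2..n}" for v K
  proof -
    obtain c where v: "v = (\<Sum>j\<in>{2..n}. mconst (c j) * mvar j)" using v by (auto simp: linear_forms_def)
  obtain t where t: "t \<in> G" "row_poly n (inv\<^bsub>GL n\<^esub> t) 1 = mvar 1 + v"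
      "row_form n (inv\<^bsub>GL n\<^esub> t) 1 = dx 1 + (\<Sum>j\<in>{2..n}. mconst (c j) *e dx j)"
      "\<And>i. i \<in> {2..n} \<Longrightarrow> row_poly n (inv\<^bsub>GL n\<^esub> t) i = mvar i"
      "\<And>i. i \<in> {2..n} \<Longrightarrow> row_form n (inv\<^bsub>GL n\<^esub> t) i = dx i"
    by (rule translation[of c, folded v]) (rule that)
    have r: "ecoeff a K \<in> polys_in {1..n}" using a2 by (simp add: forms_over_def)
    have "translate v (ecoeff a K) = act_poly n t (ecoeff a K)"
      by (rule act_poly_translation[OF t(2) _ r, symmetric]) (rule t(4))
    also have "\<dots> = ecoeff (act_form n t a) K"
      by (rule ecoeff_act_form_fixed_dx[OF a2 t(5), symmetric])
    also have "act_form n t a = a" using a t(1) by (simp add: form_invariants_def)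
    finally show ?thesis .
  qed
  have "1 \<le> n" using two_le_n by simp
  then have "\<exists>N U. (\<forall>k. U k \<in> forms_in {2..n}) \<and> a = (\<Sum>k<N. orbit_prod n ^ k *e U k)"
    by (intro translation_invariant_form_expansion translate_orbit_prod a2 coeff)
  then obtain N U where U: "\<And>k. U k \<in> forms_in {2..n}" and eq: "a = (\<Sum>k<N. orbit_prod n ^ k *e U k)" by blast
  have "act_form n g (U k) = U k" if g: "g \<in> G\<^sub>1'" and "k < N" for g k
  proof -
    have gG: "g \<in> G" using g G'_subset_G by blast
    have "act_form n g a = a" using a gG by (simp add: form_invariants_def)
    then have "(\<Sum>k<N. orbit_prod n ^ k *e act_form n g (U k)) = (\<Sum>k<N. orbit_prod n ^ k *e U k)"
      unfolding eq by (simp add: act_form_sum act_form_escale act_poly_power orbit_prod_invariant[OF gG])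
    then have "(\<Sum>k<N. orbit_prod n ^ k *e (act_form n g (U k) - U k)) = 0"
      unfolding diff_conv_add_uminus escale_simps escale_minus sum.distrib sum_negf by simp
    moreover have "act_form n g (U k) - U k \<in> forms_in {2..n}" for k
      using U act_form_closed[OF U gG] by (simp add: forms_in_eq_forms_over forms_over_diff)
    ultimately have "act_form n g (U k) - U k = 0"
      using \<open>k < N\<close> by (intro orbit_prod_form_expansion_unique[of N "\<lambda>k. act_form n g (U k) - U k" n k])
    then show ?thesis by simp
  qed
  then show ?thesis using that[of N U] U eq by (simp add: form_invariants_def)
qed

text \<open>\<partial> turns Q_I \<omega> into Q_I \<mu> up to sign, and the latter are independent
  over all polynomials.\<close>

lemma milnor_top_forms_cancel:
  assumes "partial_dx 1 (\<Sum>I\<in>Pow {0..n - 2}. d I *e milnor_set I (top_form n 1)) = 0" "I \<subseteq> {0..n - 2}"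
  shows "d I = (0 :: 'a mpoly)"
proof -
  have T: "{0..<Suc n - 2} = {0..n - 2}" using two_le_n by auto
  have "(\<Sum>I\<in>Pow {0..n - 2}. (d I * (- 1) ^ card I) *e milnor_set I (top_form n 2)) = 0"
    using assms(1)
    by (simp only: contract_sum contract_escale partial_dx_milnor_top_form escale_simps(3))
  from milnor_top_forms_independent[OF q two_le_n this[folded T], unfolded T, OF assms(2)]
  show ?thesis by simp
qed

lemma basis_spans:
  assumes span: "\<And>u. u \<in> form_invariants n {2..n} G\<^sub>1' \<Longrightarrow>
      \<exists>c. (\<forall>i\<in>A. c i \<in> poly_invariants n {2..n} G\<^sub>1') \<and> u = (\<Sum>i\<in>A. c i *e v i)"
    and u: "u \<in> form_invariants n {1..n} G"
  shows "\<exists>c d. (\<forall>i\<in>A. c i \<in> poly_invariants n {1..n} G) \<and> (\<forall>I\<in>Pow {0..n - 2}. d I \<in> poly_invariants n {1..n} G)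
    \<and> u = (\<Sum>i\<in>A. c i *e v i) + (\<Sum>I\<in>Pow {0..n - 2}. d I *e milnor_set I (top_form n 1))"
proof -
  obtain d where d: "\<And>I. I \<subseteq> {0..n - 2} \<Longrightarrow> d I \<in> poly_invariants n {1..n} G"
    and eq: "partial_dx 1 u = (\<Sum>I\<in>Pow {0..n - 2}. d I *e milnor_set I (top_form n 2))"
    by (rule partial_dx_span[OF u]) (rule that)
  \<comment> \<open>The sign undoes the one picked up when \<partial> moves past the operations in
    Q_I.\<close>
  define e where "e I = (- 1) ^ card I * d I" for I
  have "- 1 \<in> poly_invariants n {1..n} G"
    using poly_invariants_closed(2)[OF poly_invariants_closed(5,1)] by simp
  then have e: "e I \<in> poly_invariants n {1..n} G" if "I \<subseteq> {0..n - 2}" for I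
    unfolding e_def by (intro poly_invariants_closed(3) poly_invariants_power d that)
  let ?m = "\<Sum>I\<in>Pow {0..n - 2}. e I *e milnor_set I (top_form n 1)"
  have "e I *e ((- 1) ^ card I *e w) = d I *e w" for I w
  proof -
    have "(- 1) ^ card I * ((- 1) ^ card I * x) = x" for x :: "'a mpoly"
      by (cases "even (card I)") simp_all
    then show ?thesis by (simp add: e_def escale_simps mult_ac)
  qed
  then have "partial_dx 1 ?m = partial_dx 1 u"
    unfolding eq by (simp only: contract_sum contract_escale partial_dx_milnor_top_form)
  then have "partial_dx 1 (u - ?m) = 0" by (simp add: contract_diff)
  moreover have "u - ?m \<in> form_invariants n {1..n} G"
    by (intro form_invariants_closed(3,4) u form_invariants_sum milnor_top_form_invariant e) auto
  ultimately obtain N U where U: "\<And>k. k < N \<Longrightarrow> U k \<in> form_invariants n {2..n} G\<^sub>1'"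
    and um: "u - ?m = (\<Sum>k<N. orbit_prod n ^ k *e U k)"
    using form_invariant_expansion by blast
  have "\<forall>k\<in>{..<N}. \<exists>c. (\<forall>i\<in>A. c i \<in> poly_invariants n {2..n} G\<^sub>1') \<and> U k = (\<Sum>i\<in>A. c i *e v i)"
    using span U by simp
  from bchoice[OF this] obtain c where c: "\<forall>k\<in>{..<N}. (\<forall>i\<in>A. c k i \<in> poly_invariants n {2..n} G\<^sub>1') \<and> U k = (\<Sum>i\<in>A. c k i *e v i)" ..
  \<comment> \<open>The contributions to \<open>v i\<close> are collected over all powers of the
    orbit product.\<close>
  let ?c = "\<lambda>i. \<Sum>k<N. orbit_prod n ^ k * c k i"
  have "u - ?m = (\<Sum>k<N. \<Sum>i\<in>A. (orbit_prod n ^ k * c k i) *e v i)"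
    unfolding um using c by (intro sum.cong) (simp_all add: escale_sum escale_simps(3))
  also have "\<dots> = (\<Sum>i\<in>A. ?c i *e v i)"
  proof -
    have "(\<Sum>k<N. f k) *e w = (\<Sum>k<N. f k *e w)" for f :: "nat \<Rightarrow> 'a mpoly" and w
      by (induction N) (simp_all add: escale_simps)
    then show ?thesis by (subst sum.swap) simp
  qed
  finally have u_eq: "u = (\<Sum>i\<in>A. ?c i *e v i) + ?m" by (simp only: diff_eq_eq)
  have c': "?c i \<in> poly_invariants n {1..n} G" if "i \<in> A" for i
    using c that poly_invariants_mono
    by (intro poly_invariants_sum poly_invariants_closed(3) poly_invariants_power orbit_prod_poly_invariant) auto
  show ?thesis
  proof (intro exI conjI ballI)
    show "u = (\<Sum>i\<in>A. ?c i *e v i) + ?m" by (rule u_eq)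
  qed (use c' e in blast)+
qed

text \<open>Expanding the coefficients in powers of the orbit product splits the relation: the form
  at each power involves only x_2, ..., x_n and their differentials, so it vanishes separately and
  is a relation to which \<open>indep\<close> applies.\<close>

lemma independent_over_invariants:
  assumes "finite A" and indep: "\<And>c. (\<And>i. i \<in> A \<Longrightarrow> c i \<in> poly_invariants n {2..n} G\<^sub>1') \<Longrightarrow>
      (\<Sum>i\<in>A. c i *e v i) = 0 \<Longrightarrow> \<forall>i\<in>A. c i = 0"
    and v: "\<And>i. i \<in> A \<Longrightarrow> v i \<in> form_invariants n {2..n} G\<^sub>1'"
    and c: "\<And>i. i \<in> A \<Longrightarrow> c i \<in> poly_invariants n {1..n} G" and eq: "(\<Sum>i\<in>A. c i *e v i) = 0" and "i \<in> A"
  shows "c i = 0"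
proof -
  have "\<forall>i\<in>A. \<exists>N e. (\<forall>k. e k \<in> poly_invariants n {2..n} G\<^sub>1') \<and> (\<forall>k\<ge>N. e k = 0) \<and> c i = (\<Sum>k<N. e k * orbit_prod n ^ k)"
  proof
    fix i assume "i \<in> A"
    then obtain N e where *: "\<And>k. k < N \<Longrightarrow> e k \<in> poly_invariants n {2..n} G\<^sub>1'" "\<And>k. k \<ge> N \<Longrightarrow> e k = 0"
      "c i = (\<Sum>k<N. e k * orbit_prod n ^ k)"
      using poly_invariant_expansion[OF c] by blast
    then have "e k \<in> poly_invariants n {2..n} G\<^sub>1'" for k
      using poly_invariants_closed(5)[of n "{2..n}" "G\<^sub>1'"] by (cases "k < N") simp_all
    then show "\<exists>N e. (\<forall>k. e k \<in> poly_invariants n {2..n} G\<^sub>1') \<and> (\<forall>k\<ge>N. e k = 0) \<and> c i = (\<Sum>k<N. e k * orbit_prod n ^ k)"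
      using * by blast
  qed
  from bchoice[OF this] obtain N where "\<forall>i\<in>A. \<exists>e. (\<forall>k. e k \<in> poly_invariants n {2..n} G\<^sub>1')
      \<and> (\<forall>k\<ge>N i. e k = 0) \<and> c i = (\<Sum>k<N i. e k * orbit_prod n ^ k)" ..
  from bchoice[OF this] obtain e where e: "\<forall>i\<in>A. (\<forall>k. e i k \<in> poly_invariants n {2..n} G\<^sub>1')
      \<and> (\<forall>k\<ge>N i. e i k = 0) \<and> c i = (\<Sum>k<N i. e i k * orbit_prod n ^ k)" ..
  define M where "M = (\<Sum>i\<in>A. N i)"
  have ext: "c i = (\<Sum>k<M. e i k * orbit_prod n ^ k)" if "i \<in> A" for i
  proof -
    have "N i \<le> M" unfolding M_def by (rule member_le_sum) (use that \<open>finite A\<close> in auto)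
    then have "(\<Sum>k<N i. e i k * orbit_prod n ^ k) = (\<Sum>k<M. e i k * orbit_prod n ^ k)"
      using e that by (intro sum.mono_neutral_left) auto
    then show ?thesis using e that by simp
  qed
  have "(\<Sum>k<M. orbit_prod n ^ k *e (\<Sum>i\<in>A. e i k *e v i)) = (\<Sum>i\<in>A. (\<Sum>k<M. e i k * orbit_prod n ^ k) *e v i)"
  proof -
    have "(\<Sum>k<M. f k) *e w = (\<Sum>k<M. f k *e w)" for f :: "nat \<Rightarrow> 'a mpoly" and w
      by (induction M) (simp_all add: escale_simps)
    then show ?thesis
      unfolding escale_sum by (subst sum.swap) (simp add: escale_simps mult.commute)
  qed
  also have "\<dots> = (\<Sum>i\<in>A. c i *e v i)" by (rule sum.cong[OF refl]) (simp only: ext)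
  finally have zero: "(\<Sum>k<M. orbit_prod n ^ k *e (\<Sum>i\<in>A. e i k *e v i)) = 0" by (simp only: eq)
  have "(\<Sum>i\<in>A. e i k *e v i) \<in> form_invariants n {2..n} G\<^sub>1'" for k
    using e v by (intro form_invariants_sum form_invariants_closed(4)) auto
  then have "(\<Sum>i\<in>A. e i k *e v i) \<in> forms_in {2..n}" for k
    by (simp add: form_invariants_def)
  then have zero_k: "(\<Sum>i\<in>A. e i k *e v i) = 0" if "k < M" for k
    by (rule orbit_prod_form_expansion_unique[OF _ zero that])
  have "e i k = 0" if "k < M" for k
  proof -
    have "\<forall>i\<in>A. e i k = 0"
      by (rule indep) (use e zero_k[OF that] in auto)
    then show ?thesis using \<open>i \<in> A\<close> by blast
  qed
  then show ?thesis using ext[OF \<open>i \<in> A\<close>] by simp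
qed

end

theorem theorem4p2:
  fixes p k n :: nat
    and G\<^sub>1 G G\<^sub>1' :: "'a::{field, finite} mat set"
    and f :: "nat \<Rightarrow> 'a mpoly"
    and v :: "nat \<Rightarrow> 'a mpoly exterior"
  assumes "prime p" and "odd p" and "card (UNIV :: 'a set) = p ^ k"
    and "n \<ge> 2"
    and "subgroup G\<^sub>1 (SL (n - 1))"
    and "G = {block_matrix n m g\<^sub>1 | m g\<^sub>1. m \<in> carrier_mat 1 (n - 1) \<and> g\<^sub>1 \<in> G\<^sub>1}"
    and "G\<^sub>1' = {block_matrix n (0\<^sub>m 1 (n - 1)) g\<^sub>1 | g\<^sub>1. g\<^sub>1 \<in> G\<^sub>1}"
    and "is_polynomial_algebra (poly_invariants n {2..n} G\<^sub>1') {2..n} f"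
    and "\<And>i. i \<in> {2..n} \<Longrightarrow> homogeneous (f i)"
    and "is_free_module (poly_invariants n {2..n} G\<^sub>1') (form_invariants n {2..n} G\<^sub>1')
           {1..2 ^ (n - 1)} v"
  shows "is_free_module (poly_invariants n {1..n} G) (form_invariants n {1..n} G)
           ({1..2 ^ (n - 1)} <+> Pow {0..n - 2})
           (case_sum v (\<lambda>I. milnor_set I (prod_list (map dx [1..<Suc n]))))"
proof -
  interpret parabolic_extension p k n G\<^sub>1 G G\<^sub>1'
    by (rule parabolic_extension.intro) (rule assms)+
  let ?S' = "poly_invariants n {2..n} G\<^sub>1'" and ?S = "poly_invariants n {1..n} G"
  let ?A = "{1..2 ^ (n - 1)} :: nat set" and ?B = "Pow {0..n - 2}"
  let ?b = "case_sum v (\<lambda>I. milnor_set I (top_form n 1))"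
  note free = assms(10)[unfolded is_free_module_def]
  have v: "v i \<in> form_invariants n {2..n} G\<^sub>1'" if "i \<in> ?A" for i using free that by blast
  have span: "\<exists>c. (\<forall>i\<in>?A. c i \<in> ?S') \<and> u = (\<Sum>i\<in>?A. c i *e v i)" if "u \<in> form_invariants n {2..n} G\<^sub>1'" for u
    using free that by blast
  have indep: "\<forall>i\<in>?A. c i = 0" if "\<And>i. i \<in> ?A \<Longrightarrow> c i \<in> ?S'" "(\<Sum>i\<in>?A. c i *e v i) = 0" for c
    using free that by blast
  have plus: "(\<Sum>i\<in>?A <+> ?B. c i *e ?b i)
      = (\<Sum>i\<in>?A. c (Inl i) *e v i) + (\<Sum>I\<in>?B. c (Inr I) *e milnor_set I (top_form n 1))" for c
    by (subst sum.Plus) simp_all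
  have "is_free_module ?S (form_invariants n {1..n} G) (?A <+> ?B) ?b"
    unfolding is_free_module_def
  proof (intro conjI ballI allI impI)
    show "1 \<in> ?S" by (rule poly_invariants_closed)
    show "x - y \<in> ?S" "x * y \<in> ?S" if "x \<in> ?S" "y \<in> ?S" for x y
      using that by (simp_all add: poly_invariants_closed)
    show "0 \<in> form_invariants n {1..n} G" by (rule form_invariants_closed)
    show "u + w \<in> form_invariants n {1..n} G" if "u \<in> form_invariants n {1..n} G" "w \<in> form_invariants n {1..n} G" for u w
      using that by (rule form_invariants_closed)
    show "x *e u \<in> form_invariants n {1..n} G" if "x \<in> ?S" "u \<in> form_invariants n {1..n} G" for x u
      using that by (rule form_invariants_closed)
    show "finite (?A <+> ?B)" by simp
    show "?b i \<in> form_invariants n {1..n} G" if "i \<in> ?A <+> ?B" for i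
      using that v form_invariants_mono milnor_top_form_invariant by (cases i) auto
  next
    fix u assume "u \<in> form_invariants n {1..n} G"
    from basis_spans[OF span this] obtain c d where cd: "\<forall>i\<in>?A. c i \<in> ?S" "\<forall>I\<in>?B. d I \<in> ?S"
      "u = (\<Sum>i\<in>?A. c i *e v i) + (\<Sum>I\<in>?B. d I *e milnor_set I (top_form n 1))" by blast
    show "\<exists>c. (\<forall>i\<in>?A <+> ?B. c i \<in> ?S) \<and> u = (\<Sum>i\<in>?A <+> ?B. c i *e ?b i)"
      using cd(1,2) by (intro exI[of _ "case_sum c d"] conjI ballI) (auto simp: plus cd(3))
  next
    fix c i assume c: "\<forall>i\<in>?A <+> ?B. c i \<in> ?S" and eq: "(\<Sum>i\<in>?A <+> ?B. c i *e ?b i) = 0" and i: "i \<in> ?A <+> ?B"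
    let ?s = "\<Sum>i\<in>?A. c (Inl i) *e v i"
    \<comment> \<open>Applying \<partial> separates the two families: the \<open>v i\<close>
      disappear and a relation among the Q_I \<mu> remains.\<close>
    have "partial_dx 1 (v i) = 0" if "i \<in> ?A" for i
      using v[OF that] by (intro partial_dx_2) (simp add: form_invariants_def)
    then have "partial_dx 1 (\<Sum>I\<in>?B. c (Inr I) *e milnor_set I (top_form n 1)) = 0"
      using arg_cong[OF eq, of "partial_dx 1"] unfolding plus contract_add
      by (simp add: contract_sum contract_escale escale_simps)
    then have Inr: "c (Inr I) = 0" if "I \<in> ?B" for I
      using milnor_top_forms_cancel[of "\<lambda>I. c (Inr I)" I] that by blast
    then have "?s = 0" using eq unfolding plus by (simp add: escale_simps)
    then have "c (Inl j) = 0" if "j \<in> ?A" for j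
      using c that by (intro independent_over_invariants[of ?A v "\<lambda>i. c (Inl i)" j] indep v) auto
    then show "c i = 0" using i Inr by auto
  qed
  then show ?thesis by (simp only: top_form_def)
qed

end
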